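(* Let $G(\lambda)=P(\lambda)+C(\lambda E-A)^{-1}B\in\mathbb{C}(\lambda)^{n\times n}$ with $P(\lambda)=\sum_{i=0}^m\lambda^iA_i$ an $n\times n$ matrix polynomial of degree $m\ge2$, $A,E\in\mathbb{C}^{r\times r}$, $E$ nonsingular, $C\in\mathbb{C}^{n\times r}$, $B\in\mathbb{C}^{r\times n}$, and let $\mathcal S(\lambda)=\left[\begin{array}{c|c}P(\lambda)&C\\ \hline B&A-\lambda E\end{array}\right]$. Let $$\mathbb{L}(\lambda)=\left[\begin{array}{c|c}L(\lambda)&e_{m-i_0(\sigma_1,\sigma)}\otimes C\\ \hline e_{m-c_0(\sigma,\sigma_2)}^T\otimes B&A-\lambda E\end{array}\right]$$ be an EGFP of $G(\lambda)$, where $L(\lambda)=M_{\tau_1}(Y_1)M_{\sigma_1}(X_1)(\lambda M^P_\tau-M^P_\sigma)M_{\sigma_2}(X_2)M_{\tau_2}(Y_2)$ is an EGFP of $P(\lambda)$ with $0\in\sigma$ and $-m\in\tau$. Let $Z(\lambda)=\begin{bmatrix}Z_{mn}(\lambda) \\ Z_r(\lambda)\end{bmatrix}$ be an $(mn+r)\times p$ matrix polynomial, where $Z_{mn}(\lambda)$ has $mn$ rows and $Z_r(\lambda)$ has $r$ rows. Then: (a) If $Z(\lambda)$ is a right (resp., left) minimal basis of $\mathbb{L}(\lambda)$, then $\begin{bmatrix}(e^T_{m-c_0(\sigma,\sigma_2)}\otimes I_n)Z_{mn}(\lambda) \\ Z_r(\lambda)\end{bmatrix}$ (resp., $\begin{bmatrix}(e^T_{m-i_0(\sigma_1,\sigma)}\otimes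 I_n)Z_{mn}(\lambda) \\ Z_r(\lambda)\end{bmatrix}$) is a right (resp., left) minimal basis of $\mathcal S(\lambda)$. (b) Write $\tau=(-\beta,-m,-\gamma)$ and set $\alpha=(\mathrm{rev}(\beta),\sigma,\mathrm{rev}(\gamma))$, a permutation of $\{0:m-1\}$. Let $c(\alpha)$ and $i(\alpha)$ be the total number of consecutions and inversions of $\alpha$. If $\varepsilon_1\le\cdots\le\varepsilon_p$ are the right (resp., left) minimal indices of $\mathbb{L}(\lambda)$, then $\varepsilon_1-i(\alpha)\le\cdots\le\varepsilon_p-i(\alpha)$ (resp., $\varepsilon_1-c(\alpha)\le\cdots\le\varepsilon_p-c(\alpha)$) are the right (resp., left) minimal indices of $\mathcal S(\lambda)$.
   Context: Notation: $\{0:m\}=\{0,1,\dots,m\}$, $-\{0:m\}=\{-m,\dots,-1,-0\}$, where $-0$ is a formal index different from $0$ (the successor of $-1$). $e_j$ is the $j$-th column of $I_m$; $\otimes$ is the Kronecker product. Index tuples: an index tuple is a finite, possibly empty, tuple of indices. $(\alpha,\beta)$ denotes concatenation, $-\alpha$ negates all entries and $\mathrm{rev}(\alpha)$ reverses the order. A subtuple is obtained by deleting some entries. A tuple $(i_1,\dots,i_t)$ satisfies the Successor Infix Property (SIP) if whenever $a<b$ and $i_a=i_b$ there is $c$ with $a<c<b$ and $i_c=i_a+1$ (for tuples from $-\{0:m\}$ this is understood after shifting by $m$, so $-0$ is the successor of $-1$). For $t\in\alpha$, $c_t(\alpha)=p$ (consecutions at $t$) if $(t,t+1,\dots,t+p)$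 is a subtuple of $\alpha$ but $(t,\dots,t+p+1)$ is not; $i_t(\alpha)=q$ (inversions at $t$) if $(t+q,\dots,t+1,t)$ is a subtuple of $\alpha$ but $(t+q+1,t+q,\dots,t)$ is not. If $t\notin\alpha$, $c_t(\alpha)=i_t(\alpha)=-1$. For a permutation $\alpha$ of $\{0:m-1\}$, the total number of consecutions $c(\alpha)$ (resp., inversions $i(\alpha)$) is the number of $j\in\{0,\dots,m-2\}$ such that $j$ occurs before (resp., after) $j+1$ in $\alpha$. Elementary matrices (of size $mn\times mn$): for $X\in\mathbb{C}^{n\times n}$, $M_0(X)=\mathrm{diag}(I_{(m-1)n},X)$, $M_{-m}(X)=\mathrm{diag}(X,I_{(m-1)n})$, and for $i=1,\dots,m-1$ $$M_i(X)=\mathrm{diag}\Big(I_{(m-i-1)n},\begin{bmatrix}X & I_n \\ I_n & 0\end{bmatrix},I_{(i-1)n}\Big),\quad M_{-i}(X)=\mathrm{diag}\Big(I_{(m-i-1)n},\begin{bmatrix}0 & I_n \\ I_n & X\end{bmatrix},I_{(i-1)n}\Big).$$ $M_i^P=M_i(-A_i)$ for $0\le i\le m-1$, $M_{-i}^P=M_{-i}(A_i)$ for $1\le i\le m$. For a tuple $\mathbf t=(t_1,\dots,t_r)$, $M_{\mathbf t}^P=M_{t_1}^P\cdots M_{t_r}^P$; a matrix assignment for $\mathbf t$ is a tuple $X=(X_1,\dots,X_r)$ of $n\times n$ complex matrices, and $M_{\mathbf t}(X)=M_{t_1}(X_1)\cdots M_{t_r}(X_r)$. Empty products equal $I_{mn}$.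 An assignment is nonsingular if the matrices assigned to positions occupied by indices $\pm0,\pm m$ are nonsingular. EGFP of $P$: let $(\sigma,\omega)$ be a permutation of $\{0:m\}$ and $\tau=-\omega$. Let $\sigma_1,\sigma_2$ be index tuples with indices from $\sigma\setminus\{m-1,m\}$ such that $(\sigma_1,\sigma,\sigma_2)$ satisfies the SIP, and $\tau_1,\tau_2$ index tuples with indices from $\tau\setminus\{-1,-0\}$ such that $(\tau_1,\tau,\tau_2)$ satisfies the SIP. Let $X_1,X_2,Y_1,Y_2$ be arbitrary nonsingular matrix assignments for $\sigma_1,\sigma_2,\tau_1,\tau_2$. Then $L(\lambda)=M_{\tau_1}(Y_1)M_{\sigma_1}(X_1)(\lambda M^P_\tau-M^P_\sigma)M_{\sigma_2}(X_2)M_{\tau_2}(Y_2)$ is an EGFP of $P(\lambda)$. If $0\in\sigma$ and $-m\in\tau$, the pencil $\mathbb{L}(\lambda)$ displayed in the claim is called an EGFP of $G(\lambda)$. Minimal bases: for a rational matrix $G(\lambda)$, $\mathcal N_r(G)=\{x:Gx=0\}$ and $\mathcal N_l(G)=\{y:y^TG=0\}$ over $\mathbb{C}(\lambda)$. A right (left) minimal basis of $G$ is a basis of $\mathcal N_r(G)$ ($\mathcal N_l(G)$) over $\mathbb{C}(\lambda)$ consisting of polynomial vectors, ordered by nondecreasing degree, whose sum of degrees is minimal among all polynomial bases; the degrees are the right (left) minimal indices. A matrix polynomial is called a right (left) minimal basis if its columns form one. *)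

theory Defs
  imports
    "Jordan_Normal_Form.Matrix_Kernel"
    "HOL-Computational_Algebra.Polynomial_Factorial"
    "HOL-Library.Sublist"
begin

section \<open>Index tuples\<close>

text \<open>
  Index tuples are lists of integers. A tuple from \<open>-{0:m}\<close> represents the formal index \<open>-0\<close> by the
  integer \<open>0\<close>, so the successor of \<open>-1\<close> is \<open>-0\<close> and no shift is needed in the successor infix
  property. This is unambiguous, since a tuple never mixes \<open>0\<close> with \<open>-0\<close>; moreover, only tuples with
  indices in \<open>{0:m-1}\<close> or in \<open>-{1:m}\<close> are ever turned into products of elementary matrices.
\<close>

definition SIP :: "int list \<Rightarrow> bool" where
  "SIP \<alpha> \<longleftrightarrow> (\<forall>a b. a < b \<and> b < length \<alpha> \<and> \<alpha> ! a = \<alpha> ! b \<longrightarrow>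
     (\<exists>c. a < c \<and> c < b \<and> \<alpha> ! c = \<alpha> ! a + 1))"

definition consecutions :: "int \<Rightarrow> int list \<Rightarrow> int" where
  "consecutions t \<alpha> = (if t \<in> set \<alpha>
     then THE p. 0 \<le> p \<and> subseq [t..t + p] \<alpha> \<and> \<not> subseq [t..t + p + 1] \<alpha>
     else - 1)"

definition inversions :: "int \<Rightarrow> int list \<Rightarrow> int" where
  "inversions t \<alpha> = (if t \<in> set \<alpha>
     then THE q. 0 \<le> q \<and> subseq (rev [t..t + q]) \<alpha> \<and> \<not> subseq (rev [t..t + q + 1]) \<alpha>
     else - 1)"

definition total_consecutions :: "nat \<Rightarrow> int list \<Rightarrow> nat" where
  "total_consecutions m \<alpha> = card {j \<in> {0..int m - 2}. subseq [j, j + 1] \<alpha>}"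

definition total_inversions :: "nat \<Rightarrow> int list \<Rightarrow> nat" where
  "total_inversions m \<alpha> = card {j \<in> {0..int m - 2}. subseq [j + 1, j] \<alpha>}"

section \<open>Elementary matrices\<close>

definition elem_mat :: "nat \<Rightarrow> nat \<Rightarrow> int \<Rightarrow> complex mat \<Rightarrow> complex mat" where
  "elem_mat m n t X =
    (if t = 0 then diag_block_mat [1\<^sub>m ((m - 1) * n), X]
     else if t = - int m then diag_block_mat [X, 1\<^sub>m ((m - 1) * n)]
     else if t > 0 then
       diag_block_mat [1\<^sub>m ((m - nat t - 1) * n),
         four_block_mat X (1\<^sub>m n) (1\<^sub>m n) (0\<^sub>m n n), 1\<^sub>m ((nat t - 1) * n)]
     else
       diag_block_mat [1\<^sub>m ((m - nat (- t) - 1) * n),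
         four_block_mat (0\<^sub>m n n) (1\<^sub>m n) (1\<^sub>m n) X, 1\<^sub>m ((nat (- t) - 1) * n)])"

text \<open>The product \<open>M\<^sub>t(X)\<close> for a tuple \<open>t\<close> and a matrix assignment \<open>X\<close> of the same length.\<close>

definition elem_prod :: "nat \<Rightarrow> nat \<Rightarrow> int list \<Rightarrow> complex mat list \<Rightarrow> complex mat" where
  "elem_prod m n ts Xs = foldr (*) (map2 (elem_mat m n) ts Xs) (1\<^sub>m (m * n))"

text \<open>
  The matrix assigned to an index in \<open>M\<^sup>P\<close>: \<open>-A\<^sub>i\<close> for \<open>0 \<le> i \<le> m - 1\<close> and \<open>A\<^sub>i\<close> for
  \<open>-i\<close> with \<open>1 \<le> i \<le> m\<close>. Here and below, \<open>Ac\<close> is the sequence of coefficients of \<open>P\<close>.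
\<close>

definition P_assign :: "(nat \<Rightarrow> complex mat) \<Rightarrow> int \<Rightarrow> complex mat" where
  "P_assign Ac t = (if t \<ge> 0 then - Ac (nat t) else Ac (nat (- t)))"

definition elem_prod_P ::
    "nat \<Rightarrow> nat \<Rightarrow> (nat \<Rightarrow> complex mat) \<Rightarrow> int list \<Rightarrow> complex mat" where
  "elem_prod_P m n Ac ts = elem_prod m n ts (map (P_assign Ac) ts)"

definition nonsingular_assignment ::
    "nat \<Rightarrow> nat \<Rightarrow> int list \<Rightarrow> complex mat list \<Rightarrow> bool" where
  "nonsingular_assignment m n ts Xs \<longleftrightarrow>
     length Xs = length ts \<and> set Xs \<subseteq> carrier_mat n n \<and>
     (\<forall>k < length ts. ts ! k \<in> {0, int m, - int m} \<longrightarrow> invertible_mat (Xs ! k))"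

section \<open>Matrix polynomials, system matrices and EGFPs\<close>

abbreviation const_mat :: "complex mat \<Rightarrow> complex poly mat" where
  "const_mat \<equiv> map_mat (\<lambda>c. [:c:])"

abbreviation rat_mat :: "complex poly mat \<Rightarrow> complex poly fract mat" where
  "rat_mat \<equiv> map_mat to_fract"

definition mat_poly :: "nat \<Rightarrow> nat \<Rightarrow> (nat \<Rightarrow> complex mat) \<Rightarrow> complex poly mat" where
  "mat_poly n m Ac = mat n n (\<lambda>(i, j). \<Sum>k\<le>m. monom (Ac k $$ (i, j)) k)"

text \<open>\<open>pencil U V\<close> is \<open>U - \<lambda> V\<close>.\<close>

definition pencil :: "complex mat \<Rightarrow> complex mat \<Rightarrow> complex poly mat" where
  "pencil U V = const_mat U - [:0, 1:] \<cdot>\<^sub>m const_mat V"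

text \<open>\<open>G(\<lambda>) = P(\<lambda>) + C (\<lambda>E - A)\<^sup>-\<^sup>1 B\<close>\<close>

definition transfer_function ::
    "complex poly mat \<Rightarrow> complex mat \<Rightarrow> complex mat \<Rightarrow> complex mat \<Rightarrow> complex mat \<Rightarrow>
     complex poly fract mat" where
  "transfer_function P A B C E =
     rat_mat P + rat_mat (const_mat C) * the (mat_inverse (rat_mat (- pencil A E))) *
       rat_mat (const_mat B)"

definition system_matrix ::
    "complex poly mat \<Rightarrow> complex mat \<Rightarrow> complex mat \<Rightarrow> complex mat \<Rightarrow> complex mat \<Rightarrow>
     complex poly mat" where
  "system_matrix P A B C E = four_block_mat P (const_mat C) (const_mat B) (pencil A E)"

definition kronecker :: "'a :: times mat \<Rightarrow> 'a mat \<Rightarrow> 'a mat" where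
  "kronecker U V = mat (dim_row U * dim_row V) (dim_col U * dim_col V)
     (\<lambda>(i, j). U $$ (i div dim_row V, j div dim_col V) * V $$ (i mod dim_row V, j mod dim_col V))"

text \<open>\<open>e\<^sub>j\<close>, the \<open>j\<close>-th column of \<open>I\<^sub>m\<close> with \<open>j\<close> counted from 1, as an \<open>m \<times> 1\<close> matrix.\<close>

definition e_col :: "nat \<Rightarrow> int \<Rightarrow> complex mat" where
  "e_col m j = mat_of_cols m [col (1\<^sub>m m) (nat (j - 1))]"

definition EGFP_P ::
    "nat \<Rightarrow> nat \<Rightarrow> (nat \<Rightarrow> complex mat) \<Rightarrow> int list \<Rightarrow> int list \<Rightarrow>
     int list \<Rightarrow> complex mat list \<Rightarrow> int list \<Rightarrow> complex mat list \<Rightarrow>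
     int list \<Rightarrow> complex mat list \<Rightarrow> int list \<Rightarrow> complex mat list \<Rightarrow> complex poly mat" where
  "EGFP_P m n Ac \<sigma> \<tau> \<sigma>1 X1 \<sigma>2 X2 \<tau>1 Y1 \<tau>2 Y2 =
     const_mat (elem_prod m n \<tau>1 Y1) * const_mat (elem_prod m n \<sigma>1 X1) *
     ([:0, 1:] \<cdot>\<^sub>m const_mat (elem_prod_P m n Ac \<tau>) - const_mat (elem_prod_P m n Ac \<sigma>)) *
     const_mat (elem_prod m n \<sigma>2 X2) * const_mat (elem_prod m n \<tau>2 Y2)"

definition EGFP_G ::
    "nat \<Rightarrow> complex poly mat \<Rightarrow> int list \<Rightarrow> int list \<Rightarrow> int list \<Rightarrow>
     complex mat \<Rightarrow> complex mat \<Rightarrow> complex mat \<Rightarrow> complex mat \<Rightarrow> complex poly mat" where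
  "EGFP_G m L \<sigma> \<sigma>1 \<sigma>2 A B C E =
     four_block_mat
       L (const_mat (kronecker (e_col m (int m - inversions 0 (\<sigma>1 @ \<sigma>))) C))
       (const_mat (kronecker (transpose_mat (e_col m (int m - consecutions 0 (\<sigma> @ \<sigma>2)))) B))
       (pencil A E)"

section \<open>Minimal bases and minimal indices\<close>

abbreviation right_null :: "complex poly fract mat \<Rightarrow> complex poly fract vec set" where
  "right_null \<equiv> mat_kernel"

definition left_null :: "complex poly fract mat \<Rightarrow> complex poly fract vec set" where
  "left_null G = {y \<in> carrier_vec (dim_row G). mat_of_row y * G = 0\<^sub>m 1 (dim_col G)}"

definition vec_degree :: "complex poly vec \<Rightarrow> nat" where
  "vec_degree v = Max (degree ` set\<^sub>v v)"

text \<open>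
  The columns of \<open>Z\<close> form a basis of the subspace \<open>N\<close> of \<open>\<complex>(\<lambda>)\<^sup>d\<close>. As a basis is a set in the
  library, the columns are required to be distinct.
\<close>

definition polynomial_basis ::
    "nat \<Rightarrow> complex poly fract vec set \<Rightarrow> complex poly mat \<Rightarrow> bool" where
  "polynomial_basis d N Z \<longleftrightarrow>
     dim_row Z = d \<and> distinct (cols (rat_mat Z)) \<and>
     vectorspace.basis class_ring (module_vec TYPE(complex poly fract) d \<lparr>carrier := N\<rparr>)
       (set (cols (rat_mat Z)))"

definition minimal_basis ::
    "nat \<Rightarrow> complex poly fract vec set \<Rightarrow> complex poly mat \<Rightarrow> bool" where
  "minimal_basis d N Z \<longleftrightarrow>
     polynomial_basis d N Z \<and> sorted (map vec_degree (cols Z)) \<and>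
     (\<forall>W. polynomial_basis d N W \<longrightarrow>
        sum_list (map vec_degree (cols Z)) \<le> sum_list (map vec_degree (cols W)))"

definition right_minimal_basis :: "complex poly fract mat \<Rightarrow> complex poly mat \<Rightarrow> bool" where
  "right_minimal_basis G Z \<longleftrightarrow> minimal_basis (dim_col G) (right_null G) Z"

definition left_minimal_basis :: "complex poly fract mat \<Rightarrow> complex poly mat \<Rightarrow> bool" where
  "left_minimal_basis G Z \<longleftrightarrow> minimal_basis (dim_row G) (left_null G) Z"

text \<open>\<open>\<epsilon>\<close> is the list of right (left) minimal indices of \<open>G\<close>, in nondecreasing order.\<close>

definition right_minimal_indices :: "complex poly fract mat \<Rightarrow> nat list \<Rightarrow> bool" where
  "right_minimal_indices G \<epsilon> \<longleftrightarrow>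
     (\<exists>Z. right_minimal_basis G Z \<and> \<epsilon> = map vec_degree (cols Z))"

definition left_minimal_indices :: "complex poly fract mat \<Rightarrow> nat list \<Rightarrow> bool" where
  "left_minimal_indices G \<epsilon> \<longleftrightarrow>
     (\<exists>Z. left_minimal_basis G Z \<and> \<epsilon> = map vec_degree (cols Z))"

end

theory Submission
  imports Defs
begin

text \<open>
  Transposing everything reverses all tuples, exchanges \<open>\<sigma>\<^sub>1\<close> with \<open>\<sigma>\<^sub>2\<close>, \<open>\<tau>\<^sub>1\<close> with \<open>\<tau>\<^sub>2\<close>, \<open>B\<close> with
  \<open>C\<^sup>T\<close> and consecutions with inversions, and turns left null spaces into right null spaces
  (\<open>egfp_transpose\<close>, \<open>transpose_EGFP_G\<close>). So only right null spaces are treated.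

  \<^bold>\<open>Reduction to a Fiedler pencil.\<close> Since \<open>M\<^sub>i(X)\<^sup>-\<^sup>1 = M\<^sub>-\<^sub>i(-X)\<close>, the factorization
  \<open>M\<^sub>\<tau>\<^sup>P = M\<^sub>-\<^sub>\<beta>\<^sup>P M\<^sub>-\<^sub>m\<^sup>P M\<^sub>-\<^sub>\<gamma>\<^sup>P\<close> shows that \<open>L = U (\<lambda> M\<^sub>-\<^sub>m\<^sup>P - M\<^sub>\<alpha>\<^sup>P) V\<close> with
  \<open>\<alpha> = (rev(\<beta>), \<sigma>, rev(\<gamma>))\<close> and constant invertible \<open>U\<close>, \<open>V\<close>. An elementary matrix \<open>M\<^sub>t\<close> with \<open>t \<ge> 0\<close>
  moves the block column \<open>e\<^bsub>m-k\<^esub> \<otimes> C\<close> to \<open>e\<^bsub>m-k-1\<^esub> \<otimes> C\<close> if \<open>t = k + 1\<close>, fixes it if \<open>t\<close> is neither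
  \<open>k\<close> nor \<open>k + 1\<close>, and spoils it if \<open>t = k\<close>. Hence a product of them makes \<open>k\<close> climb along an inversion
  \<open>(\<dots>, 1, 0)\<close>, and the successor infix property is exactly what forbids the spoiling case
  (\<open>SIP_climb_neq\<close>). This gives \<open>U (e \<otimes> C) = e \<otimes> C\<close> with the two inversion counts
  of \<open>\<alpha>\<close> and \<open>(\<sigma>\<^sub>1, \<sigma>)\<close> (\<open>lift_single_U1\<close>), and the dual statement for the block row carrying \<open>B\<close>
  (\<open>level_V1\<close>): the given linearization is strictly equivalent to the one built from \<open>\<alpha>\<close> alone.

  \<^bold>\<open>Null vectors of the Fiedler pencil.\<close> Each \<open>M\<^sub>i\<close> occurs once in \<open>M\<^sub>\<alpha>\<close> and mixes only two
  neighbouring blocks, so the product is a signal flow graph with \<open>m\<close> wires. Following the signals, the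
  value \<open>u\<close> read by \<open>M\<^sub>0\<close> determines all others: it is multiplied by \<open>\<lambda>\<close> at each inversion, while at each
  consecution a block of the null vector is a Horner shift \<open>\<Sum>\<^bsub>j>k\<^esub> \<lambda>\<^bsup>j-c\<^esup> A\<^sub>j u\<close>; closing
  the loop gives \<open>P(\<lambda>) u + C y = 0\<close>. Thus null vectors \<open>(x, y)\<close> correspond to null vectors \<open>(u, y)\<close> of the
  system matrix, and \<open>u\<close> is a block of \<open>x\<close> (\<open>fiedler_kernel\<close>, \<open>egfp_kernel\<close>). The formulas hold over
  every commutative ring, hence for polynomial and for rational vectors alike.

  \<^bold>\<open>Degrees.\<close> As \<open>(\<lambda>E - A) y = B u\<close> with \<open>E\<close> invertible, the degree of \<open>y\<close> is at most that of \<open>u\<close>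
  (\<open>state_degree\<close>). The top block of the null vector is \<open>\<lambda>\<close> to the power \<open>i(\<alpha>)\<close> times \<open>u\<close>, and
  \<open>P(\<lambda>) u + C y = 0\<close> bounds the Horner shifts (\<open>horner_shift_degree\<close>). So a nonzero polynomial null
  vector has degree exactly \<open>i(\<alpha>)\<close> more
  than the one it recovers (\<open>kernel_degree\<close>).

  \<^bold>\<open>Minimal bases.\<close> A constant matrix that maps one null space bijectively to another, with every
  polynomial vector hit by a polynomial vector and with a constant shift of degrees, carries minimal bases to
  minimal bases, as it carries polynomial bases to polynomial bases in both directions
  (\<open>minimal_basis_transfer\<close>).
\<close>

section \<open>Index tuples\<close>

text \<open>
  Read the tuple from right to left and replace the current value \<open>k\<close> by \<open>k + 1\<close> whenever \<open>k + 1\<close> is met.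
  Started at \<open>-1\<close>, this computes the number of inversions at \<open>0\<close>, by \<open>inversions_0_eq_climb\<close> below; applied to
  the reversed tuple, the number of consecutions. It is also how elementary matrices move a block.
\<close>

definition climb :: "int list \<Rightarrow> int \<Rightarrow> int" where
  "climb \<alpha> k = foldr (\<lambda>t k. if t = k + 1 then t else k) \<alpha> k"

lemma climb_simps [simp]:
  "climb [] k = k"
  "climb (t # \<alpha>) k = (if t = climb \<alpha> k + 1 then t else climb \<alpha> k)"
  "climb (\<alpha> @ \<beta>) k = climb \<alpha> (climb \<beta> k)"
  by (simp_all add: climb_def)

lemma climb_ge: "k \<le> climb \<alpha> k"
  by (induction \<alpha>) auto

lemma climb_not_in: "k + 1 \<notin> set \<alpha> \<Longrightarrow> climb \<alpha> k = k"
  by (induction \<alpha>) auto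

lemma climb_mem: "k < climb \<alpha> k \<Longrightarrow> climb \<alpha> k \<in> set \<alpha>"
  by (induction \<alpha>) (auto split: if_splits)

lemma climb_nonneg: "0 \<in> set \<alpha> \<Longrightarrow> 0 \<le> climb \<alpha> (-1)"
proof (induction \<alpha>)
  case (Cons t \<alpha>)
  have "- 1 \<le> climb \<alpha> (- 1)" by (rule climb_ge)
  with Cons show ?case by auto
qed simp

text \<open>
  Taking the first possible occurrence of \<open>0\<close>, \<open>1\<close>, \<dots> from the right is optimal, so the greedy scan finds
  the longest descending subtuple that ends in \<open>0\<close>.
\<close>

lemma subseq_countdown_iff:
  "- 1 \<le> q \<Longrightarrow> subseq (rev [0..q]) \<alpha> \<longleftrightarrow> q \<le> climb \<alpha> (- 1)"
proof (induction \<alpha> arbitrary: q)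
  case Nil
  then show ?case by (cases "q = - 1") (auto simp: upto_rec2)
next
  case (Cons t \<alpha>)
  show ?case
  proof (cases "q = - 1")
    case True
    then show ?thesis using climb_ge[of "-1" "t # \<alpha>"] by auto
  next
    case False
    with Cons.prems have q: "0 \<le> q" by auto
    then have eq: "rev [0..q] = q # rev [0..q - 1]"
      by (simp add: upto_rec2)
    show ?thesis
    proof (cases "q = t")
      case True
      then show ?thesis using Cons.IH[of "q - 1"] q unfolding eq by auto
    next
      case False
      then show ?thesis using Cons.IH[of q] q unfolding eq by auto
    qed
  qed
qed

lemma subseq_rev: "subseq (rev xs) (rev ys) \<longleftrightarrow> subseq xs ys"
proof -
  have "subseq (rev xs) (rev ys)" if "subseq xs ys" for xs ys :: "'a list"
    using that by (induction rule: list_emb.induct) (auto intro: list_emb_append_mono)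
  from this[of xs ys] this[of "rev xs" "rev ys"] show ?thesis by auto
qed

lemma inversions_0_eq_climb: "inversions 0 \<alpha> = climb \<alpha> (- 1)"
proof (cases "0 \<in> set \<alpha>")
  case True
  have "(THE q. 0 \<le> q \<and> subseq (rev [0..0 + q]) \<alpha> \<and> \<not> subseq (rev [0..0 + q + 1]) \<alpha>) = climb \<alpha> (- 1)"
    by (rule the_equality)
      (use climb_nonneg[OF True] subseq_countdown_iff[of _ \<alpha>] in auto)
  then show ?thesis using True by (simp add: inversions_def)
next
  case False
  then show ?thesis using climb_not_in[of "-1" \<alpha>] by (simp add: inversions_def)
qed

lemma consecutions_0_eq_climb: "consecutions 0 \<alpha> = climb (rev \<alpha>) (- 1)"
proof -
  have "subseq (rev xs) (rev \<alpha>) \<longleftrightarrow> subseq xs \<alpha>" for xs by (rule subseq_rev)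
  then show ?thesis
    by (simp add: consecutions_def inversions_def flip: inversions_0_eq_climb)
qed

lemma SIP_split:
  assumes "SIP \<alpha>" "\<alpha> = p @ t # q @ t # s"
  shows "t + 1 \<in> set q"
proof -
  let ?a = "length p" and ?b = "length p + length q + 1"
  have "\<alpha> ! ?a = t" "\<alpha> ! ?b = t" "?a < ?b" "?b < length \<alpha>"
    unfolding assms(2) by (auto simp: nth_append)
  with assms(1) obtain c where c: "?a < c" "c < ?b" "\<alpha> ! c = t + 1"
    unfolding SIP_def by metis
  then have "q ! (c - length p - 1) = t + 1" "c - length p - 1 < length q"
    unfolding assms(2) by (auto simp: nth_append nth_Cons' diff_diff_eq split: if_splits)
  then show ?thesis by (metis nth_mem)
qed

lemma SIP_I:
  assumes "\<And>p t q s. \<alpha> = p @ t # q @ t # s \<Longrightarrow> t + 1 \<in> set q"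
  shows "SIP \<alpha>"
  unfolding SIP_def
proof (intro allI impI, elim conjE)
  fix a b assume ab: "a < b" "b < length \<alpha>" "\<alpha> ! a = \<alpha> ! b"
  have dr: "drop (Suc a) \<alpha> = take (b - Suc a) (drop (Suc a) \<alpha>) @ \<alpha> ! b # drop (Suc b) \<alpha>"
    using id_take_nth_drop[of "b - Suc a" "drop (Suc a) \<alpha>"] ab by simp
  have "\<alpha> = take a \<alpha> @ \<alpha> ! a # take (b - Suc a) (drop (Suc a) \<alpha>) @ \<alpha> ! a # drop (Suc b) \<alpha>"
    using id_take_nth_drop[of a \<alpha>] ab dr by simp
  from assms[OF this] obtain i where i: "i < b - Suc a" "drop (Suc a) \<alpha> ! i = \<alpha> ! a + 1"
    by (auto simp: in_set_conv_nth)
  then show "\<exists>c>a. c < b \<and> \<alpha> ! c = \<alpha> ! a + 1"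
    using ab by (intro exI[of _ "Suc a + i"]) auto
qed

lemma SIP_rev: "SIP (rev \<alpha>) \<longleftrightarrow> SIP \<alpha>"
proof -
  have "SIP (rev \<alpha>)" if "SIP \<alpha>" for \<alpha>
  proof (rule SIP_I)
    fix p t q s assume "rev \<alpha> = p @ t # q @ t # s"
    then have "\<alpha> = rev s @ t # rev q @ t # rev p"
      by (metis append.assoc append_Cons append_Nil rev.simps(2) rev_append rev_rev_ident)
    from SIP_split[OF that this] show "t + 1 \<in> set q" by simp
  qed
  from this[of \<alpha>] this[of "rev \<alpha>"] show ?thesis by auto
qed

lemma SIP_infix: "SIP (p @ \<alpha> @ s) \<Longrightarrow> SIP \<alpha>"
proof (rule SIP_I)
  fix p' t q s' assume "SIP (p @ \<alpha> @ s)" "\<alpha> = p' @ t # q @ t # s'"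
  then show "t + 1 \<in> set q" using SIP_split[of _ "p @ p'" t q "s' @ s"] by simp
qed

lemma SIP_append_mem:
  assumes "SIP (\<alpha> @ \<beta>)" "t \<in> set \<alpha>" "t \<in> set \<beta>"
  shows "t + 1 \<in> set \<alpha> \<union> set \<beta>"
proof -
  obtain p q where \<alpha>: "\<alpha> = p @ t # q" using assms(2) by (metis split_list)
  obtain p' q' where \<beta>: "\<beta> = p' @ t # q'" using assms(3) by (metis split_list)
  have "t + 1 \<in> set (q @ p')" by (rule SIP_split[OF assms(1), of p t _ q']) (simp add: \<alpha> \<beta>)
  then show ?thesis by (auto simp: \<alpha> \<beta>)
qed

lemma distinct_SIP: "distinct \<alpha> \<Longrightarrow> SIP \<alpha>"
  by (auto intro: SIP_I)

text \<open>
  The last successful step of the scan: after it, the next value never shows up again.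
\<close>

lemma climb_split:
  assumes "0 \<le> climb \<alpha> (- 1)"
  obtains p s where "\<alpha> = p @ climb \<alpha> (- 1) # s" "climb \<alpha> (- 1) + 1 \<notin> set p"
proof -
  have "\<exists>p s. \<alpha> = p @ climb \<alpha> (- 1) # s \<and> climb \<alpha> (- 1) + 1 \<notin> set p"
    using assms
  proof (induction \<alpha>)
    case (Cons t \<alpha>)
    show ?case
    proof (cases "t = climb \<alpha> (- 1) + 1")
      case True
      then show ?thesis by (intro exI[of _ "[]"] exI[of _ \<alpha>]) auto
    next
      case False
      with Cons obtain p s where "\<alpha> = p @ climb \<alpha> (- 1) # s" "climb \<alpha> (- 1) + 1 \<notin> set p"
        by auto
      with False show ?thesis by (intro exI[of _ "t # p"] exI[of _ s]) auto
    qed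
  qed simp
  then show thesis using that by blast
qed

text \<open>
  If the next index \<open>t\<close> repeated the current height, then \<open>t + 1\<close> would lie between the two occurrences of \<open>t\<close>
  and the scan would already be higher.
\<close>

lemma SIP_climb_neq:
  assumes "SIP (t # \<alpha>)" "0 \<le> climb \<alpha> (- 1)"
  shows "t \<noteq> climb \<alpha> (- 1)"
proof
  assume t: "t = climb \<alpha> (- 1)"
  from climb_split[OF assms(2)] t obtain p s where "\<alpha> = p @ t # s" "t + 1 \<notin> set p"
    by metis
  then show False using SIP_split[OF assms(1), of "[]" t p s] by simp
qed

lemma subseq_pair_iff: "subseq [a, b] \<alpha> \<longleftrightarrow> (\<exists>p q s. \<alpha> = p @ a # q @ b # s)"
proof
  assume "subseq [a, b] \<alpha>"
  then obtain p r where pr: "\<alpha> = p @ a # r" "subseq [b] r"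
    by (auto dest: list_emb_ConsD)
  then obtain q s where "r = q @ b # s"
    by (auto simp: subseq_singleton_left dest: split_list)
  with pr show "\<exists>p q s. \<alpha> = p @ a # q @ b # s" by blast
next
  assume "\<exists>p q s. \<alpha> = p @ a # q @ b # s"
  then obtain p q s where \<alpha>: "\<alpha> = p @ a # q @ b # s" by blast
  have "subseq [b] (q @ b # s)" by (simp add: subseq_singleton_left)
  then have "subseq [a, b] (a # q @ b # s)" by simp
  then show "subseq [a, b] \<alpha>" unfolding \<alpha> by (rule subseq_drop_many)
qed

lemma subseq_pair_total:
  assumes "a \<in> set \<alpha>" "b \<in> set \<alpha>" "a \<noteq> b"
  shows "subseq [a, b] \<alpha> \<or> subseq [b, a] \<alpha>"
proof -
  obtain p s where ps: "\<alpha> = p @ a # s" using assms(1) by (metis split_list)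
  then consider "b \<in> set p" | "b \<in> set s" using assms by auto
  then show ?thesis
  proof cases
    case 1 then show ?thesis unfolding ps subseq_pair_iff by (metis append.assoc append_Cons split_list)
  next
    case 2 then show ?thesis unfolding ps subseq_pair_iff by (metis split_list)
  qed
qed

lemma subseq_pair_antisym:
  assumes "distinct \<alpha>" "subseq [a, b] \<alpha>" shows "\<not> subseq [b, a] \<alpha>"
proof
  assume "subseq [b, a] \<alpha>"
  then obtain p q s where \<alpha>: "\<alpha> = p @ b # q @ a # s" unfolding subseq_pair_iff by blast
  obtain p' q' s' where \<alpha>': "\<alpha> = p' @ a # q' @ b # s'" using assms(2) unfolding subseq_pair_iff by blast
  have "(p @ b # q) @ a # s = p' @ a # (q' @ b # s')" using \<alpha> \<alpha>' by simp
  moreover have "a \<notin> set (p @ b # q)" "a \<notin> set s" using assms(1) \<alpha> by auto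
  moreover have "a \<notin> set p'" using assms(1) \<alpha>' by auto
  ultimately have "s = q' @ b # s'"
    using append_Cons_eq_iff[of a "p @ b # q" s p' "q' @ b # s'"] by blast
  then show False using assms(1) \<alpha> by auto
qed

lemma climb_below: "0 \<le> j \<Longrightarrow> j < climb \<alpha> (- 1) \<Longrightarrow> subseq [j + 1, j] \<alpha>"
proof (induction \<alpha>)
  case (Cons t \<alpha>)
  show ?case
  proof (cases "j < climb \<alpha> (- 1)")
    case True
    with Cons have "subseq [j + 1, j] \<alpha>" by simp
    then show ?thesis by (rule list_emb_Cons)
  next
    case False
    with Cons.prems have "t = j + 1" "j = climb \<alpha> (- 1)" by (auto split: if_splits)
    then show ?thesis
      using climb_mem[of "-1" \<alpha>] Cons.prems(1) subseq_singleton_left[of j \<alpha>] by auto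
  qed
qed simp

text \<open>
  In a tuple without repetitions the scan stops at \<open>k\<close> because \<open>k + 1\<close> comes after \<open>k\<close>.
\<close>

lemma climb_top:
  assumes "distinct \<alpha>" "0 \<le> climb \<alpha> (- 1)" "climb \<alpha> (- 1) + 1 \<in> set \<alpha>"
  shows "\<not> subseq [climb \<alpha> (- 1) + 1, climb \<alpha> (- 1)] \<alpha>"
proof -
  let ?k = "climb \<alpha> (- 1)"
  obtain p s where ps: "\<alpha> = p @ ?k # s" "?k + 1 \<notin> set p" using climb_split[OF assms(2)] .
  have "?k + 1 \<in> set p \<union> set (?k # s)" using assms(3) ps(1) by (metis set_append)
  then have "?k + 1 \<in> set s" using ps(2) by auto
  then have "subseq [?k, ?k + 1] \<alpha>"
    unfolding subseq_pair_iff by (metis ps(1) split_list)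
  then show ?thesis using subseq_pair_antisym[OF assms(1)] by blast
qed

section \<open>Vectors and matrices\<close>

lemma vec_diff_cancel:
  fixes v w y :: "'a :: ab_group_add vec"
  assumes "v \<in> carrier_vec n" "w \<in> carrier_vec n" "y \<in> carrier_vec n"
  shows "- v + w = w - v" "v + w - v = w" "v + w + y - v = w + y"
    "v - y = w - y \<Longrightarrow> v = w"
proof -
  assume eq: "v - y = w - y"
  show "v = w"
  proof (rule eq_vecI)
    fix i assume "i < dim_vec w"
    then have i: "i < n" using assms by simp
    then show "v $ i = w $ i" using arg_cong[OF eq, of "\<lambda>z. z $ i"] assms by simp
  qed (use assms in auto)
qed (use assms in \<open>auto intro!: eq_vecI\<close>)

lemma mult_unit_vec:
  fixes M :: "'a :: comm_ring_1 mat"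
  assumes "M \<in> carrier_mat a b" "j < b"
  shows "M *\<^sub>v unit_vec b j = col M j"
  using assms by (intro eq_vecI) auto

lemma mult_zero_vec:
  fixes M :: "'a :: comm_ring_1 mat"
  shows "M \<in> carrier_mat a b \<Longrightarrow> M *\<^sub>v 0\<^sub>v b = 0\<^sub>v a"
  by (intro eq_vecI) auto

lemma mult_smult_vec:
  fixes M :: "'a :: comm_ring_1 mat"
  assumes "M \<in> carrier_mat a b" "v \<in> carrier_vec b"
  shows "M *\<^sub>v (s \<cdot>\<^sub>v v) = s \<cdot>\<^sub>v (M *\<^sub>v v)"
  using assms by (intro eq_vecI) auto

lemma vec_split_first_last:
  assumes "z \<in> carrier_vec (p + q)"
  obtains x y where "z = x @\<^sub>v y" "x \<in> carrier_vec p" "y \<in> carrier_vec q"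
  using vec_first_last_append[OF assms] vec_first_carrier vec_last_carrier by metis

lemma mat_eq_if_mult_vec_eq:
  assumes "M \<in> carrier_mat a b" "N \<in> carrier_mat a b"
    and "\<And>v. v \<in> carrier_vec b \<Longrightarrow> M *\<^sub>v v = N *\<^sub>v (v :: 'a :: comm_ring_1 vec)"
  shows "M = N"
proof (rule eq_matI)
  fix i j assume ij: "i < dim_row N" "j < dim_col N"
  have "(M *\<^sub>v unit_vec b j) $ i = (N *\<^sub>v unit_vec b j) $ i" using assms(3) by simp
  then show "M $$ (i, j) = N $$ (i, j)" using ij assms(1,2) by auto
qed (use assms in auto)

section \<open>Block vectors\<close>

definition block :: "nat \<Rightarrow> nat \<Rightarrow> 'a vec \<Rightarrow> 'a vec" where
  "block n b x = vec n (\<lambda>i. x $ (b * n + i))"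

lemma block_carrier [simp]: "block n b x \<in> carrier_vec n" "dim_vec (block n b x) = n"
  by (auto simp: block_def)

lemma block_index_less: "b < p \<Longrightarrow> i < n \<Longrightarrow> b * n + i < p * (n :: nat)"
proof -
  assume "b < p" "i < n"
  then have "b * n + i < Suc b * n" by simp
  also have "\<dots> \<le> p * n" using \<open>b < p\<close> by (intro mult_le_mono1) simp
  finally show ?thesis .
qed

lemma block_append:
  assumes "x \<in> carrier_vec (p * n)" "y \<in> carrier_vec (q * n)" "b < p + q"
  shows "block n b (x @\<^sub>v y) = (if b < p then block n b x else block n (b - p) y)"
proof (cases "b < p")
  case True
  have "b * n + i < p * n" if "i < n" for i
    using block_index_less[OF True that] .
  then have "(x @\<^sub>v y) $ (b * n + i) = x $ (b * n + i)" if "i < n" for i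
    using assms that by (metis carrier_vecD index_append_vec(1) trans_less_add1)
  then show ?thesis using True
    by (intro eq_vecI) (auto simp: block_def)
next
  case False
  then obtain c where b: "b = p + c" by (metis le_add_diff_inverse not_less)
  have "c * n + i < q * n" if "i < n" for i
    using block_index_less[of c q i n] that assms b by simp
  then show ?thesis using assms b
    by (intro eq_vecI) (auto simp: block_def add_mult_distrib)
qed

lemma block_single: "x \<in> carrier_vec n \<Longrightarrow> block n 0 x = x"
  by (intro eq_vecI) (auto simp: block_def)

lemma block_ext:
  assumes "x \<in> carrier_vec (p * n)" "y \<in> carrier_vec (p * n)"
    and "\<And>b. b < p \<Longrightarrow> block n b x = block n b y"
  shows "x = y"
proof (rule eq_vecI)
  fix j assume "j < dim_vec y"
  then have j: "j < p * n" using assms by simp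
  then have n: "0 < n" by (cases n) auto
  have "j div n < p" using j by (simp add: less_mult_imp_div_less)
  from assms(3)[OF this] have "block n (j div n) x $ (j mod n) = block n (j div n) y $ (j mod n)"
    by simp
  then show "x $ j = y $ j" using n by (simp add: block_def)
qed (use assms in auto)

text \<open>
  Block \<open>m - k\<close>, counted from 1, is called level \<open>k\<close>. With this numbering \<open>M\<^sub>i\<close> acts on the levels \<open>i\<close>
  and \<open>i - 1\<close>, the matrix \<open>M\<^sub>0\<close> on level \<open>0\<close> and \<open>M\<^sub>-\<^sub>m\<close> on level \<open>m - 1\<close>.
\<close>

definition blk :: "nat \<Rightarrow> nat \<Rightarrow> nat \<Rightarrow> 'a vec \<Rightarrow> 'a vec" where
  "blk m n k x = block n (m - 1 - k) x"

lemma blk_carrier [simp]: "blk m n k x \<in> carrier_vec n" "dim_vec (blk m n k x) = n"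
  by (auto simp: blk_def)

lemma blk_ext:
  assumes "x \<in> carrier_vec (m * n)" "y \<in> carrier_vec (m * n)"
    and "\<And>k. k < m \<Longrightarrow> blk m n k x = blk m n k y"
  shows "x = y"
proof (rule block_ext[OF assms(1,2)])
  fix b assume "b < m"
  then have "m - 1 - (m - 1 - b) = b" "m - 1 - b < m" by auto
  then show "block n b x = block n b y" using assms(3)[of "m - 1 - b"] by (simp add: blk_def)
qed

lemma blk_add:
  assumes "x \<in> carrier_vec (m * n)" "y \<in> carrier_vec (m * n)" "k < m"
  shows "blk m n k (x + y) = blk m n k x + blk m n k y"
proof -
  have "(m - 1 - k) * n + i < m * n" if "i < n" for i
    using block_index_less[of "m - 1 - k" m i n] that assms(3) by simp
  then show ?thesis using assms by (intro eq_vecI) (auto simp: blk_def block_def)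
qed

lemma blk_index:
  assumes "i < n" "k < m"
  shows "blk m n k x $ i = x $ ((m - 1 - k) * n + i)" "(m - 1 - k) * n + i < m * n"
  using assms block_index_less[of "m - 1 - k" m i n] by (auto simp: blk_def block_def)

lemma blk_smult:
  assumes "x \<in> carrier_vec (m * n)" "k < m"
  shows "blk m n k (c \<cdot>\<^sub>v x) = c \<cdot>\<^sub>v blk m n k x"
proof (rule eq_vecI)
  fix i assume "i < dim_vec (c \<cdot>\<^sub>v blk m n k x)"
  then have "i < n" by simp
  then show "blk m n k (c \<cdot>\<^sub>v x) $ i = (c \<cdot>\<^sub>v blk m n k x) $ i"
    using blk_index(2)[of i n k m] assms by (simp add: blk_index(1))
qed simp

lemma blk_zero: "k < m \<Longrightarrow> blk m n k (0\<^sub>v (m * n)) = (0\<^sub>v n :: 'a :: zero vec)"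
proof (rule eq_vecI)
  fix i assume "k < m" "i < dim_vec (0\<^sub>v n :: 'a vec)"
  then show "blk m n k (0\<^sub>v (m * n)) $ i = (0\<^sub>v n :: 'a vec) $ i"
    using blk_index(2)[of i n k m] by (simp add: blk_index(1))
qed simp

definition of_blks :: "nat \<Rightarrow> nat \<Rightarrow> (nat \<Rightarrow> 'a vec) \<Rightarrow> 'a vec" where
  "of_blks m n v = vec (m * n) (\<lambda>j. v (m - 1 - j div n) $ (j mod n))"

lemma of_blks_carrier [simp]: "of_blks m n v \<in> carrier_vec (m * n)"
  by (simp add: of_blks_def)

lemma blk_of_blks:
  assumes "k < m" "v k \<in> carrier_vec n"
  shows "blk m n k (of_blks m n v) = v k"
proof (rule eq_vecI)
  fix i assume "i < dim_vec (v k)"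
  then have i: "i < n" using assms by simp
  show "blk m n k (of_blks m n v) $ i = v k $ i"
  proof -
    have "m - 1 - (m - 1 - k) = k" using assms(1) by simp
    then show ?thesis using i blk_index(2)[OF i assms(1)] assms(1)
      by (simp add: of_blks_def blk_index(1))
  qed
qed (use assms in simp)

text \<open>
  The vector \<open>e\<^bsub>m-k\<^esub> \<otimes> v\<close>.
\<close>

definition single :: "nat \<Rightarrow> nat \<Rightarrow> nat \<Rightarrow> 'a :: zero vec \<Rightarrow> 'a vec" where
  "single m n k v = of_blks m n (\<lambda>j. if j = k then v else 0\<^sub>v n)"

lemma single_carrier [simp]: "single m n k v \<in> carrier_vec (m * n)"
  by (simp add: single_def)

lemma blk_single:
  assumes "v \<in> carrier_vec n" "j < m"
  shows "blk m n j (single m n k v) = (if j = k then v else 0\<^sub>v n)"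
  unfolding single_def using assms by (subst blk_of_blks) auto

section \<open>The action of elementary matrices on levels\<close>

lemma map_mat_0_hom: "f 0 = 0 \<Longrightarrow> map_mat f (0\<^sub>m a b) = 0\<^sub>m a b"
  by (intro eq_matI) auto

lemma map_mat_1_hom: "f 0 = 0 \<Longrightarrow> f 1 = 1 \<Longrightarrow> map_mat f (1\<^sub>m a) = 1\<^sub>m a"
  by (intro eq_matI) auto

lemma elem_mat_carrier:
  assumes "m \<ge> 2" "- int m \<le> t" "t < int m" "X \<in> carrier_mat n n"
  shows "elem_mat m n t X \<in> carrier_mat (m * n) (m * n)"
proof -
  define s where "s = nat \<bar>t\<bar>"
  have s: "t = int s \<or> t = - int s" "s \<le> m" using assms unfolding s_def by auto
  have *: "(m - 1) * n + n = m * n" "n + (m - 1) * n = m * n"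
    using assms(1) by (cases m; simp)+
  have **: "(m - s - 1) * n + (n + n + (s - 1) * n) = m * n" if "0 < s" "s < m"
  proof -
    have "(m - s - 1) * n + (n + n + (s - 1) * n) = ((m - s - 1) + (2 + (s - 1))) * n"
      by (simp add: algebra_simps)
    also have "(m - s - 1) + (2 + (s - 1)) = m" using that by simp
    finally show ?thesis .
  qed
  show ?thesis
    using assms s * ** unfolding elem_mat_def
    by (intro carrier_matI) (auto simp: dim_diag_block_mat)
qed

lemma diag3_eq:
  fixes F :: "'a :: comm_ring_1 mat"
  assumes "F \<in> carrier_mat q q"
  shows "diag_block_mat [1\<^sub>m p, F, 1\<^sub>m r] =
      four_block_mat (1\<^sub>m p) (0\<^sub>m p (q + r)) (0\<^sub>m (q + r) p)
        (four_block_mat F (0\<^sub>m q r) (0\<^sub>m r q) (1\<^sub>m r))"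
  unfolding diag_block_mat.simps(2)[of _ "[_, _]"] diag_block_mat.simps(2)[of _ "[_]"]
    diag_block_mat_singleton Let_def
  using assms by simp

lemma diag3_mult_vec:
  fixes F :: "'a :: comm_ring_1 mat"
  assumes "F \<in> carrier_mat q q" "x \<in> carrier_vec p" "y \<in> carrier_vec q" "z \<in> carrier_vec r"
  shows "diag_block_mat [1\<^sub>m p, F, 1\<^sub>m r] *\<^sub>v (x @\<^sub>v y @\<^sub>v z) = x @\<^sub>v (F *\<^sub>v y) @\<^sub>v z"
proof -
  note 1 = diag3_eq[OF assms(1), of p r]
  have [simp]: "F *\<^sub>v y \<in> carrier_vec q" using assms by simp
  have 2: "four_block_mat F (0\<^sub>m q r) (0\<^sub>m r q) (1\<^sub>m r) *\<^sub>v (y @\<^sub>v z) = (F *\<^sub>v y) @\<^sub>v z"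
    by (subst four_block_mat_mult_vec[of _ q q _ r _ r]) (use assms in auto)
  have yz: "(y @\<^sub>v z) \<in> carrier_vec (q + r)" using assms by simp
  show ?thesis unfolding 1
    by (subst four_block_mat_mult_vec[of _ p p _ "q + r" _ "q + r"]) (use assms yz in \<open>auto simp: 2\<close>)
qed

lemma split_blocks:
  assumes "(x :: 'a vec) \<in> carrier_vec (p + (q + r))"
  obtains x1 x2 x3 where "x = x1 @\<^sub>v x2 @\<^sub>v x3" "x1 \<in> carrier_vec p" "x2 \<in> carrier_vec q"
    "x3 \<in> carrier_vec r"
proof -
  have 1: "x = vec_first x p @\<^sub>v vec_last x (q + r)"
    using assms by (metis vec_first_last_append)
  have "vec_last x (q + r) = vec_first (vec_last x (q + r)) q @\<^sub>v vec_last (vec_last x (q + r)) r"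
    by (metis vec_first_last_append vec_last_carrier)
  with 1 show thesis using that by (metis vec_first_carrier vec_last_carrier)
qed

text \<open>
  Null spaces are taken over the rational functions, degrees over the polynomials. Both are served at once by
  letting the complex matrices act on vectors over any commutative ring through a homomorphism \<open>f\<close>.
\<close>

locale elementary =
  comm_ring_hom f for f :: "complex \<Rightarrow> 'a :: comm_ring_1" +
  fixes m n :: nat
  assumes m2: "2 \<le> m"
begin

abbreviation lift :: "complex mat \<Rightarrow> 'a mat" where "lift \<equiv> map_mat f"

abbreviation level :: "nat \<Rightarrow> 'a vec \<Rightarrow> 'a vec" where "level \<equiv> blk m n"

lemma lift_one: "lift (1\<^sub>m a) = 1\<^sub>m a" and lift_zero: "lift (0\<^sub>m a b) = 0\<^sub>m a b"
  by (auto intro!: map_mat_1_hom map_mat_0_hom)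

text \<open>
  The common part of \<open>M\<^sub>s\<close> and \<open>M\<^sub>-\<^sub>s\<close>: a block \<open>F\<close> that acts on the two levels \<open>s\<close> and \<open>s - 1\<close>.
\<close>

lemma level_diag3:
  assumes "0 < s" "s < m" and F: "F \<in> carrier_mat (n + n) (n + n)"
    and x: "x \<in> carrier_vec (m * n)" and k: "k < m"
    and M: "M = diag_block_mat [1\<^sub>m ((m - s - 1) * n), F, 1\<^sub>m ((s - 1) * n)]"
  shows "level k (lift M *\<^sub>v x) =
    (if k = s then vec_first (lift F *\<^sub>v (level s x @\<^sub>v level (s - 1) x)) n
     else if k = s - 1 then vec_last (lift F *\<^sub>v (level s x @\<^sub>v level (s - 1) x)) n
     else level k x)"
proof -
  have sz: "m * n = (m - s - 1) * n + ((n + n) + (s - 1) * n)"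
  proof -
    have "m = (m - s - 1) + (2 + (s - 1))" using assms by simp
    then have "m * n = ((m - s - 1) + (2 + (s - 1))) * n" by (rule arg_cong)
    then show ?thesis by (simp add: algebra_simps)
  qed
  obtain x1 x2 x3 where x_eq: "x = x1 @\<^sub>v x2 @\<^sub>v x3" and c: "x1 \<in> carrier_vec ((m - s - 1) * n)"
    "x2 \<in> carrier_vec (n + n)" "x3 \<in> carrier_vec ((s - 1) * n)"
    using split_blocks[of x "(m - s - 1) * n" "n + n" "(s - 1) * n"] x sz by metis
  have lF: "lift F \<in> carrier_mat (n + n) (n + n)" using F by simp
  have lM: "lift M = diag_block_mat [1\<^sub>m ((m - s - 1) * n), lift F, 1\<^sub>m ((s - 1) * n)]"
    unfolding M diag3_eq[OF F] diag3_eq[OF lF] using F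
    by (simp add: map_four_block_mat[of _ "(m - s - 1) * n" "(m - s - 1) * n" _ "n + n + (s - 1) * n" _ "n + n + (s - 1) * n"]
       map_four_block_mat[of _ "n + n" "n + n" _ "(s - 1) * n" _ "(s - 1) * n"] lift_one lift_zero)
  have Mx: "lift M *\<^sub>v x = x1 @\<^sub>v (lift F *\<^sub>v x2) @\<^sub>v x3"
    unfolding lM x_eq using F c by (intro diag3_mult_vec) auto
  have blk3: "level k (y1 @\<^sub>v y2 @\<^sub>v y3) =
      (if k = s then vec_first y2 n else if k = s - 1 then vec_last y2 n
       else if k < s then block n (m - 1 - k - (m - s - 1) - 2) y3 else block n (m - 1 - k) y1)"
    if k: "k < m" and y: "y1 \<in> carrier_vec ((m - s - 1) * n)" "y2 \<in> carrier_vec (2 * n)"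
      "y3 \<in> carrier_vec ((s - 1) * n)" for k :: nat and y1 y2 y3 :: "'a vec"
  proof -
    have yy: "y2 @\<^sub>v y3 \<in> carrier_vec ((2 + (s - 1)) * n)"
      using append_carrier_vec[OF y(2,3)] by (simp only: add_mult_distrib)
    have "level k (y1 @\<^sub>v y2 @\<^sub>v y3) = (if m - 1 - k < m - s - 1 then block n (m - 1 - k) y1
        else block n (m - 1 - k - (m - s - 1)) (y2 @\<^sub>v y3))"
      unfolding blk_def by (rule block_append[OF y(1) yy]) (use assms k in auto)
    moreover have "block n (m - 1 - k - (m - s - 1)) (y2 @\<^sub>v y3) =
        (if m - 1 - k - (m - s - 1) < 2 then block n (m - 1 - k - (m - s - 1)) y2
         else block n (m - 1 - k - (m - s - 1) - 2) y3)" if "\<not> m - 1 - k < m - s - 1"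
      by (rule block_append[OF y(2,3)]) (use assms k that in auto)
    moreover have "vec_first y2 n = block n 0 y2" "vec_last y2 n = block n 1 y2"
      using y by (auto simp: vec_first_def vec_last_def block_def)
    moreover have "m - 1 - k < m - s - 1 \<longleftrightarrow> s < k" using k assms by auto
    moreover have "m - 1 - s - (m - s - 1) = 0" "m - 1 - (s - 1) - (m - s - 1) = 1"
      using assms by auto
    moreover have "m - 1 - k - (m - s - 1) < 2 \<longleftrightarrow> s - 1 \<le> k" using k assms by auto
    ultimately show ?thesis by auto
  qed
  have x2: "x2 \<in> carrier_vec (2 * n)" "lift F *\<^sub>v x2 \<in> carrier_vec (2 * n)" using F c by (auto simp: mult_2)
  have "level s x = vec_first x2 n" "level (s - 1) x = vec_last x2 n"
    unfolding x_eq using blk3[of s x1 x2 x3] blk3[of "s - 1" x1 x2 x3] assms c x2 by auto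
  then have "level s x @\<^sub>v level (s - 1) x = x2"
    using c(2) by (simp add: vec_first_last_append)
  then show ?thesis
    unfolding Mx using blk3[OF k c(1) x2(2) c(3)] blk3[OF k c(1) x2(1) c(3)] x_eq by auto
qed

lemma level_elem_pos:
  assumes s: "0 < s" "s < m" and X: "X \<in> carrier_mat n n"
    and x: "x \<in> carrier_vec (m * n)" and k: "k < m"
  shows "level k (lift (elem_mat m n (int s) X) *\<^sub>v x) =
    (if k = s then lift X *\<^sub>v level s x + level (s - 1) x
     else if k = s - 1 then level s x else level k x)"
proof -
  let ?F = "four_block_mat X (1\<^sub>m n) (1\<^sub>m n) (0\<^sub>m n n)"
  have M: "elem_mat m n (int s) X = diag_block_mat [1\<^sub>m ((m - s - 1) * n), ?F, 1\<^sub>m ((s - 1) * n)]"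
    using s by (simp add: elem_mat_def)
  have F: "?F \<in> carrier_mat (n + n) (n + n)" using X by simp
  have "lift ?F = four_block_mat (lift X) (1\<^sub>m n) (1\<^sub>m n) (0\<^sub>m n n)"
    using X by (subst map_four_block_mat[of _ n n _ n _ n]) (auto simp: lift_one lift_zero)
  then have "lift ?F *\<^sub>v (level s x @\<^sub>v level (s - 1) x) =
      (lift X *\<^sub>v level s x + level (s - 1) x) @\<^sub>v level s x"
    using X by (simp, subst four_block_mat_mult_vec[of _ n n _ n _ n]) auto
  moreover have "vec_first (a @\<^sub>v b) n = a" "vec_last (a @\<^sub>v b) n = b"
    if "a \<in> carrier_vec n" "b \<in> carrier_vec n" for a b :: "'a vec"
    using that by (auto simp: vec_first_def vec_last_def)
  ultimately show ?thesis using level_diag3[OF s F x k M] X by auto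
qed

lemma level_elem_neg:
  assumes s: "0 < s" "s < m" and X: "X \<in> carrier_mat n n"
    and x: "x \<in> carrier_vec (m * n)" and k: "k < m"
  shows "level k (lift (elem_mat m n (- int s) X) *\<^sub>v x) =
    (if k = s then level (s - 1) x
     else if k = s - 1 then level s x + lift X *\<^sub>v level (s - 1) x else level k x)"
proof -
  let ?F = "four_block_mat (0\<^sub>m n n) (1\<^sub>m n) (1\<^sub>m n) X"
  have M: "elem_mat m n (- int s) X = diag_block_mat [1\<^sub>m ((m - s - 1) * n), ?F, 1\<^sub>m ((s - 1) * n)]"
    using s by (simp add: elem_mat_def)
  have F: "?F \<in> carrier_mat (n + n) (n + n)" using X by simp
  have "lift ?F = four_block_mat (0\<^sub>m n n) (1\<^sub>m n) (1\<^sub>m n) (lift X)"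
    using X by (subst map_four_block_mat[of _ n n _ n _ n]) (auto simp: lift_one lift_zero)
  then have "lift ?F *\<^sub>v (level s x @\<^sub>v level (s - 1) x) =
      level (s - 1) x @\<^sub>v (level s x + lift X *\<^sub>v level (s - 1) x)"
    using X by (simp, subst four_block_mat_mult_vec[of _ n n _ n _ n]) auto
  moreover have "vec_first (a @\<^sub>v b) n = a" "vec_last (a @\<^sub>v b) n = b"
    if "a \<in> carrier_vec n" "b \<in> carrier_vec n" for a b :: "'a vec"
    using that by (auto simp: vec_first_def vec_last_def)
  ultimately show ?thesis using level_diag3[OF s F x k M] X by auto
qed

lemma level_elem_0:
  assumes X: "X \<in> carrier_mat n n" and x: "x \<in> carrier_vec (m * n)" and k: "k < m"
  shows "level k (lift (elem_mat m n 0 X) *\<^sub>v x) = (if k = 0 then lift X *\<^sub>v level 0 x else level k x)"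
proof -
  have sz: "m * n = (m - 1) * n + 1 * n" using m2 by (cases m) simp_all
  obtain x1 x2 where x_eq: "x = x1 @\<^sub>v x2" and c: "x1 \<in> carrier_vec ((m - 1) * n)" "x2 \<in> carrier_vec n"
    using x sz by (metis vec_first_carrier vec_last_carrier vec_first_last_append mult_1)
  have "lift (elem_mat m n 0 X) = four_block_mat (1\<^sub>m ((m - 1) * n)) (0\<^sub>m ((m - 1) * n) n) (0\<^sub>m n ((m - 1) * n)) (lift X)"
    unfolding elem_mat_def diag_block_mat.simps(2)[of _ "[_]"] diag_block_mat_singleton Let_def
    using X by (simp add: map_four_block_mat[of _ "(m - 1) * n" "(m - 1) * n" _ n _ n] lift_one lift_zero)
  then have "lift (elem_mat m n 0 X) *\<^sub>v x = x1 @\<^sub>v (lift X *\<^sub>v x2)"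
    unfolding x_eq using X c by (simp, subst four_block_mat_mult_vec[of _ "(m - 1) * n" "(m - 1) * n" _ n _ n]) auto
  moreover have "level k (x1 @\<^sub>v y) = (if k = 0 then y else block n (m - 1 - k) x1)"
    if "k < m" "y \<in> carrier_vec n" for k y
    unfolding blk_def using that c block_append[of x1 "m - 1" n y 1 "m - 1 - k"] block_single[of y n]
    by auto
  ultimately show ?thesis using k c X by (auto simp: x_eq)
qed

lemma level_elem_minus_m:
  assumes X: "X \<in> carrier_mat n n" and x: "x \<in> carrier_vec (m * n)" and k: "k < m"
  shows "level k (lift (elem_mat m n (- int m) X) *\<^sub>v x) =
    (if k = m - 1 then lift X *\<^sub>v level (m - 1) x else level k x)"
proof -
  have sz: "m * n = 1 * n + (m - 1) * n" using m2 by (cases m) simp_all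
  obtain x1 x2 where x_eq: "x = x1 @\<^sub>v x2" and c: "x1 \<in> carrier_vec n" "x2 \<in> carrier_vec ((m - 1) * n)"
    using x sz by (metis vec_first_carrier vec_last_carrier vec_first_last_append mult_1)
  have "lift (elem_mat m n (- int m) X) = four_block_mat (lift X) (0\<^sub>m n ((m - 1) * n)) (0\<^sub>m ((m - 1) * n) n) (1\<^sub>m ((m - 1) * n))"
    unfolding elem_mat_def diag_block_mat.simps(2)[of _ "[_]"] diag_block_mat_singleton Let_def
    using X m2 by (simp add: map_four_block_mat[of _ n n _ "(m - 1) * n" _ "(m - 1) * n"] lift_one lift_zero)
  then have "lift (elem_mat m n (- int m) X) *\<^sub>v x = (lift X *\<^sub>v x1) @\<^sub>v x2"
    unfolding x_eq using X c by (simp, subst four_block_mat_mult_vec[of _ n n _ "(m - 1) * n" _ "(m - 1) * n"]) auto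
  moreover have "level k (y @\<^sub>v x2) = (if k = m - 1 then y else block n (m - 1 - k - 1) x2)"
    if "k < m" "y \<in> carrier_vec n" for k y
    unfolding blk_def using that c block_append[of y 1 n x2 "m - 1" "m - 1 - k"] block_single[of y n]
    by auto
  ultimately show ?thesis using k c X m2 by (auto simp: x_eq)
qed

end

section \<open>Products of elementary matrices\<close>

text \<open>
  A matrix assignment for a tuple in which every index names an elementary matrix, which \<open>m\<close> does not.
\<close>

definition assignment :: "nat \<Rightarrow> nat \<Rightarrow> int list \<Rightarrow> complex mat list \<Rightarrow> bool" where
  "assignment m n ts Xs \<longleftrightarrow>
     length Xs = length ts \<and> set Xs \<subseteq> carrier_mat n n \<and> set ts \<subseteq> {- int m..<int m}"

lemma assignment_Nil [simp]: "assignment m n [] Xs \<longleftrightarrow> Xs = []"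
  by (auto simp: assignment_def)

lemma assignment_Cons:
  "assignment m n (t # ts) Xs \<longleftrightarrow>
     (\<exists>X Ys. Xs = X # Ys \<and> X \<in> carrier_mat n n \<and> - int m \<le> t \<and> t < int m \<and> assignment m n ts Ys)"
  by (cases Xs) (auto simp: assignment_def)

lemma elem_prod_Nil [simp]: "elem_prod m n [] Xs = 1\<^sub>m (m * n)"
  by (simp add: elem_prod_def)

lemma elem_prod_Cons [simp]:
  "elem_prod m n (t # ts) (X # Xs) = elem_mat m n t X * elem_prod m n ts Xs"
  by (simp add: elem_prod_def)

lemma elem_prod_carrier:
  assumes "m \<ge> 2" "assignment m n ts Xs"
  shows "elem_prod m n ts Xs \<in> carrier_mat (m * n) (m * n)"
  using assms(2)
  by (induction ts arbitrary: Xs) (auto simp: assignment_Cons intro!: mult_carrier_mat elem_mat_carrier assms(1))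

lemma elem_prod_append:
  assumes "m \<ge> 2" "assignment m n ts Xs" "assignment m n us Ys"
  shows "elem_prod m n (ts @ us) (Xs @ Ys) = elem_prod m n ts Xs * elem_prod m n us Ys"
  using assms(2)
proof (induction ts arbitrary: Xs)
  case Nil
  then show ?case using elem_prod_carrier[OF assms(1,3)] by simp
next
  case (Cons t ts)
  then obtain X Xs' where X: "Xs = X # Xs'" "X \<in> carrier_mat n n" "- int m \<le> t" "t < int m"
    "assignment m n ts Xs'" by (auto simp: assignment_Cons)
  then show ?case
    using Cons.IH[OF X(5)] elem_prod_carrier[OF assms(1,3)] elem_prod_carrier[OF assms(1) X(5)]
      elem_mat_carrier[OF assms(1) X(3,4,2)]
    by simp
qed

lemma assignment_P:
  assumes "\<And>i. i \<le> m \<Longrightarrow> Ac i \<in> carrier_mat n n" "set ts \<subseteq> {- int m..<int m}"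
  shows "assignment m n ts (map (P_assign Ac) ts)"
  using assms by (force simp: assignment_def P_assign_def)

lemma elem_prod_P_append:
  assumes "m \<ge> 2" "\<And>i. i \<le> m \<Longrightarrow> Ac i \<in> carrier_mat n n"
    "set ts \<subseteq> {- int m..<int m}" "set us \<subseteq> {- int m..<int m}"
  shows "elem_prod_P m n Ac (ts @ us) = elem_prod_P m n Ac ts * elem_prod_P m n Ac us"
  unfolding elem_prod_P_def map_append
  by (intro elem_prod_append assignment_P assms)

lemma elem_prod_P_carrier:
  assumes "m \<ge> 2" "\<And>i. i \<le> m \<Longrightarrow> Ac i \<in> carrier_mat n n" "set ts \<subseteq> {- int m..<int m}"
  shows "elem_prod_P m n Ac ts \<in> carrier_mat (m * n) (m * n)"
  unfolding elem_prod_P_def by (intro elem_prod_carrier assignment_P assms)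

context elementary
begin

lemma lift_mult_vec:
  assumes "U \<in> carrier_mat a b" "V \<in> carrier_mat b c" "x \<in> carrier_vec c"
  shows "lift (U * V) *\<^sub>v x = lift U *\<^sub>v (lift V *\<^sub>v x)"
  unfolding mat_hom_mult[OF assms(1,2)] using assms by (intro assoc_mult_mat_vec) auto

lemma lift_elem_prod_Cons:
  assumes "assignment m n (t # ts) (X # Xs)" "x \<in> carrier_vec (m * n)"
  shows "lift (elem_prod m n (t # ts) (X # Xs)) *\<^sub>v x =
    lift (elem_mat m n t X) *\<^sub>v (lift (elem_prod m n ts Xs) *\<^sub>v x)"
  using assms unfolding elem_prod_Cons
  by (intro lift_mult_vec[of _ "m * n" "m * n" _ "m * n"] elem_mat_carrier elem_prod_carrier m2)
    (auto simp: assignment_Cons)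

lemma lift_elem_prod_vec_carrier:
  assumes "assignment m n ts Xs" "x \<in> carrier_vec (m * n)"
  shows "lift (elem_prod m n ts Xs) *\<^sub>v x \<in> carrier_vec (m * n)"
  using elem_prod_carrier[OF m2 assms(1)] assms(2) by (intro mult_mat_vec_carrier) auto

lemma lift_elem_prod_append:
  assumes "assignment m n ts Xs" "assignment m n us Ys" "x \<in> carrier_vec (m * n)"
  shows "lift (elem_prod m n (ts @ us) (Xs @ Ys)) *\<^sub>v x =
    lift (elem_prod m n ts Xs) *\<^sub>v (lift (elem_prod m n us Ys) *\<^sub>v x)"
  unfolding elem_prod_append[OF m2 assms(1,2)]
  by (rule lift_mult_vec[OF elem_prod_carrier[OF m2 assms(1)] elem_prod_carrier[OF m2 assms(2)] assms(3)])

lemma level_elem_up: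
  assumes "k + 1 < m" "X \<in> carrier_mat n n" "x \<in> carrier_vec (m * n)"
  shows "level k (lift (elem_mat m n (int k + 1) X) *\<^sub>v x) = level (k + 1) x"
  using level_elem_pos[of "k + 1" X x k] assms by (simp add: add.commute)

lemma level_elem_other:
  assumes "k < m" "- int m \<le> t" "t < int m" "X \<in> carrier_mat n n" "x \<in> carrier_vec (m * n)"
    and "t \<notin> {int k, int k + 1, - int k, - (int k + 1)}"
  shows "level k (lift (elem_mat m n t X) *\<^sub>v x) = level k x"
proof -
  consider "t = 0" | "t = - int m" | s where "t = int s" "0 < s" "s < m"
    | s where "t = - int s" "0 < s" "s < m"
  proof -
    have "t = int (nat t) \<or> t = - int (nat (- t))" by auto
    then show thesis using that assms(2,3)
      by (metis int_nat_eq le_neq_implies_less nat_int neg_le_iff_le not_le_imp_less of_nat_0_less_iff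
          of_nat_le_iff of_nat_less_iff minus_minus neg_equal_0_iff_equal of_nat_0 le0 gr0I)
  qed
  then show ?thesis
    using assms level_elem_0[OF assms(4,5,1)] level_elem_minus_m[OF assms(4,5,1)]
      level_elem_pos[OF _ _ assms(4,5,1)] level_elem_neg[OF _ _ assms(4,5,1)]
    by cases (auto simp: of_nat_diff)
qed

lemma level_elem_pos_full:
  assumes "k < m" "0 \<le> t" "t < int m" "X \<in> carrier_mat n n" "x \<in> carrier_vec (m * n)"
    and "t \<noteq> int k"
  shows "level k (lift (elem_mat m n t X) *\<^sub>v x) = level (if t = int k + 1 then k + 1 else k) x"
  using level_elem_up[of k X x] level_elem_other[of k t X x] assms by auto

lemma single_elem_other:
  assumes "k < m" "- int m \<le> t" "t < int m" "X \<in> carrier_mat n n" "v \<in> carrier_vec n"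
    and "t \<notin> {int k, int k + 1, - int k, - (int k + 1)}"
  shows "lift (elem_mat m n t X) *\<^sub>v single m n k v = single m n k v"
proof (rule blk_ext)
  note X = assms(4)
  have s: "single m n k v \<in> carrier_vec (m * n)" by simp
  fix j assume j: "j < m"
  have [simp]: "lift X *\<^sub>v 0\<^sub>v n = 0\<^sub>v n" using X by (intro eq_vecI) auto
  consider "t \<notin> {int j, int j + 1, - int j, - (int j + 1)}" | "t = int j" | "t = int j + 1"
    | "t = - int j" | "t = - (int j + 1)" by blast
  then show "level j (lift (elem_mat m n t X) *\<^sub>v single m n k v) = level j (single m n k v)"
  proof cases
    case 1
    then show ?thesis using level_elem_other[OF j assms(2,3,4) s] by simp
  next
    case 2
    then show ?thesis
      using level_elem_0[OF X s j] level_elem_pos[OF _ j X s j] assms j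
      by (cases "j = 0") (auto simp: blk_single)
  next
    case 3
    then have "Suc j < m" using assms by auto
    then show ?thesis using 3 level_elem_pos[of "Suc j" X "single m n k v" j] assms
      by (auto simp: blk_single add.commute)
  next
    case 4
    then show ?thesis
      using level_elem_0[OF X s j] level_elem_neg[OF _ j X s j] assms j
      by (cases "j = 0") (auto simp: blk_single)
  next
    case 5
    then consider "Suc j = m" | "Suc j < m" using j by linarith
    then show ?thesis
    proof cases
      case 1
      then have "t = - int m" using 5 by auto
      then show ?thesis using 1 level_elem_minus_m[OF X s j] assms by (auto simp: blk_single)
    next
      case 2
      then show ?thesis using 5 level_elem_neg[of "Suc j" X "single m n k v" j] assms
        by (auto simp: blk_single add.commute)
    qed
  qed
qed (use assms elem_mat_carrier[OF m2 assms(2,3,4)] in \<open>auto intro!: mult_mat_vec_carrier\<close>)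

lemma single_elem_up:
  assumes "k + 1 < m" "X \<in> carrier_mat n n" "v \<in> carrier_vec n"
  shows "lift (elem_mat m n (int k + 1) X) *\<^sub>v single m n k v = single m n (k + 1) v"
proof (rule blk_ext)
  fix j assume j: "j < m"
  have [simp]: "lift X *\<^sub>v 0\<^sub>v n = 0\<^sub>v n" using assms by (intro eq_vecI) auto
  have "int (Suc k) = int k + 1" by simp
  then show "level j (lift (elem_mat m n (int k + 1) X) *\<^sub>v single m n k v) = level j (single m n (k + 1) v)"
    using level_elem_pos[of "Suc k" X "single m n k v" j] assms j
    unfolding \<open>int (Suc k) = int k + 1\<close> by (auto simp: blk_single)
qed (use assms elem_mat_carrier[OF m2, of "int k + 1" X n] in \<open>auto intro!: mult_mat_vec_carrier\<close>)

text \<open>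
  A matrix with negative index \<open>-i\<close> leaves a block at level \<open>k\<close> alone unless \<open>i\<close> is \<open>k\<close> or \<open>k + 1\<close>.
\<close>

lemma single_elem_prod_neg:
  assumes "assignment m n ts Xs" "set ts \<subseteq> {..-1}" "k < m" "v \<in> carrier_vec n"
    "- int k \<notin> set ts" "- (int k + 1) \<notin> set ts"
  shows "lift (elem_prod m n ts Xs) *\<^sub>v single m n k v = single m n k v"
  using assms(1,2,5,6)
proof (induction ts arbitrary: Xs)
  case Nil
  then show ?case by (simp add: lift_one)
next
  case (Cons t ts)
  then obtain X Ys where X: "Xs = X # Ys" "X \<in> carrier_mat n n" "- int m \<le> t" "t < int m"
    "assignment m n ts Ys" by (auto simp: assignment_Cons)
  have "lift (elem_mat m n t X) *\<^sub>v single m n k v = single m n k v"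
    using Cons.prems X assms by (intro single_elem_other) auto
  moreover have "lift (elem_prod m n ts Ys) *\<^sub>v single m n k v = single m n k v"
    using Cons.prems X by (intro Cons.IH) auto
  ultimately show ?case
    using lift_elem_prod_Cons[of t ts X Ys "single m n k v"] Cons.prems(1) unfolding X(1) by simp
qed

lemma level_elem_prod_neg:
  assumes "assignment m n ts Xs" "set ts \<subseteq> {..-1}" "k < m" "x \<in> carrier_vec (m * n)"
    "- int k \<notin> set ts" "- (int k + 1) \<notin> set ts"
  shows "level k (lift (elem_prod m n ts Xs) *\<^sub>v x) = level k x"
  using assms(1,2,5,6)
proof (induction ts arbitrary: Xs)
  case Nil
  then show ?case using assms by (simp add: lift_one)
next
  case (Cons t ts)
  then obtain X Ys where X: "Xs = X # Ys" "X \<in> carrier_mat n n" "- int m \<le> t" "t < int m"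
    "assignment m n ts Ys" by (auto simp: assignment_Cons)
  have "level k (lift (elem_mat m n t X) *\<^sub>v (lift (elem_prod m n ts Ys) *\<^sub>v x)) =
      level k (lift (elem_prod m n ts Ys) *\<^sub>v x)"
    using Cons.prems X assms by (intro level_elem_other lift_elem_prod_vec_carrier) auto
  moreover have "level k (lift (elem_prod m n ts Ys) *\<^sub>v x) = level k x"
    using Cons.prems X by (intro Cons.IH) auto
  ultimately show ?case
    using lift_elem_prod_Cons[of t ts X Ys x] Cons.prems(1) assms(4) unfolding X(1) by simp
qed

lemma climb_bound:
  assumes "0 \<in> set \<alpha>" "set \<alpha> \<subseteq> {0..<int m}"
  shows "0 \<le> climb \<alpha> (- 1)" "nat (climb \<alpha> (- 1)) < m" "int (nat (climb \<alpha> (- 1))) = climb \<alpha> (- 1)"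
proof -
  show 1: "0 \<le> climb \<alpha> (- 1)" using climb_nonneg[OF assms(1)] .
  then have "climb \<alpha> (- 1) \<in> set \<alpha>" using climb_mem[of "-1" \<alpha>] by simp
  then have "climb \<alpha> (- 1) < int m" using assms(2) by auto
  then show "nat (climb \<alpha> (- 1)) < m" using m2 by linarith
  show "int (nat (climb \<alpha> (- 1))) = climb \<alpha> (- 1)" using 1 by simp
qed

text \<open>
  How a block column travels: the factors act from right to left, each \<open>M\<^sub>t\<close> with \<open>t = k + 1\<close> lifts the block
  from level \<open>k\<close> to level \<open>k + 1\<close>, and the successor infix property excludes \<open>t = k\<close>, the one factor that would
  multiply the block by its assigned matrix.
\<close>

lemma single_elem_prod_climb:
  assumes "assignment m n ts Xs" "set ts \<subseteq> {0..}" "SIP (ts @ \<sigma>)"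
    and "0 \<in> set \<sigma>" "set \<sigma> \<subseteq> {0..<int m}" "v \<in> carrier_vec n"
  shows "lift (elem_prod m n ts Xs) *\<^sub>v single m n (nat (climb \<sigma> (- 1))) v =
    single m n (nat (climb (ts @ \<sigma>) (- 1))) v"
  using assms(1-3)
proof (induction ts arbitrary: Xs)
  case Nil
  then show ?case by (simp add: lift_one)
next
  case (Cons t ts)
  then obtain X Ys where X: "Xs = X # Ys" "X \<in> carrier_mat n n" "- int m \<le> t" "t < int m"
    "assignment m n ts Ys" by (auto simp: assignment_Cons)
  define k where "k = nat (climb (ts @ \<sigma>) (- 1))"
  have ts: "set (ts @ \<sigma>) \<subseteq> {0..<int m}" "0 \<in> set (ts @ \<sigma>)"
    using X(5) Cons.prems(2) assms(4,5) by (fastforce simp: assignment_def)+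
  note k = climb_bound[OF ts(2,1), folded k_def]
  have S: "SIP (t # ts @ \<sigma>)" "SIP (ts @ \<sigma>)"
    using Cons.prems(3) SIP_infix[of "[t]" "ts @ \<sigma>" "[]"] by auto
  have tk: "t \<noteq> int k" using SIP_climb_neq[OF S(1) k(1)] k(3) by simp
  have IH: "lift (elem_prod m n ts Ys) *\<^sub>v single m n (nat (climb \<sigma> (- 1))) v = single m n k v"
    unfolding k_def using Cons.prems X S by (intro Cons.IH) auto
  have "lift (elem_mat m n t X) *\<^sub>v single m n k v = single m n (nat (climb ((t # ts) @ \<sigma>) (- 1))) v"
  proof (cases "t = int k + 1")
    case True
    moreover from this have "climb ((t # ts) @ \<sigma>) (- 1) = int k + 1" using k(3) by simp
    then have "nat (climb ((t # ts) @ \<sigma>) (- 1)) = k + 1" by linarith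
    ultimately show ?thesis using single_elem_up[of k X v] X assms by auto
  next
    case False
    then have "climb ((t # ts) @ \<sigma>) (- 1) = climb (ts @ \<sigma>) (- 1)" using k by simp
    moreover have "lift (elem_mat m n t X) *\<^sub>v single m n k v = single m n k v"
      using False tk Cons.prems(2) X k(2) assms by (intro single_elem_other) auto
    ultimately show ?thesis by (simp add: k_def)
  qed
  then show ?case
    using lift_elem_prod_Cons[of t ts X Ys "single m n (nat (climb \<sigma> (- 1))) v"] Cons.prems(1) IH
    unfolding X(1) by simp
qed

text \<open>
  The dual statement for block rows: a block of the product is read off from a block of the argument. Now the
  factors are met from left to right, whence the reversed tuples.
\<close>

lemma level_elem_prod_climb:
  assumes "assignment m n ts Xs" "set ts \<subseteq> {0..}" "SIP (\<sigma> @ ts)"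
    and "0 \<in> set \<sigma>" "set \<sigma> \<subseteq> {0..<int m}" "x \<in> carrier_vec (m * n)"
  shows "level (nat (climb (rev \<sigma>) (- 1))) (lift (elem_prod m n ts Xs) *\<^sub>v x) =
    level (nat (climb (rev (\<sigma> @ ts)) (- 1))) x"
  using assms(1-5)
proof (induction ts arbitrary: Xs \<sigma>)
  case Nil
  then show ?case using assms by (simp add: lift_one)
next
  case (Cons t ts)
  then obtain X Ys where X: "Xs = X # Ys" "X \<in> carrier_mat n n" "- int m \<le> t" "t < int m"
    "assignment m n ts Ys" by (auto simp: assignment_Cons)
  define k where "k = nat (climb (rev \<sigma>) (- 1))"
  have \<sigma>: "set (rev \<sigma>) \<subseteq> {0..<int m}" "0 \<in> set (rev \<sigma>)"
    using Cons.prems by auto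
  note k = climb_bound[OF \<sigma>(2,1), folded k_def]
  have "SIP (t # rev \<sigma>)"
    using Cons.prems(3) SIP_infix[of "[]" "\<sigma> @ [t]" ts] SIP_rev[of "\<sigma> @ [t]"] by simp
  from SIP_climb_neq[OF this k(1)] have tk: "t \<noteq> int k" using k(3) by simp
  have y: "lift (elem_prod m n ts Ys) *\<^sub>v x \<in> carrier_vec (m * n)"
    using X assms by (intro lift_elem_prod_vec_carrier) auto
  have "level k (lift (elem_mat m n t X) *\<^sub>v (lift (elem_prod m n ts Ys) *\<^sub>v x)) =
      level (if t = int k + 1 then k + 1 else k) (lift (elem_prod m n ts Ys) *\<^sub>v x)"
    using X k Cons.prems tk y by (intro level_elem_pos_full) auto
  also have "(if t = int k + 1 then k + 1 else k) = nat (climb (rev (\<sigma> @ [t])) (- 1))"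
    using k(1) by (auto simp: k_def nat_add_distrib)
  also have "level \<dots> (lift (elem_prod m n ts Ys) *\<^sub>v x) = level (nat (climb (rev ((\<sigma> @ [t]) @ ts)) (- 1))) x"
    using X Cons.prems by (intro Cons.IH) auto
  finally show ?case
    using lift_elem_prod_Cons[of t ts X Ys x] Cons.prems(1) assms(6)
    unfolding X(1) k_def by simp
qed

end

section \<open>Inverses of products of elementary matrices\<close>

lemma map_mat_ident: "map_mat (\<lambda>c. c) M = M"
  by (intro eq_matI) auto

lemma elementary_ident: "2 \<le> m \<Longrightarrow> elementary (\<lambda>c. c) m"
  by unfold_locales auto

lemmas complex_level_elem =
  elementary.level_elem_pos[OF elementary_ident, unfolded map_mat_ident]
  elementary.level_elem_neg[OF elementary_ident, unfolded map_mat_ident]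
  elementary.level_elem_0[OF elementary_ident, unfolded map_mat_ident]
  elementary.level_elem_minus_m[OF elementary_ident, unfolded map_mat_ident]

text \<open>
  \<open>M\<^sub>t(X)\<^sup>-\<^sup>1 = M\<^sub>-\<^sub>t(-X)\<close> for every \<open>X\<close>, checked level by level.
\<close>

lemma elem_mat_inverse:
  assumes m: "2 \<le> m" and t: "0 < \<bar>t\<bar>" "\<bar>t\<bar> < int m" and X: "X \<in> carrier_mat n n"
  shows "elem_mat m n t X * elem_mat m n (- t) (- X) = 1\<^sub>m (m * n)"
proof (rule mat_eq_if_mult_vec_eq)
  have c: "elem_mat m n t X \<in> carrier_mat (m * n) (m * n)"
    "elem_mat m n (- t) (- X) \<in> carrier_mat (m * n) (m * n)"
    using assms by (auto intro!: elem_mat_carrier)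
  then show "elem_mat m n t X * elem_mat m n (- t) (- X) \<in> carrier_mat (m * n) (m * n)" by simp
  define s where "s = nat \<bar>t\<bar>"
  have s: "0 < s" "s < m" "t = int s \<or> t = - int s" using t by (auto simp: s_def)
  fix v :: "complex vec" assume v: "v \<in> carrier_vec (m * n)"
  define w where "w = elem_mat m n (- t) (- X) *\<^sub>v v"
  have w: "w \<in> carrier_vec (m * n)" unfolding w_def using c v by simp
  note pos = complex_level_elem(1)[OF m s(1,2)]
  note neg = complex_level_elem(2)[OF m s(1,2)]
  have mX: "- X \<in> carrier_mat n n" using X by simp
  have neg_mult: "- X *\<^sub>v y = - (X *\<^sub>v y)" if "y \<in> carrier_vec n" for y
    using X that by (intro eq_vecI) auto
  have cancel: "a + (b - a) = b" "a + - a + b = b" "- a + b + a = b" "b + - a + a = b" "a + (b + - a) = b"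
      "a + (- a + b) = b"
    if "a \<in> carrier_vec n" "b \<in> carrier_vec n" for a b :: "complex vec"
    using that by (intro eq_vecI; simp)+
  have "elem_mat m n t X *\<^sub>v w = v"
  proof (rule blk_ext)
    fix k assume k: "k < m"
    have "s - 1 \<noteq> s" "s - 1 < m" using s by auto
    then show "blk m n k (elem_mat m n t X *\<^sub>v w) = blk m n k v"
      using s(3)
    proof (elim disjE)
      assume t: "t = int s"
      note lw = neg[OF mX v, folded t, folded w_def]
      show ?thesis using pos[OF X w k, folded t] lw[OF k] lw[OF s(2)] lw[OF \<open>s - 1 < m\<close>] \<open>s - 1 \<noteq> s\<close> X
        by (auto simp: neg_mult cancel)
    next
      assume t: "t = - int s"
      then have t': "- t = int s" by simp
      note lw = pos[OF mX v, folded t', folded w_def]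
      show ?thesis using neg[OF X w k, folded t] lw[OF k] lw[OF s(2)] lw[OF \<open>s - 1 < m\<close>] \<open>s - 1 \<noteq> s\<close> X
        by (auto simp: neg_mult cancel)
    qed
  qed (use c v w in auto)
  then show "elem_mat m n t X * elem_mat m n (- t) (- X) *\<^sub>v v = 1\<^sub>m (m * n) *\<^sub>v v"
    using c v by (simp add: w_def)
qed simp

lemma elem_mat_inverse_end:
  assumes m: "2 \<le> m" and t: "t = 0 \<or> t = - int m"
    and X: "X \<in> carrier_mat n n" "Y \<in> carrier_mat n n" "X * Y = 1\<^sub>m n"
  shows "elem_mat m n t X * elem_mat m n t Y = 1\<^sub>m (m * n)"
proof (rule mat_eq_if_mult_vec_eq)
  have c: "elem_mat m n t X \<in> carrier_mat (m * n) (m * n)"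
    "elem_mat m n t Y \<in> carrier_mat (m * n) (m * n)"
    using assms by (auto intro!: elem_mat_carrier)
  then show "elem_mat m n t X * elem_mat m n t Y \<in> carrier_mat (m * n) (m * n)" by simp
  fix v :: "complex vec" assume v: "v \<in> carrier_vec (m * n)"
  define w where "w = elem_mat m n t Y *\<^sub>v v"
  have w: "w \<in> carrier_vec (m * n)" unfolding w_def using c v by simp
  note zero = complex_level_elem(3)[OF m]
  note mm = complex_level_elem(4)[OF m]
  have XY: "X *\<^sub>v (Y *\<^sub>v y) = y" if "y \<in> carrier_vec n" for y
    using X that by (metis assoc_mult_mat_vec one_mult_mat_vec)
  have "elem_mat m n t X *\<^sub>v w = v"
  proof (rule blk_ext)
    fix k assume k: "k < m"
    have "m - 1 < m" "0 < m" using m by auto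
    with t show "blk m n k (elem_mat m n t X *\<^sub>v w) = blk m n k v"
      using zero[OF X(1) w k] mm[OF X(1) w k] zero[OF X(2) v] mm[OF X(2) v] k
      by (auto simp: w_def XY)
  qed (use c v w in auto)
  then show "elem_mat m n t X * elem_mat m n t Y *\<^sub>v v = 1\<^sub>m (m * n) *\<^sub>v v"
    using c v by (simp add: w_def)
qed simp

lemma invertible_obtain:
  assumes "invertible_mat X" "X \<in> carrier_mat n n"
  obtains Y where "Y \<in> carrier_mat n n" "X * Y = 1\<^sub>m n" "Y * X = 1\<^sub>m n"
proof -
  from assms obtain Y where Y: "X * Y = 1\<^sub>m (dim_row X)" "Y * X = 1\<^sub>m (dim_row Y)"
    unfolding invertible_mat_def inverts_mat_def by auto
  have "dim_row Y = n" using arg_cong[OF Y(2), of dim_col] assms(2) by auto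
  moreover have "dim_col Y = n" using arg_cong[OF Y(1), of dim_col] assms(2) by auto
  ultimately show thesis using that[of Y] Y assms(2) by auto
qed

lemma elem_prod_inverse:
  assumes m: "2 \<le> m" and "nonsingular_assignment m n ts Xs" "set ts \<subseteq> {- int m..<int m}"
  shows "\<exists>W \<in> carrier_mat (m * n) (m * n). W * elem_prod m n ts Xs = 1\<^sub>m (m * n) \<and>
    elem_prod m n ts Xs * W = 1\<^sub>m (m * n)"
  using assms(2,3)
proof (induction ts arbitrary: Xs)
  case Nil
  then show ?case by (intro bexI[of _ "1\<^sub>m (m * n)"]) auto
next
  case (Cons t ts)
  obtain X Ys where X: "Xs = X # Ys" "X \<in> carrier_mat n n" "t \<in> {0, int m, - int m} \<longrightarrow> invertible_mat X"
    "nonsingular_assignment m n ts Ys"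
    using Cons.prems(1) unfolding nonsingular_assignment_def
    by (cases Xs) (auto simp: nth_Cons' All_less_Suc2)
  have t: "- int m \<le> t" "t < int m" using Cons.prems by auto
  have a: "assignment m n ts Ys" using X(4) Cons.prems unfolding assignment_def nonsingular_assignment_def by auto
  obtain W where W: "W \<in> carrier_mat (m * n) (m * n)" "W * elem_prod m n ts Ys = 1\<^sub>m (m * n)"
    "elem_prod m n ts Ys * W = 1\<^sub>m (m * n)"
    using Cons.IH[OF X(4)] Cons.prems by auto
  define M where "M = elem_mat m n t X"
  have M: "M \<in> carrier_mat (m * n) (m * n)" unfolding M_def by (intro elem_mat_carrier m t X)
  have "\<exists>N \<in> carrier_mat (m * n) (m * n). M * N = 1\<^sub>m (m * n)"
  proof (cases "t \<in> {0, - int m}")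
    case True
    then obtain Y where "Y \<in> carrier_mat n n" "X * Y = 1\<^sub>m n"
      using X invertible_obtain by (metis insert_iff)
    then show ?thesis unfolding M_def using True elem_mat_inverse_end[OF m _ X(2)] t
      by (intro bexI[of _ "elem_mat m n t Y"] elem_mat_carrier[OF m]) auto
  next
    case False
    then show ?thesis unfolding M_def using elem_mat_inverse[OF m _ _ X(2), of t] t X(2)
      by (intro bexI[of _ "elem_mat m n (- t) (- X)"] elem_mat_carrier[OF m]) auto
  qed
  then obtain N where N: "N \<in> carrier_mat (m * n) (m * n)" "M * N = 1\<^sub>m (m * n)" by auto
  have NM: "N * M = 1\<^sub>m (m * n)" by (rule mat_mult_left_right_inverse[OF M N])
  note E = elem_prod_carrier[OF m a]
  have "(W * N) * (M * elem_prod m n ts Ys) = W * (N * M) * elem_prod m n ts Ys"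
    using W(1) N(1) M E by (simp add: assoc_mult_mat[of _ "m * n" "m * n" _ "m * n" _ "m * n"])
  then have 1: "(W * N) * (M * elem_prod m n ts Ys) = 1\<^sub>m (m * n)" using NM W E by simp
  have "(M * elem_prod m n ts Ys) * (W * N) = 1\<^sub>m (m * n)"
    by (rule mat_mult_left_right_inverse[OF _ _ 1]) (use W N M E in auto)
  then show ?case unfolding X(1) elem_prod_Cons M_def[symmetric]
    by (intro bexI[of _ "W * N"]) (use 1 W N in auto)
qed

text \<open>
  As \<open>M\<^sub>i\<^sup>P\<close> uses \<open>-A\<^sub>i\<close> and \<open>M\<^sub>-\<^sub>i\<^sup>P\<close> uses \<open>A\<^sub>i\<close>, the two are inverse to each other.
\<close>

lemma elem_prod_P_neg_inverse:
  assumes m: "2 \<le> m" and A: "\<And>i. i \<le> m \<Longrightarrow> Ac i \<in> carrier_mat n n"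
    and "set \<beta> \<subseteq> {0<..<int m}"
  shows "elem_prod_P m n Ac (map uminus \<beta>) * elem_prod_P m n Ac (rev \<beta>) = 1\<^sub>m (m * n)"
  using assms(3)
proof (induction \<beta>)
  case Nil
  then show ?case by (simp add: elem_prod_P_def)
next
  case (Cons t \<beta>)
  let ?P = "elem_prod_P m n Ac"
  have 1: "?P (map uminus (t # \<beta>)) = ?P [- t] * ?P (map uminus \<beta>)"
    using elem_prod_P_append[OF m, of Ac n "[- t]" "map uminus \<beta>"] A Cons.prems by force
  have 2: "?P (rev (t # \<beta>)) = ?P (rev \<beta>) * ?P [t]"
    using elem_prod_P_append[OF m, of Ac n "rev \<beta>" "[t]"] A Cons.prems by force
  have c: "?P [- t] \<in> carrier_mat (m * n) (m * n)" "?P [t] \<in> carrier_mat (m * n) (m * n)"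
    "?P (map uminus \<beta>) \<in> carrier_mat (m * n) (m * n)" "?P (rev \<beta>) \<in> carrier_mat (m * n) (m * n)"
    by (intro elem_prod_P_carrier m A; use Cons.prems in force)+
  have "?P (map uminus (t # \<beta>)) * ?P (rev (t # \<beta>)) = ?P [- t] * (?P (map uminus \<beta>) * ?P (rev \<beta>)) * ?P [t]"
    unfolding 1 2 using c by (simp add: assoc_mult_mat[of _ "m * n" "m * n" _ "m * n" _ "m * n"])
  also have "\<dots> = ?P [- t] * ?P [t]" using c Cons by simp
  also have "\<dots> = 1\<^sub>m (m * n)"
  proof -
    have t: "0 < t" "t < int m" using Cons.prems by auto
    have X: "P_assign Ac (- t) \<in> carrier_mat n n" "- P_assign Ac (- t) = P_assign Ac t"
      using t A[of "nat t"] by (auto simp: P_assign_def)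
    have "elem_mat m n (- t) (P_assign Ac (- t)) \<in> carrier_mat (m * n) (m * n)"
       "elem_mat m n t (P_assign Ac t) \<in> carrier_mat (m * n) (m * n)"
      using t X by (auto intro!: elem_mat_carrier m simp flip: X(2))
    then show ?thesis
      using elem_mat_inverse[OF m _ _ X(1), of "- t"] t X(2) by (simp add: elem_prod_P_def)
  qed
  finally show ?case .
qed

section \<open>Transposes of products of elementary matrices\<close>

lemma transpose_elem_mat:
  assumes m: "2 \<le> m" and t: "- int m \<le> t" "t < int m" and X: "X \<in> carrier_mat n n"
  shows "transpose_mat (elem_mat m n t X) = elem_mat m n t (transpose_mat X)"
proof -
  have F: "four_block_mat X (1\<^sub>m n) (1\<^sub>m n) (0\<^sub>m n n) \<in> carrier_mat (n + n) (n + n)"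
    "four_block_mat (0\<^sub>m n n) (1\<^sub>m n) (1\<^sub>m n) X \<in> carrier_mat (n + n) (n + n)"
    "four_block_mat (transpose_mat X) (1\<^sub>m n) (1\<^sub>m n) (0\<^sub>m n n) \<in> carrier_mat (n + n) (n + n)"
    "four_block_mat (0\<^sub>m n n) (1\<^sub>m n) (1\<^sub>m n) (transpose_mat X) \<in> carrier_mat (n + n) (n + n)"
    using X by auto
  have d3: "transpose_mat (diag_block_mat [1\<^sub>m p, F, 1\<^sub>m r]) = diag_block_mat [1\<^sub>m p, transpose_mat F, 1\<^sub>m r]"
    if F: "F \<in> carrier_mat q q" for F :: "complex mat" and p q r
    unfolding diag3_eq[OF F] using F diag3_eq[of "transpose_mat F" q p r]
    by (simp add: transpose_four_block_mat[of _ p p _ "q + r" _ "q + r"] transpose_four_block_mat[of _ q q _ r _ r])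
  have d2: "transpose_mat (diag_block_mat [F, G]) = diag_block_mat [transpose_mat F, transpose_mat G]"
    if "F \<in> carrier_mat p p" "G \<in> carrier_mat q q" for F G :: "complex mat" and p q
    unfolding diag_block_mat.simps(2)[of _ "[_]"] diag_block_mat_singleton Let_def
    using that by (simp add: transpose_four_block_mat[of _ p p _ q _ q])
  show ?thesis
    unfolding elem_mat_def
    using d3[OF F(1)] d3[OF F(2)] d2[OF X] d2[OF _ X] X
    by (simp add: transpose_four_block_mat[of _ n n _ n _ n])
qed

lemma transpose_elem_prod:
  assumes m: "2 \<le> m" and "assignment m n ts Xs"
  shows "transpose_mat (elem_prod m n ts Xs) = elem_prod m n (rev ts) (rev (map transpose_mat Xs))"
  using assms(2)
proof (induction ts arbitrary: Xs)
  case (Cons t ts)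
  then obtain X Ys where X: "Xs = X # Ys" "X \<in> carrier_mat n n" "- int m \<le> t" "t < int m"
    "assignment m n ts Ys" by (auto simp: assignment_Cons)
  have a: "assignment m n (rev ts) (rev (map transpose_mat Ys))" "assignment m n [t] [transpose_mat X]"
    using X unfolding assignment_def by auto
  note c = elem_mat_carrier[OF m X(3,4,2)] elem_prod_carrier[OF m X(5)]
  have "elem_mat m n t (transpose_mat X) \<in> carrier_mat (m * n) (m * n)"
    using X by (intro elem_mat_carrier m) auto
  then show ?case
    unfolding X(1) elem_prod_Cons transpose_mult[OF c] Cons.IH[OF X(5)] transpose_elem_mat[OF m X(3,4,2)]
    using elem_prod_append[OF m a] by simp
qed simp

section \<open>The null space of a Fiedler pencil\<close>

text \<open>
  The setting of the Fiedler pencil \<open>\<lambda> M\<^sub>-\<^sub>m\<^sup>P - M\<^sub>\<alpha>\<^sup>P\<close>; the ring element \<open>l\<close> plays the role of \<open>\<lambda>\<close>.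
\<close>

locale fiedler = elementary f m n for f :: "complex \<Rightarrow> 'a :: comm_ring_1" and m n +
  fixes l :: 'a and Ac :: "nat \<Rightarrow> complex mat" and \<alpha> :: "int list"
  assumes coeff_carrier: "\<And>i. i \<le> m \<Longrightarrow> Ac i \<in> carrier_mat n n"
    and distinct_\<alpha>: "distinct \<alpha>" and set_\<alpha>: "set \<alpha> = {0..<int m}"
begin

definition inverted :: "nat \<Rightarrow> bool" where "inverted k \<longleftrightarrow> subseq [int k + 1, int k] \<alpha>"

text \<open>
  The numbers of inversions and of consecutions of \<open>\<alpha>\<close> below \<open>k\<close>.
\<close>

primrec num_inv :: "nat \<Rightarrow> nat" where
  "num_inv 0 = 0"
| "num_inv (Suc k) = num_inv k + (if inverted k then 1 else 0)"

primrec num_con :: "nat \<Rightarrow> nat" where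
  "num_con 0 = 0"
| "num_con (Suc k) = num_con k + (if inverted k then 0 else 1)"

lemma num_con_plus_num_inv: "num_con k + num_inv k = k"
  by (induction k) auto

abbreviation coeff_mat :: "nat \<Rightarrow> 'a mat" where "coeff_mat j \<equiv> lift (Ac j)"

definition i0 :: nat where "i0 = nat (climb \<alpha> (- 1))"

definition c0 :: nat where "c0 = nat (climb (rev \<alpha>) (- 1))"

lemma zero_in_\<alpha>: "0 \<in> set \<alpha>" "0 \<in> set (rev \<alpha>)"
  using set_\<alpha> m2 by auto

lemma i0_less: "i0 < m" "int i0 = climb \<alpha> (- 1)" and c0_less: "c0 < m" "int c0 = climb (rev \<alpha>) (- 1)"
  unfolding i0_def c0_def using climb_bound[of \<alpha>] climb_bound[of "rev \<alpha>"] zero_in_\<alpha> set_\<alpha> by auto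

lemma inv_total:
  assumes "k + 1 < m"
  shows "\<not> inverted k \<longleftrightarrow> subseq [int k, int k + 1] \<alpha>"
  unfolding inverted_def
  using subseq_pair_total[of "int k" \<alpha> "int k + 1"] subseq_pair_antisym[OF distinct_\<alpha>] assms
  by (auto simp: set_\<alpha>)

lemma inv_below_i0: "j < i0 \<Longrightarrow> inverted j"
  using climb_below[of "int j" \<alpha>] i0_less by (auto simp: inverted_def)

lemma not_inv_i0: "i0 + 1 < m \<Longrightarrow> \<not> inverted i0"
  using climb_top[OF distinct_\<alpha>] i0_less by (auto simp: inverted_def set_\<alpha>)

lemma not_inv_below_c0: "j < c0 \<Longrightarrow> \<not> inverted j"
  using climb_below[of "int j" "rev \<alpha>"] c0_less inv_total[of j]
    subseq_rev[of "[int j, int j + 1]" \<alpha>] by auto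

lemma inv_c0: "c0 + 1 < m \<Longrightarrow> inverted c0"
  using climb_top[of "rev \<alpha>"] c0_less inv_total[of c0] distinct_\<alpha>
    subseq_rev[of "[int c0, int c0 + 1]" \<alpha>] by (auto simp: set_\<alpha>)

lemma num_inv_c0: "num_inv c0 = 0"
proof -
  have "k \<le> c0 \<Longrightarrow> num_inv k = 0" for k
    by (induction k) (auto simp: not_inv_below_c0)
  then show ?thesis by simp
qed

lemma num_inv_total: "num_inv (m - 1) = total_inversions m \<alpha>"
proof -
  have "num_inv k = card {j \<in> {0..int k - 1}. subseq [j + 1, j] \<alpha>}" for k
  proof (induction k)
    case (Suc k)
    have "{0..int (Suc k) - 1} = insert (int k) {0..int k - 1}" by auto
    then have "{j \<in> {0..int (Suc k) - 1}. subseq [j + 1, j] \<alpha>} =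
        (if inverted k then insert (int k) {j \<in> {0..int k - 1}. subseq [j + 1, j] \<alpha>}
         else {j \<in> {0..int k - 1}. subseq [j + 1, j] \<alpha>})"
      by (auto simp: inverted_def)
    moreover have "finite {j \<in> {0..int k - 1}. subseq [j + 1, j] \<alpha>}" by (rule finite_subset[of _ "{0..int k - 1}"]) auto
    moreover have "int k \<notin> {j \<in> {0..int k - 1}. subseq [j + 1, j] \<alpha>}" by simp
    ultimately show ?case using Suc by (simp only: num_inv.simps card_insert_disjoint if_True if_False split: if_split) simp
  qed simp
  from this[of "m - 1"] show ?thesis using m2 by (simp add: total_inversions_def)
qed

definition M :: "int list \<Rightarrow> 'a vec \<Rightarrow> 'a vec" where
  "M ts x = lift (elem_prod_P m n Ac ts) *\<^sub>v x"

lemma M_carrier [simp]: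
  assumes "set ts \<subseteq> {0..<int m}" "x \<in> carrier_vec (m * n)"
  shows "M ts x \<in> carrier_vec (m * n)"
  unfolding M_def elem_prod_P_def
  by (intro lift_elem_prod_vec_carrier assignment_P coeff_carrier assms)
    (use assms in auto)

lemma M_Nil: "x \<in> carrier_vec (m * n) \<Longrightarrow> M [] x = x"
  by (simp add: M_def elem_prod_P_def lift_one)

lemma M_append:
  assumes "set ts \<subseteq> {0..<int m}" "set us \<subseteq> {0..<int m}" "x \<in> carrier_vec (m * n)"
  shows "M (ts @ us) x = M ts (M us x)"
  unfolding M_def elem_prod_P_def map_append
  by (intro lift_elem_prod_append assignment_P coeff_carrier assms)
    (use assms in auto)

lemma level_M_other:
  assumes "set ts \<subseteq> {0..<int m}" "x \<in> carrier_vec (m * n)" "k < m"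
    "int k \<notin> set ts" "int k + 1 \<notin> set ts"
  shows "level k (M ts x) = level k x"
  using assms(1,4,5)
proof (induction ts)
  case Nil
  then show ?case using assms by (simp add: M_Nil)
next
  case (Cons t ts)
  have t: "0 \<le> t" "t < int m" using Cons.prems by auto
  have "M (t # ts) x = M [t] (M ts x)"
    using M_append[of "[t]" ts x] Cons.prems assms by simp
  moreover have "level k (M [t] (M ts x)) = level k (M ts x)"
  proof -
    have X: "P_assign Ac t \<in> carrier_mat n n" using t coeff_carrier[of "nat t"] by (auto simp: P_assign_def)
    have "level k (lift (elem_mat m n t (P_assign Ac t)) *\<^sub>v (M ts x)) = level k (M ts x)"
      using t Cons.prems assms X by (intro level_elem_other) auto
    moreover have "elem_mat m n t (P_assign Ac t) \<in> carrier_mat (m * n) (m * n)"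
      using t X by (intro elem_mat_carrier m2) auto
    ultimately show ?thesis by (simp add: M_def elem_prod_P_def)
  qed
  ultimately show ?case using Cons by simp
qed

lemma level_M_single:
  assumes x: "x \<in> carrier_vec (m * n)" and k: "k < m"
  shows "level k (M [int k] x) = (if k = 0 then 0\<^sub>v n else level (k - 1) x) - coeff_mat k *\<^sub>v level k x"
    and "0 < k \<Longrightarrow> level (k - 1) (M [int k] x) = level k x"
proof -
  have X: "- Ac k \<in> carrier_mat n n" using coeff_carrier[of k] k by simp
  have E: "M [int k] x = lift (elem_mat m n (int k) (- Ac k)) *\<^sub>v x"
    using elem_mat_carrier[OF m2 _ _ X, of "int k"] k by (simp add: M_def elem_prod_P_def P_assign_def)
  have neg: "lift (- Ac k) *\<^sub>v y = - (coeff_mat k *\<^sub>v y)" if "y \<in> carrier_vec n" for y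
    using coeff_carrier[of k] k that
    by (intro eq_vecI) (auto simp: scalar_prod_def hom_uminus sum_negf)
  have A: "coeff_mat k *\<^sub>v y \<in> carrier_vec n" if "y \<in> carrier_vec n" for y
    using coeff_carrier[of k] k that by (intro mult_mat_vec_carrier) auto
  show "level k (M [int k] x) = (if k = 0 then 0\<^sub>v n else level (k - 1) x) - coeff_mat k *\<^sub>v level k x"
  proof (cases "k = 0")
    case True
    have "coeff_mat 0 *\<^sub>v level 0 x \<in> carrier_vec n" using A[of "level 0 x"] True by simp
    then show ?thesis unfolding E using True level_elem_0[OF X x k] neg[of "level 0 x"]
      by (auto intro!: eq_vecI)
  next
    case False
    then show ?thesis unfolding E using level_elem_pos[OF _ k X x k] neg[of "level k x"] A[of "level k x"]
        vec_diff_cancel(1)[of "coeff_mat k *\<^sub>v level k x" n "level (k - 1) x"] by simp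
  qed
  show "level (k - 1) (M [int k] x) = level k x" if "0 < k"
    unfolding E using level_elem_pos[OF that k X x, of "k - 1"] that k by auto
qed

text \<open>
  The signal flow graph of \<open>z = M\<^sub>\<alpha> x\<close>, with \<open>x\<close> and \<open>z\<close> given by levels. \<open>M\<^sub>k\<close> receives \<open>u k\<close> on level \<open>k\<close>
  and \<open>q k\<close> on level \<open>k - 1\<close>; it sends \<open>q k - A\<^sub>k u k\<close> out on level \<open>k\<close> and passes \<open>u k\<close> on to
  level \<open>k - 1\<close>. With \<open>q 0 = 0\<close> this covers \<open>M\<^sub>0\<close>. Level \<open>k < m - 1\<close> is touched by \<open>M\<^sub>k\<close> and \<open>M\<^bsub>k+1\<^esub>\<close> only,
  and the three equations for it say which of the two comes first.
\<close>

definition wires :: "(nat \<Rightarrow> 'a vec) \<Rightarrow> (nat \<Rightarrow> 'a vec) \<Rightarrow> (nat \<Rightarrow> 'a vec) \<Rightarrow> (nat \<Rightarrow> 'a vec) \<Rightarrow> bool" where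
  "wires x z u q \<longleftrightarrow>
     (\<forall>k<m. u k \<in> carrier_vec n \<and> q k \<in> carrier_vec n) \<and> q 0 = 0\<^sub>v n \<and>
     (\<forall>k. Suc k < m \<longrightarrow>
        (if inverted k then x k = u k \<and> q (Suc k) = q k - coeff_mat k *\<^sub>v u k \<and> z k = u (Suc k)
         else x k = q (Suc k) \<and> u (Suc k) = u k \<and> z k = q k - coeff_mat k *\<^sub>v u k)) \<and>
     x (m - 1) = u (m - 1) \<and> z (m - 1) = q (m - 1) - coeff_mat (m - 1) *\<^sub>v u (m - 1)"

text \<open>
  The signals are the values just before the respective factor is applied: \<open>suf k\<close> is the part of \<open>\<alpha>\<close> to
  the right of \<open>k\<close>, and between its neighbours \<open>M\<^sub>k\<close> and \<open>M\<^bsub>k+1\<^esub>\<close> a level does not change.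
\<close>

lemma wires_exist:
  assumes x: "x \<in> carrier_vec (m * n)"
  shows "\<exists>u q. wires (\<lambda>k. level k x) (\<lambda>k. level k (M \<alpha> x)) u q"
proof -
  define suf where "suf k = tl (dropWhile (\<lambda>t. t \<noteq> int k) \<alpha>)" for k
  have suf: "suf k = s" if "\<alpha> = p @ int k # s" for k p s
  proof -
    have "int k \<notin> set p" using distinct_\<alpha> that by auto
    then have "dropWhile (\<lambda>t. t \<noteq> int k) \<alpha> = int k # s"
      unfolding that by (subst dropWhile_append2) auto
    then show ?thesis by (simp add: suf_def)
  qed
  define u where "u k = level k (M (suf k) x)" for k
  define q where "q k = (if k = 0 then 0\<^sub>v n else level (k - 1) (M (suf k) x))" for k
  have sub: "set p \<subseteq> {0..<int m}" "set s \<subseteq> {0..<int m}" if "\<alpha> = p @ s" for p s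
    using that set_\<alpha> by auto
  have step: "level k (M (int k # s) x) = q k - coeff_mat k *\<^sub>v u k"
    "0 < k \<Longrightarrow> level (k - 1) (M (int k # s) x) = u k"
    if "\<alpha> = p @ int k # s" "k < m" for k p s
  proof -
    have s: "set s \<subseteq> {0..<int m}" using sub[of "p @ [int k]" s] that by simp
    have "M (int k # s) x = M [int k] (M s x)"
      using M_append[of "[int k]" s x] s x that by simp
    then show "level k (M (int k # s) x) = q k - coeff_mat k *\<^sub>v u k"
      "0 < k \<Longrightarrow> level (k - 1) (M (int k # s) x) = u k"
      using level_M_single[of "M s x" k] that s x suf[OF that(1)] by (auto simp: q_def u_def)
  qed
  have W: "if inverted k then level k x = u k \<and> q (Suc k) = q k - coeff_mat k *\<^sub>v u k \<and> level k (M \<alpha> x) = u (Suc k)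
         else level k x = q (Suc k) \<and> u (Suc k) = u k \<and> level k (M \<alpha> x) = q k - coeff_mat k *\<^sub>v u k"
    if k: "Suc k < m" for k
  proof (cases "inverted k")
    case True
    then obtain p b s where \<alpha>: "\<alpha> = p @ int (Suc k) # b @ int k # s"
      unfolding inverted_def subseq_pair_iff by (auto simp: add.commute)
    have sets: "set p \<subseteq> {0..<int m}" "set b \<subseteq> {0..<int m}" "set s \<subseteq> {0..<int m}"
      "set (int k # s) \<subseteq> {0..<int m}" "set (b @ int k # s) \<subseteq> {0..<int m}"
      "set (int (Suc k) # b @ int k # s) \<subseteq> {0..<int m}"
      using set_\<alpha> k unfolding \<alpha> by auto
    have nin: "int k \<notin> set s" "int k + 1 \<notin> set s" "int k \<notin> set b" "int k + 1 \<notin> set b"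
      "int k \<notin> set p" "int k + 1 \<notin> set p"
      using distinct_\<alpha> unfolding \<alpha> by (auto simp: add.commute)
    have \<alpha>': "\<alpha> = (p @ int (Suc k) # b) @ int k # s" using \<alpha> by simp
    have "level k x = u k"
      unfolding u_def suf[OF \<alpha>'] using level_M_other[OF sets(3) x _ nin(1,2)] k by simp
    moreover have "q (Suc k) = level k (M (int k # s) x)"
      unfolding q_def suf[OF \<alpha>] M_append[OF sets(2,4) x]
      using level_M_other[OF sets(2) M_carrier[OF sets(4) x] _ nin(3,4)] k by simp
    then have "q (Suc k) = q k - coeff_mat k *\<^sub>v u k"
      using step(1)[OF \<alpha>'] k by simp
    moreover have "level k (M \<alpha> x) = level k (M (int (Suc k) # b @ int k # s) x)"
      unfolding \<alpha> M_append[OF sets(1,6) x]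
      using level_M_other[OF sets(1) M_carrier[OF sets(6) x] _ nin(5,6)] k by simp
    then have "level k (M \<alpha> x) = u (Suc k)"
      using step(2)[OF \<alpha>] k by simp
    ultimately show ?thesis using True by simp
  next
    case False
    then obtain p b s where \<alpha>: "\<alpha> = p @ int k # b @ int (Suc k) # s"
      using inv_total[of k] k unfolding subseq_pair_iff by (auto simp: add.commute)
    have sets: "set p \<subseteq> {0..<int m}" "set b \<subseteq> {0..<int m}" "set s \<subseteq> {0..<int m}"
      "set (int (Suc k) # s) \<subseteq> {0..<int m}" "set (b @ int (Suc k) # s) \<subseteq> {0..<int m}"
      "set (int k # b @ int (Suc k) # s) \<subseteq> {0..<int m}"
      using set_\<alpha> k unfolding \<alpha> by auto
    have nin: "int k \<notin> set s" "int k + 1 \<notin> set s" "int k \<notin> set b" "int k + 1 \<notin> set b"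
      "int k \<notin> set p" "int k + 1 \<notin> set p"
      using distinct_\<alpha> unfolding \<alpha> by (auto simp: add.commute)
    have \<alpha>': "\<alpha> = (p @ int k # b) @ int (Suc k) # s" using \<alpha> by simp
    have "level k x = q (Suc k)"
      unfolding q_def suf[OF \<alpha>'] using level_M_other[OF sets(3) x _ nin(1,2)] k by simp
    moreover have "u k = level k (M (int (Suc k) # s) x)"
      unfolding u_def suf[OF \<alpha>] M_append[OF sets(2,4) x]
      using level_M_other[OF sets(2) M_carrier[OF sets(4) x] _ nin(3,4)] k by simp
    then have "u (Suc k) = u k"
      using step(2)[OF \<alpha>'] k by simp
    moreover have "level k (M \<alpha> x) = level k (M (int k # b @ int (Suc k) # s) x)"
      unfolding \<alpha> M_append[OF sets(1,6) x]
      using level_M_other[OF sets(1) M_carrier[OF sets(6) x] _ nin(5,6)] k by simp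
    then have "level k (M \<alpha> x) = q k - coeff_mat k *\<^sub>v u k"
      using step(1)[OF \<alpha>] k by simp
    ultimately show ?thesis using False by simp
  qed
  have "int (m - 1) \<in> set \<alpha>" using set_\<alpha> m2 by auto
  then obtain p s where \<alpha>: "\<alpha> = p @ int (m - 1) # s" by (metis split_list)
  have sets: "set p \<subseteq> {0..<int m}" "set s \<subseteq> {0..<int m}" "set (int (m - 1) # s) \<subseteq> {0..<int m}"
    using set_\<alpha> unfolding \<alpha> by auto
  have nin: "int (m - 1) \<notin> set s" "int (m - 1) + 1 \<notin> set s" "int (m - 1) \<notin> set p" "int (m - 1) + 1 \<notin> set p"
    using distinct_\<alpha> sets m2 unfolding \<alpha> by auto
  have last1: "level (m - 1) x = u (m - 1)"
    unfolding u_def suf[OF \<alpha>] using level_M_other[OF sets(2) x _ nin(1,2)] m2 by simp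
  have "level (m - 1) (M \<alpha> x) = level (m - 1) (M (int (m - 1) # s) x)"
    unfolding \<alpha> M_append[OF sets(1,3) x]
    using level_M_other[OF sets(1) M_carrier[OF sets(3) x] _ nin(3,4)] m2 by simp
  then have last2: "level (m - 1) (M \<alpha> x) = q (m - 1) - coeff_mat (m - 1) *\<^sub>v u (m - 1)"
    using step(1)[OF \<alpha>] m2 by simp
  have "u k \<in> carrier_vec n" "q k \<in> carrier_vec n" for k by (auto simp: u_def q_def)
  then have "wires (\<lambda>k. level k x) (\<lambda>k. level k (M \<alpha> x)) u q"
    unfolding wires_def using W last1 last2 q_def[of 0] by simp
  then show ?thesis by blast
qed

text \<open>
  The equations determine the signals, and therefore the output, from the input: \<open>u\<close> downwards from level
  \<open>m - 1\<close>, then \<open>q\<close> upwards from level \<open>0\<close>. So any solution of the equations computes \<open>M\<^sub>\<alpha> x\<close>.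
\<close>

lemma wires_unique:
  assumes W: "wires x z u q" and W': "wires x' z' u' q'"
    and eq: "\<And>k. k < m \<Longrightarrow> x k = x' k" and k: "k < m"
  shows "z k = z' k"
proof -
  have u: "u j = u' j" if "j < m" for j
  proof -
    have "j \<le> m - 1" using that by simp
    then show ?thesis
    proof (induction rule: inc_induct)
      case base
      then show ?case using W W' eq[of "m - 1"] m2 unfolding wires_def by simp
    next
      case (step j)
      then have "Suc j < m" by simp
      then show ?case using W W' eq[of j] step.IH unfolding wires_def by (cases "inverted j") force+
    qed
  qed
  have q: "q j = q' j" if "j < m" for j
    using that
  proof (induction j)
    case 0
    then show ?case using W W' unfolding wires_def by simp
  next
    case (Suc j)
    then show ?case using W W' eq[of j] u[of j] unfolding wires_def by (cases "inverted j") force+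
  qed
  show ?thesis
  proof (cases "Suc k < m")
    case True
    then show ?thesis using W W' u[of k] u[of "Suc k"] q[of k] unfolding wires_def by (cases "inverted k") force+
  next
    case False
    then have "k = m - 1" using k by simp
    then show ?thesis using W W' u[of k] q[of k] k unfolding wires_def by simp
  qed
qed

text \<open>
  The vector \<open>\<Sum>\<^bsub>j\<ge>k\<^esub> l\<^bsup>j-e\<^esup> A\<^sub>j u\<close>. For \<open>k = e = 0\<close> this is \<open>P(l) u\<close>, and for \<open>k = e\<close> a Horner shift of it.
\<close>

definition tail_sum :: "nat \<Rightarrow> nat \<Rightarrow> 'a vec \<Rightarrow> 'a vec" where
  "tail_sum k e u = vec n (\<lambda>i. \<Sum>j = k..m. l ^ (j - e) * (coeff_mat j *\<^sub>v u) $ i)"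

lemma tail_sum_carrier [simp]: "tail_sum k e u \<in> carrier_vec n" "dim_vec (tail_sum k e u) = n"
  by (auto simp: tail_sum_def)

lemma tail_sum_head:
  assumes "k \<le> m"
  shows "tail_sum k e u = l ^ (k - e) \<cdot>\<^sub>v (coeff_mat k *\<^sub>v u) + tail_sum (Suc k) e u"
  using coeff_carrier[OF assms] assms
  by (intro eq_vecI) (auto simp: tail_sum_def sum.atLeast_Suc_atMost)

lemma tail_sum_smult:
  assumes "e < k"
  shows "tail_sum k e u = l \<cdot>\<^sub>v tail_sum k (Suc e) u"
proof (rule eq_vecI)
  fix i assume "i < dim_vec (l \<cdot>\<^sub>v tail_sum k (Suc e) u)"
  then have i: "i < n" by simp
  have "l ^ (j - e) = l * l ^ (j - Suc e)" if "j \<in> {k..m}" for j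
  proof -
    have "j - e = Suc (j - Suc e)" using that assms by auto
    then show ?thesis by simp
  qed
  then show "tail_sum k e u $ i = (l \<cdot>\<^sub>v tail_sum k (Suc e) u) $ i"
    using i by (simp add: tail_sum_def sum_distrib_left mult.assoc)
qed simp

text \<open>
  The null vector that belongs to \<open>u\<close>.
\<close>

definition expand :: "'a vec \<Rightarrow> 'a vec" where
  "expand u = of_blks m n (\<lambda>k. if inverted k \<or> k = m - 1 then l ^ num_inv k \<cdot>\<^sub>v u else tail_sum (Suc k) (num_con (Suc k)) u)"

lemma expand_carrier [simp]: "expand u \<in> carrier_vec (m * n)"
  by (simp add: expand_def)

lemma level_expand:
  assumes "k < m" "u \<in> carrier_vec n"
  shows "level k (expand u) = (if inverted k \<or> k = m - 1 then l ^ num_inv k \<cdot>\<^sub>v u else tail_sum (Suc k) (num_con (Suc k)) u)"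
  unfolding expand_def using assms by (subst blk_of_blks) auto

lemma level_c0_expand:
  assumes "u \<in> carrier_vec n"
  shows "level c0 (expand u) = u"
proof -
  have "inverted c0 \<or> c0 = m - 1" using inv_c0 c0_less by linarith
  then show ?thesis using level_expand[OF c0_less(1) assms] num_inv_c0 assms by (auto simp: one_smult_vec)
qed

text \<open>
  The pencil equation reads \<open>M\<^sub>\<alpha> x = pencil_side x g\<close>, where \<open>g\<close> stands for \<open>C y\<close>.
\<close>

definition pencil_side :: "'a vec \<Rightarrow> 'a vec \<Rightarrow> 'a vec" where
  "pencil_side x g = l \<cdot>\<^sub>v (lift (elem_mat m n (- int m) (Ac m)) *\<^sub>v x) + single m n i0 g"

lemma pencil_side_carrier:
  assumes "x \<in> carrier_vec (m * n)"
  shows "pencil_side x g \<in> carrier_vec (m * n)"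
  unfolding pencil_side_def using elem_mat_carrier[OF m2 _ _ coeff_carrier[of m], of "- int m"] assms m2
  by (intro add_carrier_vec smult_carrier_vec mult_mat_vec_carrier) auto

lemma level_pencil_side:
  assumes "x \<in> carrier_vec (m * n)" "g \<in> carrier_vec n" "k < m"
  shows "level k (pencil_side x g) =
    l \<cdot>\<^sub>v (if k = m - 1 then coeff_mat m *\<^sub>v level k x else level k x) + (if k = i0 then g else 0\<^sub>v n)"
proof -
  have c: "lift (elem_mat m n (- int m) (Ac m)) *\<^sub>v x \<in> carrier_vec (m * n)"
    using elem_mat_carrier[OF m2 _ _ coeff_carrier[of m], of "- int m"] assms m2
    by (intro mult_mat_vec_carrier) auto
  show ?thesis unfolding pencil_side_def
    using c assms level_elem_minus_m[OF coeff_carrier[of m] assms(1,3)]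
    by (subst blk_add) (auto simp: blk_smult blk_single)
qed

text \<open>
  The signal \<open>q k\<close> in a solution of the pencil equation. The vector \<open>g\<close> enters on level \<open>i0\<close>, where the
  first run of inversions ends, so it is still present exactly up to there.
\<close>

definition incoming :: "'a vec \<Rightarrow> 'a vec \<Rightarrow> nat \<Rightarrow> 'a vec" where
  "incoming u g k = tail_sum k (num_con k) u + (if k \<le> i0 then g else 0\<^sub>v n)"

lemma incoming_carrier: "g \<in> carrier_vec n \<Longrightarrow> incoming u g k \<in> carrier_vec n"
  by (simp add: incoming_def)

lemma a_smult:
  assumes "k \<le> m" "u \<in> carrier_vec n"
  shows "coeff_mat k *\<^sub>v (s \<cdot>\<^sub>v u) = s \<cdot>\<^sub>v (coeff_mat k *\<^sub>v u)" "coeff_mat k *\<^sub>v u \<in> carrier_vec n"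
  using coeff_carrier[OF assms(1)] assms(2)
  by (auto intro!: mult_mat_vec[of _ n n] mult_mat_vec_carrier)

lemma incoming_step:
  assumes "k \<le> m" "u \<in> carrier_vec n" "g \<in> carrier_vec n"
  shows "incoming u g k - coeff_mat k *\<^sub>v (l ^ num_inv k \<cdot>\<^sub>v u) = tail_sum (Suc k) (num_con k) u + (if k \<le> i0 then g else 0\<^sub>v n)"
proof -
  have "k - num_con k = num_inv k" using num_con_plus_num_inv[of k] by simp
  then show ?thesis
    unfolding incoming_def a_smult(1)[OF assms(1,2)] tail_sum_head[OF assms(1), of "num_con k" u]
    using a_smult(2)[OF assms(1,2)] assms
      vec_diff_cancel(2)[of "l ^ num_inv k \<cdot>\<^sub>v (coeff_mat k *\<^sub>v u)" n "tail_sum (Suc k) (num_con k) u" "0\<^sub>v n"]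
      vec_diff_cancel(3)[of "l ^ num_inv k \<cdot>\<^sub>v (coeff_mat k *\<^sub>v u)" n "tail_sum (Suc k) (num_con k) u" g]
    by simp
qed

lemma incoming_step_inv:
  assumes "Suc k < m" "inverted k" "u \<in> carrier_vec n" "g \<in> carrier_vec n"
  shows "incoming u g k - coeff_mat k *\<^sub>v (l ^ num_inv k \<cdot>\<^sub>v u) = incoming u g (Suc k)"
proof -
  \<comment> \<open>Level \<open>i0\<close> is no inversion, so \<open>g\<close> is present at both \<open>k\<close> and \<open>k + 1\<close> or at neither.\<close>
  have "k \<noteq> i0" using not_inv_i0 assms by auto
  then have "k \<le> i0 \<longleftrightarrow> Suc k \<le> i0" by auto
  then show ?thesis using incoming_step[of k u g] assms by (simp add: incoming_def)
qed

lemma incoming_step_not_inv: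
  assumes "Suc k < m" "\<not> inverted k" "u \<in> carrier_vec n" "g \<in> carrier_vec n"
  shows "incoming u g k - coeff_mat k *\<^sub>v (l ^ num_inv k \<cdot>\<^sub>v u) =
      l \<cdot>\<^sub>v tail_sum (Suc k) (num_con (Suc k)) u + (if k = i0 then g else 0\<^sub>v n)"
    and "incoming u g (Suc k) = tail_sum (Suc k) (num_con (Suc k)) u"
proof -
  \<comment> \<open>A consecution can only occur from \<open>i0\<close> on, and \<open>g\<close> leaves at \<open>i0\<close> itself.\<close>
  have k: "i0 \<le> k" using inv_below_i0[of k] assms by force
  then have "k \<le> i0 \<longleftrightarrow> k = i0" "\<not> Suc k \<le> i0" by auto
  moreover have "num_con k < Suc k" using num_con_plus_num_inv[of k] by simp
  ultimately show "incoming u g k - coeff_mat k *\<^sub>v (l ^ num_inv k \<cdot>\<^sub>v u) =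
      l \<cdot>\<^sub>v tail_sum (Suc k) (num_con (Suc k)) u + (if k = i0 then g else 0\<^sub>v n)"
    "incoming u g (Suc k) = tail_sum (Suc k) (num_con (Suc k)) u"
    using incoming_step[of k u g] assms tail_sum_smult[of "num_con k" "Suc k" u] by (auto simp: incoming_def)
qed

lemma incoming_step_last:
  assumes "u \<in> carrier_vec n" "g \<in> carrier_vec n"
  shows "incoming u g (m - 1) - coeff_mat (m - 1) *\<^sub>v (l ^ num_inv (m - 1) \<cdot>\<^sub>v u) =
      l \<cdot>\<^sub>v (coeff_mat m *\<^sub>v (l ^ num_inv (m - 1) \<cdot>\<^sub>v u)) + (if m - 1 = i0 then g else 0\<^sub>v n)"
proof -
  have *: "m - 1 \<le> i0 \<longleftrightarrow> m - 1 = i0" using i0_less by auto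
  have "Suc (m - 1) = m" using m2 by simp
  moreover have "tail_sum m (num_con (m - 1)) u = l \<cdot>\<^sub>v (coeff_mat m *\<^sub>v (l ^ num_inv (m - 1) \<cdot>\<^sub>v u))"
  proof -
    have "m - num_con (m - 1) = Suc (num_inv (m - 1))" using num_con_plus_num_inv[of "m - 1"] m2 by simp
    moreover have "tail_sum (Suc m) e u = 0\<^sub>v n" for e by (intro eq_vecI) (auto simp: tail_sum_def)
    ultimately show ?thesis
      using tail_sum_head[of m "num_con (m - 1)" u] a_smult[of m u] assms
      by (auto intro!: eq_vecI simp: smult_smult_assoc)
  qed
  ultimately show ?thesis using incoming_step[of "m - 1" u g] assms * by simp
qed

text \<open>
  From left to right, \<open>u k\<close> is found upwards from \<open>u 0\<close> and \<open>q k\<close> downwards from the top level; then \<open>q 0 = 0\<close>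
  is the equation \<open>P(l) u + g = 0\<close>. From right to left, the same formulas solve the wire equations. No power of
  \<open>l\<close> is ever cancelled.
\<close>

theorem fiedler_kernel:
  assumes x: "x \<in> carrier_vec (m * n)" and g: "g \<in> carrier_vec n"
  shows "M \<alpha> x = pencil_side x g \<longleftrightarrow> (\<exists>u \<in> carrier_vec n. x = expand u \<and> tail_sum 0 0 u + g = 0\<^sub>v n)"
proof
  assume eq: "M \<alpha> x = pencil_side x g"
  obtain u q where W: "wires (\<lambda>k. level k x) (\<lambda>k. level k (pencil_side x g)) u q"
    using wires_exist[OF x] eq by metis
  define u0 where "u0 = u 0"
  have uc: "u k \<in> carrier_vec n" "q k \<in> carrier_vec n" if "k < m" for k using W that unfolding wires_def by auto
  have u0: "u0 \<in> carrier_vec n" unfolding u0_def using uc m2 by simp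
  have WI: "level k x = u k" "q (Suc k) = q k - coeff_mat k *\<^sub>v u k" "level k (pencil_side x g) = u (Suc k)"
    if "inverted k" "Suc k < m" for k using W that unfolding wires_def by auto
  have WC: "level k x = q (Suc k)" "u (Suc k) = u k" "level k (pencil_side x g) = q k - coeff_mat k *\<^sub>v u k"
    if "\<not> inverted k" "Suc k < m" for k using W that unfolding wires_def by auto
  have WL: "level (m - 1) x = u (m - 1)" "level (m - 1) (pencil_side x g) = q (m - 1) - coeff_mat (m - 1) *\<^sub>v u (m - 1)"
    "q 0 = 0\<^sub>v n" using W unfolding wires_def by auto
  have u: "u k = l ^ num_inv k \<cdot>\<^sub>v u0" if "k < m" for k
    using that
  proof (induction k)
    case 0
    then show ?case using u0 by (simp add: u0_def one_smult_vec)
  next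
    case (Suc k)
    show ?case
    proof (cases "inverted k")
      case True
      have "k \<noteq> i0" using not_inv_i0 True Suc.prems by auto
      then have "u (Suc k) = l \<cdot>\<^sub>v u k"
        using WI[OF True] Suc.prems level_pencil_side[OF x g, of k] uc[of k] uc[of "Suc k"] by (simp split: if_splits)
      then show ?thesis using Suc True by (simp add: smult_smult_assoc)
    next
      case False
      then show ?thesis using WC(2) Suc by simp
    qed
  qed
  have q: "q k = incoming u0 g k" if "k < m" for k
  proof -
    have "k \<le> m - 1" using that by simp
    then show ?thesis
    proof (induction rule: inc_induct)
      case base
      have lt: "m - 1 < m" using m2 by simp
      have E: "q (m - 1) - coeff_mat (m - 1) *\<^sub>v u (m - 1) = l \<cdot>\<^sub>v (coeff_mat m *\<^sub>v u (m - 1)) + (if m - 1 = i0 then g else 0\<^sub>v n)"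
        using level_pencil_side[OF x g lt] unfolding WL by simp
      have "q (m - 1) - coeff_mat (m - 1) *\<^sub>v u (m - 1) = incoming u0 g (m - 1) - coeff_mat (m - 1) *\<^sub>v u (m - 1)"
        using E unfolding u[OF lt] by (simp only: incoming_step_last[OF u0 g])
      then show ?case
        using a_smult(2)[of "m - 1" "u (m - 1)"] uc[OF lt] incoming_carrier[OF g]
        by (intro vec_diff_cancel(4)[of "q (m - 1)" n _ "coeff_mat (m - 1) *\<^sub>v u (m - 1)"]) simp_all
    next
      case (step k)
      then have k: "Suc k < m" "k < m" by auto
      have E: "q k - coeff_mat k *\<^sub>v u k = incoming u0 g k - coeff_mat k *\<^sub>v u k"
      proof (cases "inverted k")
        case True
        show ?thesis using WI(2)[OF True k(1)] step.IH incoming_step_inv[OF k(1) True u0 g]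
          unfolding u[OF k(2)] by simp
      next
        case False
        have "k \<noteq> m - 1" using k by auto
        then have "q k - coeff_mat k *\<^sub>v u k = l \<cdot>\<^sub>v q (Suc k) + (if k = i0 then g else 0\<^sub>v n)"
          using level_pencil_side[OF x g k(2)] WC[OF False k(1)] by simp
        then show ?thesis using step.IH incoming_step_not_inv[OF k(1) False u0 g] unfolding u[OF k(2)] by simp
      qed
      show ?case
        using E a_smult(2)[of k "u k"] uc[OF k(2)] k incoming_carrier[OF g]
        by (intro vec_diff_cancel(4)[of "q k" n _ "coeff_mat k *\<^sub>v u k"]) simp_all
    qed
  qed
  have "x = expand u0"
  proof (rule blk_ext[OF x expand_carrier])
    fix k assume k: "k < m"
    show "level k x = level k (expand u0)"
    proof (cases "inverted k \<or> k = m - 1")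
      case True
      then have "level k x = u k" using WI(1)[of k] WL(1) k by (cases "k = m - 1") auto
      then show ?thesis using True level_expand[OF k u0] u[OF k] by simp
    next
      case False
      then have k': "Suc k < m" using k by auto
      then have "level k x = q (Suc k)" using WC(1) False by simp
      then show ?thesis using False level_expand[OF k u0] q[OF k'] incoming_step_not_inv(2)[OF k' _ u0 g] by simp
    qed
  qed
  moreover have "tail_sum 0 0 u0 + g = 0\<^sub>v n"
    using q[of 0] WL(3) m2 by (simp add: incoming_def)
  ultimately show "\<exists>u \<in> carrier_vec n. x = expand u \<and> tail_sum 0 0 u + g = 0\<^sub>v n" using u0 by blast
next
  assume "\<exists>u \<in> carrier_vec n. x = expand u \<and> tail_sum 0 0 u + g = 0\<^sub>v n"
  then obtain u where u: "u \<in> carrier_vec n" and x_eq: "x = expand u" and P: "tail_sum 0 0 u + g = 0\<^sub>v n" by blast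
  have "if inverted k then level k x = l ^ num_inv k \<cdot>\<^sub>v u \<and>
          incoming u g (Suc k) = incoming u g k - coeff_mat k *\<^sub>v (l ^ num_inv k \<cdot>\<^sub>v u) \<and> level k (pencil_side x g) = l ^ num_inv (Suc k) \<cdot>\<^sub>v u
        else level k x = incoming u g (Suc k) \<and> l ^ num_inv (Suc k) \<cdot>\<^sub>v u = l ^ num_inv k \<cdot>\<^sub>v u \<and>
          level k (pencil_side x g) = incoming u g k - coeff_mat k *\<^sub>v (l ^ num_inv k \<cdot>\<^sub>v u)" if k: "Suc k < m" for k
  proof (cases "inverted k")
    case True
    have "k \<noteq> i0" using not_inv_i0 True k by auto
    then show ?thesis
      using True k level_expand[of k u] level_pencil_side[OF x g, of k] incoming_step_inv[OF k True u g] u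
      by (auto simp: x_eq smult_smult_assoc)
  next
    case False
    then show ?thesis
      using k level_expand[of k u] level_pencil_side[OF x g, of k] incoming_step_not_inv[OF k False u g] u
      by (auto simp: x_eq)
  qed
  moreover have "incoming u g 0 = 0\<^sub>v n" using P by (simp add: incoming_def)
  moreover have "level (m - 1) x = l ^ num_inv (m - 1) \<cdot>\<^sub>v u"
    using level_expand[of "m - 1" u] u m2 by (simp add: x_eq)
  moreover from this have "level (m - 1) (pencil_side x g) = incoming u g (m - 1) - coeff_mat (m - 1) *\<^sub>v (l ^ num_inv (m - 1) \<cdot>\<^sub>v u)"
    using level_pencil_side[OF x g, of "m - 1"] incoming_step_last[OF u g] m2 by simp
  moreover have "l ^ num_inv k \<cdot>\<^sub>v u \<in> carrier_vec n" "incoming u g k \<in> carrier_vec n" for k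
    using u g by (auto simp: incoming_def)
  ultimately have W': "wires (\<lambda>k. level k x) (\<lambda>k. level k (pencil_side x g)) (\<lambda>k. l ^ num_inv k \<cdot>\<^sub>v u) (incoming u g)"
    unfolding wires_def by blast
  obtain u' q' where W: "wires (\<lambda>k. level k x) (\<lambda>k. level k (M \<alpha> x)) u' q'"
    using wires_exist[OF x] by blast
  show "M \<alpha> x = pencil_side x g"
    by (rule blk_ext) (use wires_unique[OF W W'] x pencil_side_carrier[OF x] set_\<alpha> in auto)
qed

end

section \<open>The null space of an EGFP\<close>

lemma index_kronecker_e_col:
  assumes C: "C \<in> carrier_mat n r" and k: "k < m" and ij: "i < m * n" "j < r"
  shows "kronecker (e_col m (int m - int k)) C $$ (i, j) =
    (if i div n = m - 1 - k then C $$ (i mod n, j) else 0)"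
proof -
  have "i div n < m" using ij(1) by (simp add: less_mult_imp_div_less)
  moreover have "nat (int m - int k - 1) = m - 1 - k" using k by linarith
  moreover have "m - 1 - k < m" using k by simp
  ultimately show ?thesis
    using C ij by (simp add: kronecker_def e_col_def mat_of_cols_def)
qed

lemma index_kronecker_e_row:
  assumes B: "B \<in> carrier_mat r n" and k: "k < m" and ij: "i < r" "j < m * n"
  shows "kronecker (transpose_mat (e_col m (int m - int k))) B $$ (i, j) =
    (if j div n = m - 1 - k then B $$ (i, j mod n) else 0)"
proof -
  have "j div n < m" using ij(2) by (simp add: less_mult_imp_div_less)
  moreover have "nat (int m - int k - 1) = m - 1 - k" using k by linarith
  moreover have "m - 1 - k < m" using k by simp
  ultimately show ?thesis
    using B ij by (simp add: kronecker_def e_col_def mat_of_cols_def)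
qed

lemma dim_kronecker_e:
  "C \<in> carrier_mat n r \<Longrightarrow> kronecker (e_col m j) C \<in> carrier_mat (m * n) r"
  "B \<in> carrier_mat r n \<Longrightarrow> kronecker (transpose_mat (e_col m j)) B \<in> carrier_mat r (m * n)"
  by (auto simp: kronecker_def e_col_def)

lemma sum_block:
  fixes g :: "nat \<Rightarrow> 'a :: comm_monoid_add"
  assumes "b < m"
  shows "(\<Sum>j = 0..<m * n. if j div n = b then g j else 0) = (\<Sum>i = 0..<n. g (b * n + i))"
proof -
  have sub: "b * n + i < m * n" if "i < n" for i
    using block_index_less[OF assms that] .
  have "(\<Sum>j = 0..<m * n. if j div n = b then g j else 0) = (\<Sum>j \<in> {j \<in> {0..<m * n}. j div n = b}. g j)"
    by (rule sum.inter_filter[symmetric]) simp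
  also have "{j \<in> {0..<m * n}. j div n = b} = (\<lambda>i. b * n + i) ` {0..<n}"
  proof (intro equalityI subsetI)
    fix j assume j: "j \<in> {j \<in> {0..<m * n}. j div n = b}"
    then have "0 < n" by (cases n) auto
    then have "j = b * n + j mod n" "j mod n < n" using j by auto
    then show "j \<in> (\<lambda>i. b * n + i) ` {0..<n}" by auto
  next
    fix j assume "j \<in> (\<lambda>i. b * n + i) ` {0..<n}"
    then obtain i where i: "j = b * n + i" "i < n" by (elim imageE) auto
    then have "j div n = b" by simp
    then show "j \<in> {j \<in> {0..<m * n}. j div n = b}" using sub[OF i(2)] i(1) by simp
  qed
  also have "(\<Sum>j \<in> (\<lambda>i. b * n + i) ` {0..<n}. g j) = (\<Sum>i = 0..<n. g (b * n + i))"
    by (subst sum.reindex) (auto simp: inj_on_def)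
  finally show ?thesis .
qed

context elementary
begin

text \<open>
  The borders \<open>e\<^bsub>m-k\<^esub> \<otimes> C\<close> and \<open>e\<^bsub>m-k\<^esub>\<^sup>T \<otimes> B\<close> write to and read from level \<open>k\<close>.
\<close>

lemma lift_kronecker_col:
  assumes C: "C \<in> carrier_mat n r" and k: "k < m" and y: "y \<in> carrier_vec r"
  shows "lift (kronecker (e_col m (int m - int k)) C) *\<^sub>v y = single m n k (lift C *\<^sub>v y)"
proof (rule eq_vecI)
  have d: "kronecker (e_col m (int m - int k)) C \<in> carrier_mat (m * n) r" using dim_kronecker_e(1)[OF C] .
  then show "dim_vec (lift (kronecker (e_col m (int m - int k)) C) *\<^sub>v y) = dim_vec (single m n k (lift C *\<^sub>v y))"
    by (simp add: single_def of_blks_def)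
  fix i assume "i < dim_vec (single m n k (lift C *\<^sub>v y))"
  then have i: "i < m * n" by (simp add: single_def of_blks_def)
  then have "0 < n" by (cases n) auto
  then have im: "i mod n < n" by simp
  have "i div n < m" using i by (simp add: less_mult_imp_div_less)
  then have eq: "m - 1 - i div n = k \<longleftrightarrow> i div n = m - 1 - k" using k by auto
  have "(lift (kronecker (e_col m (int m - int k)) C) *\<^sub>v y) $ i =
      (\<Sum>j = 0..<r. (if i div n = m - 1 - k then f (C $$ (i mod n, j)) else 0) * y $ j)"
    using d i y index_kronecker_e_col[OF C k i]
    by (auto simp: scalar_prod_def intro!: sum.cong)
  also have "\<dots> = single m n k (lift C *\<^sub>v y) $ i"
    using i im C y eq by (auto simp: single_def of_blks_def scalar_prod_def intro!: sum.cong)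
  finally show "(lift (kronecker (e_col m (int m - int k)) C) *\<^sub>v y) $ i = single m n k (lift C *\<^sub>v y) $ i" .
qed

lemma lift_kronecker_row:
  assumes B: "B \<in> carrier_mat r n" and k: "k < m" and x: "x \<in> carrier_vec (m * n)"
  shows "lift (kronecker (transpose_mat (e_col m (int m - int k))) B) *\<^sub>v x = lift B *\<^sub>v level k x"
proof (rule eq_vecI)
  have d: "kronecker (transpose_mat (e_col m (int m - int k))) B \<in> carrier_mat r (m * n)"
    using dim_kronecker_e(2)[OF B] .
  then show "dim_vec (lift (kronecker (transpose_mat (e_col m (int m - int k))) B) *\<^sub>v x) = dim_vec (lift B *\<^sub>v level k x)"
    using B by simp
  fix i assume "i < dim_vec (lift B *\<^sub>v level k x)"
  then have i: "i < r" using B by simp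
  have "(lift (kronecker (transpose_mat (e_col m (int m - int k))) B) *\<^sub>v x) $ i =
      (\<Sum>j = 0..<m * n. if j div n = m - 1 - k then f (B $$ (i, j mod n)) * x $ j else 0)"
    using d i x index_kronecker_e_row[OF B k i]
    by (auto simp: scalar_prod_def intro!: sum.cong)
  also have "\<dots> = (\<Sum>j = 0..<n. f (B $$ (i, ((m - 1 - k) * n + j) mod n)) * x $ ((m - 1 - k) * n + j))"
    using k by (intro sum_block) simp
  also have "\<dots> = (lift B *\<^sub>v level k x) $ i"
    using B i k by (auto simp: scalar_prod_def blk_index(1) intro!: sum.cong)
  finally show "(lift (kronecker (transpose_mat (e_col m (int m - int k))) B) *\<^sub>v x) $ i = (lift B *\<^sub>v level k x) $ i" .
qed

end

text \<open>
  An EGFP, given by the parts of \<open>\<tau> = (-\<beta>, -m, -\<gamma>)\<close> and with \<open>(\<sigma>, \<beta>, m, \<gamma>)\<close> rearranged to the permutation \<open>\<alpha>\<close>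
  of \<open>{0:m-1}\<close>.
\<close>

locale egfp =
  fixes m n r :: nat and Ac :: "nat \<Rightarrow> complex mat" and A B C E :: "complex mat"
    and \<sigma> \<beta> \<gamma> \<sigma>1 \<sigma>2 \<tau>1 \<tau>2 :: "int list" and X1 X2 Y1 Y2 :: "complex mat list"
  assumes m_ge_2: "2 \<le> m"
    and coeff: "\<And>i. i \<le> m \<Longrightarrow> Ac i \<in> carrier_mat n n"
    and A: "A \<in> carrier_mat r r" and E: "E \<in> carrier_mat r r" "invertible_mat E"
    and C: "C \<in> carrier_mat n r" and B: "B \<in> carrier_mat r n"
    and distinct: "distinct (rev \<beta> @ \<sigma> @ rev \<gamma>)" and set: "set (rev \<beta> @ \<sigma> @ rev \<gamma>) = {0..<int m}"
    and zero: "0 \<in> set \<sigma>"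
    and \<sigma>12: "set \<sigma>1 \<subseteq> set \<sigma>" "set \<sigma>2 \<subseteq> set \<sigma>" "SIP (\<sigma>1 @ \<sigma> @ \<sigma>2)"
    and \<tau>12: "set \<tau>1 \<subseteq> set (map uminus \<beta> @ [- int m] @ map uminus \<gamma>)"
      "set \<tau>2 \<subseteq> set (map uminus \<beta> @ [- int m] @ map uminus \<gamma>)"
      "SIP (\<tau>1 @ (map uminus \<beta> @ [- int m] @ map uminus \<gamma>) @ \<tau>2)"
    and nonsingular: "nonsingular_assignment m n \<sigma>1 X1" "nonsingular_assignment m n \<sigma>2 X2"
      "nonsingular_assignment m n \<tau>1 Y1" "nonsingular_assignment m n \<tau>2 Y2"
begin

abbreviation \<alpha> :: "int list" where "\<alpha> \<equiv> rev \<beta> @ \<sigma> @ rev \<gamma>"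

abbreviation \<tau> :: "int list" where "\<tau> \<equiv> map uminus \<beta> @ [- int m] @ map uminus \<gamma>"

text \<open>
  The levels of the block column with \<open>C\<close> and of the block row with \<open>B\<close>.
\<close>

definition kc :: nat where "kc = nat (climb (\<sigma>1 @ \<sigma>) (- 1))"

definition kr :: nat where "kr = nat (climb (rev (\<sigma> @ \<sigma>2)) (- 1))"

lemma \<sigma>_sub: "set \<sigma> \<subseteq> {0..<int m}" "set \<beta> \<subseteq> {0<..<int m}" "set \<gamma> \<subseteq> {0<..<int m}"
proof -
  show "set \<sigma> \<subseteq> {0..<int m}" using set by auto
  have "0 \<notin> set \<beta>" "0 \<notin> set \<gamma>" using distinct zero by auto
  moreover have "set \<beta> \<subseteq> {0..<int m}" "set \<gamma> \<subseteq> {0..<int m}" using set by auto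
  ultimately show "set \<beta> \<subseteq> {0<..<int m}" "set \<gamma> \<subseteq> {0<..<int m}" by (force simp: order.strict_iff_order)+
qed

lemma \<tau>_sub: "set \<tau> \<subseteq> {- int m..-1}"
  using \<sigma>_sub m_ge_2 by auto

lemma assignments:
  "assignment m n \<sigma>1 X1" "assignment m n \<sigma>2 X2" "assignment m n \<tau>1 Y1" "assignment m n \<tau>2 Y2"
proof -
  have "set \<sigma>1 \<subseteq> {- int m..<int m}" "set \<sigma>2 \<subseteq> {- int m..<int m}"
    using \<sigma>12 \<sigma>_sub by force+
  moreover have "set \<tau>1 \<subseteq> {- int m..<int m}" "set \<tau>2 \<subseteq> {- int m..<int m}"
    using \<tau>12(1,2) \<tau>_sub m_ge_2 by force+
  ultimately show "assignment m n \<sigma>1 X1" "assignment m n \<sigma>2 X2" "assignment m n \<tau>1 Y1" "assignment m n \<tau>2 Y2"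
    using nonsingular unfolding assignment_def nonsingular_assignment_def by auto
qed

lemma mem_not_neg_mem_\<tau>: "k \<in> set \<sigma> \<Longrightarrow> - k \<notin> set \<tau>"
  using distinct \<sigma>_sub by auto

lemma kc: "int kc = climb (\<sigma>1 @ \<sigma>) (- 1)" "kc < m" "int kc \<in> set \<sigma>"
  and kr: "int kr = climb (rev (\<sigma> @ \<sigma>2)) (- 1)" "kr < m" "int kr \<in> set \<sigma>"
proof -
  have s: "0 \<in> set (\<sigma>1 @ \<sigma>)" "0 \<in> set (rev (\<sigma> @ \<sigma>2))" "set (\<sigma>1 @ \<sigma>) \<subseteq> set \<sigma>" "set (rev (\<sigma> @ \<sigma>2)) \<subseteq> set \<sigma>"
    using zero \<sigma>12 by auto
  have n: "0 \<le> climb (\<sigma>1 @ \<sigma>) (- 1)" "0 \<le> climb (rev (\<sigma> @ \<sigma>2)) (- 1)"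
    using climb_nonneg s by blast+
  then show 1: "int kc = climb (\<sigma>1 @ \<sigma>) (- 1)" "int kr = climb (rev (\<sigma> @ \<sigma>2)) (- 1)"
    by (simp_all add: kc_def kr_def)
  show 2: "int kc \<in> set \<sigma>" "int kr \<in> set \<sigma>"
    using climb_mem[of "-1" "\<sigma>1 @ \<sigma>"] climb_mem[of "-1" "rev (\<sigma> @ \<sigma>2)"] n s unfolding 1 by auto
  then show "kc < m" "kr < m" using \<sigma>_sub by auto
qed

text \<open>
  As \<open>kc \<in> \<sigma>\<close>, the index \<open>-kc\<close> is not in \<open>\<tau>\<close>. If \<open>-(kc + 1)\<close> were in \<open>\<tau>\<^sub>1\<close>, it would occur a second time in \<open>\<tau>\<close>,
  with its successor \<open>-kc\<close> in between.
\<close>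

lemma \<tau>1_avoids: "- int kc \<notin> set \<tau>1" "- (int kc + 1) \<notin> set \<tau>1"
  and \<tau>2_avoids: "- int kr \<notin> set \<tau>2" "- (int kr + 1) \<notin> set \<tau>2"
proof -
  note c = mem_not_neg_mem_\<tau>[OF kc(3)] and r = mem_not_neg_mem_\<tau>[OF kr(3)]
  then show "- int kc \<notin> set \<tau>1" "- int kr \<notin> set \<tau>2" using \<tau>12(1,2) by blast+
  have "SIP (\<tau>1 @ \<tau>)" "SIP (\<tau> @ \<tau>2)"
    using \<tau>12(3) SIP_infix[of "[]" "\<tau>1 @ \<tau>" \<tau>2] SIP_infix[of \<tau>1 "\<tau> @ \<tau>2" "[]"] by auto
  moreover have "- (int k + 1) + 1 = - int k" for k by simp
  ultimately show "- (int kc + 1) \<notin> set \<tau>1" "- (int kr + 1) \<notin> set \<tau>2"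
    using SIP_append_mem[of \<tau>1 \<tau> "- (int kc + 1)"] SIP_append_mem[of \<tau> \<tau>2 "- (int kr + 1)"]
      \<tau>12(1,2) c r by (metis Un_iff subsetD)+
qed

text \<open>
  The constant factors on the two sides of the Fiedler pencil.
\<close>

definition U1 :: "complex mat" where
  "U1 = elem_prod m n \<tau>1 Y1 * elem_prod m n \<sigma>1 X1 * elem_prod_P m n Ac (map uminus \<beta>)"

definition V1 :: "complex mat" where
  "V1 = elem_prod_P m n Ac (map uminus \<gamma>) * elem_prod m n \<sigma>2 X2 * elem_prod m n \<tau>2 Y2"

lemma sub_valid:
  "set (map uminus \<beta>) \<subseteq> {- int m..<int m}" "set (map uminus \<gamma>) \<subseteq> {- int m..<int m}"
  "set (rev \<beta>) \<subseteq> {- int m..<int m}" "set (rev \<gamma>) \<subseteq> {- int m..<int m}"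
  "set \<sigma> \<subseteq> {- int m..<int m}" "set [- int m] \<subseteq> {- int m..<int m}"
  using \<sigma>_sub m_ge_2 by force+

lemma factor_carriers:
  "elem_prod m n \<tau>1 Y1 \<in> carrier_mat (m * n) (m * n)"
  "elem_prod m n \<sigma>1 X1 \<in> carrier_mat (m * n) (m * n)"
  "elem_prod m n \<tau>2 Y2 \<in> carrier_mat (m * n) (m * n)"
  "elem_prod m n \<sigma>2 X2 \<in> carrier_mat (m * n) (m * n)"
  "elem_prod_P m n Ac (map uminus \<beta>) \<in> carrier_mat (m * n) (m * n)"
  "elem_prod_P m n Ac (map uminus \<gamma>) \<in> carrier_mat (m * n) (m * n)"
  "elem_prod_P m n Ac (rev \<beta>) \<in> carrier_mat (m * n) (m * n)"
  "elem_prod_P m n Ac (rev \<gamma>) \<in> carrier_mat (m * n) (m * n)"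
  "elem_prod_P m n Ac \<sigma> \<in> carrier_mat (m * n) (m * n)"
  "elem_mat m n (- int m) (Ac m) \<in> carrier_mat (m * n) (m * n)"
  using assignments m_ge_2
  by (auto intro!: elem_prod_carrier elem_prod_P_carrier elem_mat_carrier coeff sub_valid simp del: set_map set_rev)

lemma inverse_\<beta>\<gamma>:
  "elem_prod_P m n Ac (map uminus \<beta>) * elem_prod_P m n Ac (rev \<beta>) = 1\<^sub>m (m * n)"
  "elem_prod_P m n Ac (rev \<gamma>) * elem_prod_P m n Ac (map uminus \<gamma>) = 1\<^sub>m (m * n)"
  "elem_prod_P m n Ac (map uminus \<gamma>) * elem_prod_P m n Ac (rev \<gamma>) = 1\<^sub>m (m * n)"
  "elem_prod_P m n Ac (rev \<beta>) * elem_prod_P m n Ac (map uminus \<beta>) = 1\<^sub>m (m * n)"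
proof -
  show 1: "elem_prod_P m n Ac (map uminus \<beta>) * elem_prod_P m n Ac (rev \<beta>) = 1\<^sub>m (m * n)"
    and 2: "elem_prod_P m n Ac (map uminus \<gamma>) * elem_prod_P m n Ac (rev \<gamma>) = 1\<^sub>m (m * n)"
    by (intro elem_prod_P_neg_inverse m_ge_2 coeff \<sigma>_sub; assumption)+
  show "elem_prod_P m n Ac (rev \<gamma>) * elem_prod_P m n Ac (map uminus \<gamma>) = 1\<^sub>m (m * n)"
    by (rule mat_mult_left_right_inverse[OF factor_carriers(6,8) 2])
  show "elem_prod_P m n Ac (rev \<beta>) * elem_prod_P m n Ac (map uminus \<beta>) = 1\<^sub>m (m * n)"
    by (rule mat_mult_left_right_inverse[OF factor_carriers(5,7) 1])
qed

lemma inverse_mult: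
  fixes M N M' N' :: "complex mat"
  assumes "M \<in> carrier_mat d d" "N \<in> carrier_mat d d" "M' \<in> carrier_mat d d" "N' \<in> carrier_mat d d"
    "M' * M = 1\<^sub>m d" "N' * N = 1\<^sub>m d"
  shows "(N' * M') * (M * N) = 1\<^sub>m d"
proof -
  have "(N' * M') * (M * N) = N' * (M' * M) * N"
    using assms(1-4) by (simp add: assoc_mult_mat[of _ d d _ d _ d])
  then show ?thesis using assms by simp
qed

lemma U1_inverse: "U1 \<in> carrier_mat (m * n) (m * n)"
    "\<exists>W \<in> carrier_mat (m * n) (m * n). W * U1 = 1\<^sub>m (m * n) \<and> U1 * W = 1\<^sub>m (m * n)"
  and V1_inverse: "V1 \<in> carrier_mat (m * n) (m * n)"
    "\<exists>W \<in> carrier_mat (m * n) (m * n). W * V1 = 1\<^sub>m (m * n) \<and> V1 * W = 1\<^sub>m (m * n)"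
proof -
  note c = factor_carriers
  show U: "U1 \<in> carrier_mat (m * n) (m * n)" and V: "V1 \<in> carrier_mat (m * n) (m * n)"
    using c by (auto simp: U1_def V1_def)
  have sub: "set \<sigma>1 \<subseteq> {- int m..<int m}" "set \<sigma>2 \<subseteq> {- int m..<int m}"
    "set \<tau>1 \<subseteq> {- int m..<int m}" "set \<tau>2 \<subseteq> {- int m..<int m}"
    using assignments unfolding assignment_def by auto
  obtain W1 W2 W3 W4 where W: "W1 \<in> carrier_mat (m * n) (m * n)" "W1 * elem_prod m n \<sigma>1 X1 = 1\<^sub>m (m * n)"
    "W2 \<in> carrier_mat (m * n) (m * n)" "W2 * elem_prod m n \<sigma>2 X2 = 1\<^sub>m (m * n)"
    "W3 \<in> carrier_mat (m * n) (m * n)" "W3 * elem_prod m n \<tau>1 Y1 = 1\<^sub>m (m * n)"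
    "W4 \<in> carrier_mat (m * n) (m * n)" "W4 * elem_prod m n \<tau>2 Y2 = 1\<^sub>m (m * n)"
    using elem_prod_inverse[OF m_ge_2 nonsingular(1) sub(1)] elem_prod_inverse[OF m_ge_2 nonsingular(2) sub(2)]
      elem_prod_inverse[OF m_ge_2 nonsingular(3) sub(3)] elem_prod_inverse[OF m_ge_2 nonsingular(4) sub(4)]
    by blast
  have "(elem_prod_P m n Ac (rev \<beta>) * (W1 * W3)) * U1 = 1\<^sub>m (m * n)"
    unfolding U1_def using c W inverse_\<beta>\<gamma>
    by (intro inverse_mult) (auto intro!: inverse_mult mult_carrier_mat)
  moreover have W': "elem_prod_P m n Ac (rev \<beta>) * (W1 * W3) \<in> carrier_mat (m * n) (m * n)" using c W by auto
  ultimately show "\<exists>W \<in> carrier_mat (m * n) (m * n). W * U1 = 1\<^sub>m (m * n) \<and> U1 * W = 1\<^sub>m (m * n)"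
    using mat_mult_left_right_inverse[OF W' U] by blast
  have "(W4 * (W2 * elem_prod_P m n Ac (rev \<gamma>))) * V1 = 1\<^sub>m (m * n)"
    unfolding V1_def using c W inverse_\<beta>\<gamma>
    by (intro inverse_mult) (auto intro!: inverse_mult mult_carrier_mat)
  moreover have W'': "W4 * (W2 * elem_prod_P m n Ac (rev \<gamma>)) \<in> carrier_mat (m * n) (m * n)" using c W by auto
  ultimately show "\<exists>W \<in> carrier_mat (m * n) (m * n). W * V1 = 1\<^sub>m (m * n) \<and> V1 * W = 1\<^sub>m (m * n)"
    using mat_mult_left_right_inverse[OF W'' V] by blast
qed

lemma elem_prod_P_\<tau>:
  "elem_prod_P m n Ac \<tau> = elem_prod_P m n Ac (map uminus \<beta>) * (elem_mat m n (- int m) (Ac m) * elem_prod_P m n Ac (map uminus \<gamma>))"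
proof -
  have 1: "elem_prod_P m n Ac [- int m] = elem_mat m n (- int m) (Ac m)"
    using factor_carriers(10) m_ge_2 by (simp add: elem_prod_P_def P_assign_def)
  have "elem_prod_P m n Ac ([- int m] @ map uminus \<gamma>) = elem_prod_P m n Ac [- int m] * elem_prod_P m n Ac (map uminus \<gamma>)"
    by (intro elem_prod_P_append m_ge_2 coeff sub_valid; assumption)
  moreover have "elem_prod_P m n Ac \<tau> = elem_prod_P m n Ac (map uminus \<beta>) * elem_prod_P m n Ac ([- int m] @ map uminus \<gamma>)"
    by (intro elem_prod_P_append m_ge_2 coeff sub_valid; (assumption)?) (use sub_valid in auto)
  ultimately show ?thesis using 1 by simp
qed

text \<open>
  \<open>M\<^sub>\<alpha>\<^sup>P = M\<^bsub>rev(\<beta>)\<^esub>\<^sup>P M\<^sub>\<sigma>\<^sup>P M\<^bsub>rev(\<gamma>)\<^esub>\<^sup>P\<close>, and the outer factors are the inverses of \<open>M\<^sub>-\<^sub>\<beta>\<^sup>P\<close> and \<open>M\<^sub>-\<^sub>\<gamma>\<^sup>P\<close>.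
\<close>

lemma elem_prod_P_\<sigma>:
  "elem_prod_P m n Ac \<sigma> = elem_prod_P m n Ac (map uminus \<beta>) * (elem_prod_P m n Ac \<alpha> * elem_prod_P m n Ac (map uminus \<gamma>))"
proof -
  note c = factor_carriers
  have 1: "elem_prod_P m n Ac (\<sigma> @ rev \<gamma>) = elem_prod_P m n Ac \<sigma> * elem_prod_P m n Ac (rev \<gamma>)"
    by (intro elem_prod_P_append m_ge_2 coeff sub_valid; assumption)
  have 2: "elem_prod_P m n Ac \<alpha> = elem_prod_P m n Ac (rev \<beta>) * elem_prod_P m n Ac (\<sigma> @ rev \<gamma>)"
    by (intro elem_prod_P_append m_ge_2 coeff sub_valid; (assumption)?) (use sub_valid in auto)
  have "elem_prod_P m n Ac (map uminus \<beta>) * (elem_prod_P m n Ac \<alpha> * elem_prod_P m n Ac (map uminus \<gamma>)) =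
     (elem_prod_P m n Ac (map uminus \<beta>) * elem_prod_P m n Ac (rev \<beta>)) * elem_prod_P m n Ac \<sigma> *
     (elem_prod_P m n Ac (rev \<gamma>) * elem_prod_P m n Ac (map uminus \<gamma>))"
    unfolding 1 2 using c by (simp add: assoc_mult_mat[of _ "m * n" "m * n" _ "m * n" _ "m * n"])
  then show ?thesis using c by (simp add: inverse_\<beta>\<gamma>)
qed

end

text \<open>
  The EGFP, the system matrix and the recovery map over the ring of \<open>f\<close>, with \<open>l\<close> for \<open>\<lambda>\<close>.
\<close>

locale egfp_over = egfp m n r Ac A B C E \<sigma> \<beta> \<gamma> \<sigma>1 \<sigma>2 \<tau>1 \<tau>2 X1 X2 Y1 Y2 +
  comm_ring_hom f
  for m n r Ac A B C E \<sigma> \<beta> \<gamma> \<sigma>1 \<sigma>2 \<tau>1 \<tau>2 X1 X2 Y1 Y2 and f :: "complex \<Rightarrow> 'a :: comm_ring_1" +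
  fixes l :: 'a
begin

sublocale fiedler f m n l Ac \<alpha>
  by unfold_locales (use m_ge_2 coeff distinct set in auto)

definition L_over :: "'a mat" where
  "L_over = lift (elem_prod m n \<tau>1 Y1) * lift (elem_prod m n \<sigma>1 X1) *
     (l \<cdot>\<^sub>m lift (elem_prod_P m n Ac \<tau>) - lift (elem_prod_P m n Ac \<sigma>)) *
     lift (elem_prod m n \<sigma>2 X2) * lift (elem_prod m n \<tau>2 Y2)"

definition D_over :: "'a mat" where "D_over = lift A - l \<cdot>\<^sub>m lift E"

definition LL_over :: "'a mat" where
  "LL_over = four_block_mat L_over (lift (kronecker (e_col m (int m - int kc)) C))
     (lift (kronecker (transpose_mat (e_col m (int m - int kr))) B)) D_over"

definition P_over :: "'a mat" where
  "P_over = mat n n (\<lambda>(i, j). \<Sum>k\<le>m. f (Ac k $$ (i, j)) * l ^ k)"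

definition S_over :: "'a mat" where
  "S_over = four_block_mat P_over (lift C) (lift B) D_over"

lemma L_over_carrier: "L_over \<in> carrier_mat (m * n) (m * n)"
  unfolding L_over_def
  by (intro mult_carrier_mat minus_carrier_mat smult_carrier_mat) (use factor_carriers in auto)

lemma D_over_carrier: "D_over \<in> carrier_mat r r"
  using A E by (auto simp: D_over_def)

lemma LL_over_carrier: "LL_over \<in> carrier_mat (m * n + r) (m * n + r)"
  unfolding LL_over_def by (intro four_block_carrier_mat L_over_carrier D_over_carrier)

lemma P_over_carrier: "P_over \<in> carrier_mat n n"
  by (simp add: P_over_def)

lemma S_over_carrier: "S_over \<in> carrier_mat (n + r) (n + r)"
  unfolding S_over_def by (intro four_block_carrier_mat P_over_carrier D_over_carrier)

lemma P_over_mult_vec: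
  assumes u: "u \<in> carrier_vec n"
  shows "P_over *\<^sub>v u = tail_sum 0 0 u"
proof (rule eq_vecI)
  fix i assume "i < dim_vec (tail_sum 0 0 u)"
  then have i: "i < n" by simp
  have "(P_over *\<^sub>v u) $ i = (\<Sum>j = 0..<n. \<Sum>k\<le>m. f (Ac k $$ (i, j)) * l ^ k * u $ j)"
    using i u by (simp add: P_over_def scalar_prod_def sum_distrib_right)
  also have "\<dots> = (\<Sum>k\<le>m. \<Sum>j = 0..<n. f (Ac k $$ (i, j)) * l ^ k * u $ j)"
    by (rule sum.swap)
  also have "\<dots> = (\<Sum>k\<le>m. l ^ k * (coeff_mat k *\<^sub>v u) $ i)"
  proof (rule sum.cong[OF refl])
    fix k assume "k \<in> {..m}"
    then show "(\<Sum>j = 0..<n. f (Ac k $$ (i, j)) * l ^ k * u $ j) = l ^ k * (coeff_mat k *\<^sub>v u) $ i"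
      using coeff[of k] i u by (auto simp: scalar_prod_def sum_distrib_left intro!: sum.cong)
  qed
  also have "\<dots> = tail_sum 0 0 u $ i" using i by (simp add: tail_sum_def atMost_atLeast0)
  finally show "(P_over *\<^sub>v u) $ i = tail_sum 0 0 u $ i" .
qed (simp add: P_over_def)

text \<open>
  Multiplication by \<open>M\<^bsub>rev(\<beta>)\<^esub>\<^sup>P\<close> lets the block climb from the height of \<open>\<sigma>\<close> to that of \<open>\<alpha>\<close>, so its inverse
  takes it back; then \<open>M\<^bsub>\<sigma>1\<^esub>\<close> lifts it to the height of \<open>(\<sigma>\<^sub>1, \<sigma>)\<close>, and \<open>M\<^bsub>\<tau>1\<^esub>\<close> leaves it there. The part
  \<open>rev(\<gamma>)\<close> of \<open>\<alpha>\<close> is invisible to the scan as it does not contain \<open>0\<close>.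
\<close>

lemma lift_single_U1:
  assumes g: "g \<in> carrier_vec n"
  shows "lift U1 *\<^sub>v single m n i0 g = single m n kc g"
proof -
  note c = factor_carriers
  define k\<sigma> where "k\<sigma> = nat (climb \<sigma> (- 1))"
  have rev\<beta>: "assignment m n (rev \<beta>) (map (P_assign Ac) (rev \<beta>))"
    by (intro assignment_P coeff sub_valid; assumption)
  have "distinct (rev \<beta> @ \<sigma>)" using distinct by auto
  then have "lift (elem_prod_P m n Ac (rev \<beta>)) *\<^sub>v single m n k\<sigma> g =
      single m n (nat (climb (rev \<beta> @ \<sigma>) (- 1))) g"
    unfolding elem_prod_P_def k\<sigma>_def using \<sigma>_sub g zero
    by (intro single_elem_prod_climb[OF rev\<beta>] distinct_SIP) auto
  moreover have "climb (rev \<beta> @ \<sigma>) (- 1) = climb \<alpha> (- 1)"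
    using climb_not_in[of "-1" "rev \<gamma>"] \<sigma>_sub by force
  ultimately have "lift (elem_prod_P m n Ac (rev \<beta>)) *\<^sub>v single m n k\<sigma> g = single m n i0 g"
    by (simp add: i0_def)
  then have "lift (elem_prod_P m n Ac (map uminus \<beta>)) *\<^sub>v single m n i0 g =
      lift (elem_prod_P m n Ac (map uminus \<beta>) * elem_prod_P m n Ac (rev \<beta>)) *\<^sub>v single m n k\<sigma> g"
    by (simp add: lift_mult_vec[OF c(5) c(7)])
  also have "\<dots> = single m n k\<sigma> g" by (simp add: inverse_\<beta>\<gamma> lift_one)
  finally have 1: "lift (elem_prod_P m n Ac (map uminus \<beta>)) *\<^sub>v single m n i0 g = single m n k\<sigma> g" .
  have 2: "lift (elem_prod m n \<sigma>1 X1) *\<^sub>v single m n k\<sigma> g = single m n kc g"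
    unfolding k\<sigma>_def kc_def using \<sigma>12 \<sigma>_sub SIP_infix[of "[]" "\<sigma>1 @ \<sigma>" \<sigma>2] zero g
    by (intro single_elem_prod_climb assignments) auto
  have 3: "lift (elem_prod m n \<tau>1 Y1) *\<^sub>v single m n kc g = single m n kc g"
    using \<tau>12(1) \<tau>_sub \<tau>1_avoids kc g by (intro single_elem_prod_neg assignments) force+
  have "lift U1 *\<^sub>v single m n i0 g = lift (elem_prod m n \<tau>1 Y1) *\<^sub>v
     (lift (elem_prod m n \<sigma>1 X1) *\<^sub>v (lift (elem_prod_P m n Ac (map uminus \<beta>)) *\<^sub>v single m n i0 g))"
    unfolding U1_def using c
    by (subst lift_mult_vec[of _ "m * n" "m * n" _ "m * n"], auto,
        subst lift_mult_vec[of _ "m * n" "m * n" _ "m * n"], auto intro!: mult_mat_vec_carrier)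
  then show ?thesis by (simp add: 1 2 3)
qed

lemma level_V1:
  assumes x: "x \<in> carrier_vec (m * n)"
  shows "level c0 (lift V1 *\<^sub>v x) = level kr x"
proof -
  note c = factor_carriers
  define k\<sigma> where "k\<sigma> = nat (climb (rev \<sigma>) (- 1))"
  define y where "y = lift (elem_prod m n \<tau>2 Y2) *\<^sub>v x"
  define y' where "y' = lift (elem_prod m n \<sigma>2 X2) *\<^sub>v y"
  define w where "w = lift V1 *\<^sub>v x"
  have yc: "y \<in> carrier_vec (m * n)" "y' \<in> carrier_vec (m * n)" "w \<in> carrier_vec (m * n)"
    unfolding y_def y'_def w_def using c x V1_inverse(1) by (auto intro!: mult_mat_vec_carrier)
  have w_eq: "w = lift (elem_prod_P m n Ac (map uminus \<gamma>)) *\<^sub>v y'"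
    unfolding w_def V1_def y_def y'_def using c x
    by (subst lift_mult_vec[of _ "m * n" "m * n" _ "m * n"], auto,
        subst lift_mult_vec[of _ "m * n" "m * n" _ "m * n"], auto intro!: mult_mat_vec_carrier)
  have y'_eq: "lift (elem_prod_P m n Ac (rev \<gamma>)) *\<^sub>v w = y'"
    unfolding w_eq using yc by (simp add: inverse_\<beta>\<gamma> lift_one flip: lift_mult_vec[OF c(8) c(6)])
  have rev\<gamma>: "assignment m n (rev \<gamma>) (map (P_assign Ac) (rev \<gamma>))"
    by (intro assignment_P coeff sub_valid; assumption)
  have "distinct (\<sigma> @ rev \<gamma>)" using distinct by auto
  then have "level k\<sigma> (lift (elem_prod_P m n Ac (rev \<gamma>)) *\<^sub>v w) =
      level (nat (climb (rev (\<sigma> @ rev \<gamma>)) (- 1))) w"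
    unfolding elem_prod_P_def k\<sigma>_def using \<sigma>_sub yc zero
    by (intro level_elem_prod_climb[OF rev\<gamma>] distinct_SIP) auto
  moreover have "climb (rev (\<sigma> @ rev \<gamma>)) (- 1) = climb (rev \<alpha>) (- 1)"
    using climb_not_in[of "-1" "\<beta>"] \<sigma>_sub by force
  ultimately have "level c0 w = level k\<sigma> y'" using y'_eq by (simp add: c0_def)
  also have "\<dots> = level kr y"
    unfolding y'_def k\<sigma>_def kr_def using \<sigma>12 \<sigma>_sub SIP_infix[of \<sigma>1 "\<sigma> @ \<sigma>2" "[]"] zero yc
    by (intro level_elem_prod_climb assignments) auto
  also have "\<dots> = level kr x"
    unfolding y_def using \<tau>12(2) \<tau>_sub \<tau>2_avoids kr x by (intro level_elem_prod_neg assignments) force+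
  finally show ?thesis by (simp add: w_def)
qed

lemma L_over_mult_vec:
  assumes x: "x \<in> carrier_vec (m * n)" and g: "g \<in> carrier_vec n" and w: "w = lift V1 *\<^sub>v x"
  shows "L_over *\<^sub>v x + single m n kc g = lift U1 *\<^sub>v (pencil_side w g - M \<alpha> w)"
proof -
  note c = factor_carriers
  define y where "y = lift (elem_prod m n \<tau>2 Y2) *\<^sub>v x"
  define y' where "y' = lift (elem_prod m n \<sigma>2 X2) *\<^sub>v y"
  define b where "b = lift (elem_mat m n (- int m) (Ac m)) *\<^sub>v w"
  have \<alpha>c: "elem_prod_P m n Ac \<alpha> \<in> carrier_mat (m * n) (m * n)"
    by (intro elem_prod_P_carrier m_ge_2 coeff) (use set in auto)
  have \<tau>c: "elem_prod_P m n Ac \<tau> \<in> carrier_mat (m * n) (m * n)"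
    using c unfolding elem_prod_P_\<tau> by auto
  have yc: "y \<in> carrier_vec (m * n)" "y' \<in> carrier_vec (m * n)" "w \<in> carrier_vec (m * n)" "b \<in> carrier_vec (m * n)"
    unfolding y_def y'_def w b_def using c x V1_inverse(1) by (auto intro!: mult_mat_vec_carrier)
  have M\<alpha>: "M \<alpha> w \<in> carrier_vec (m * n)" using yc set by auto
  have w_eq: "w = lift (elem_prod_P m n Ac (map uminus \<gamma>)) *\<^sub>v y'"
    unfolding w V1_def y_def y'_def using c x
    by (subst lift_mult_vec[of _ "m * n" "m * n" _ "m * n"], auto,
        subst lift_mult_vec[of _ "m * n" "m * n" _ "m * n"], auto intro!: mult_mat_vec_carrier)
  have \<tau>: "lift (elem_prod_P m n Ac \<tau>) *\<^sub>v y' = lift (elem_prod_P m n Ac (map uminus \<beta>)) *\<^sub>v b"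
    unfolding elem_prod_P_\<tau> b_def w_eq using c yc
    by (subst lift_mult_vec[of _ "m * n" "m * n" _ "m * n"], auto,
        subst lift_mult_vec[of _ "m * n" "m * n" _ "m * n"], auto intro!: mult_mat_vec_carrier)
  have \<sigma>: "lift (elem_prod_P m n Ac \<sigma>) *\<^sub>v y' = lift (elem_prod_P m n Ac (map uminus \<beta>)) *\<^sub>v M \<alpha> w"
    unfolding M_def w_eq using c yc \<alpha>c
    by (subst elem_prod_P_\<sigma>, subst lift_mult_vec[of _ "m * n" "m * n" _ "m * n"], auto,
        subst lift_mult_vec[of _ "m * n" "m * n" _ "m * n"], auto intro!: mult_mat_vec_carrier)
  define p where "p = lift (elem_prod_P m n Ac (map uminus \<beta>))"
  have pc: "p \<in> carrier_mat (m * n) (m * n)" using c by (simp add: p_def)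
  have "(l \<cdot>\<^sub>m lift (elem_prod_P m n Ac \<tau>) - lift (elem_prod_P m n Ac \<sigma>)) *\<^sub>v y' =
      l \<cdot>\<^sub>v (lift (elem_prod_P m n Ac \<tau>) *\<^sub>v y') - lift (elem_prod_P m n Ac \<sigma>) *\<^sub>v y'"
  proof -
    have "lift (elem_prod_P m n Ac \<tau>) \<in> carrier_mat (m * n) (m * n)"
      "lift (elem_prod_P m n Ac \<sigma>) \<in> carrier_mat (m * n) (m * n)" using \<tau>c c by auto
    moreover have "(l \<cdot>\<^sub>m N) *\<^sub>v v = l \<cdot>\<^sub>v (N *\<^sub>v v)"
      if "N \<in> carrier_mat (m * n) (m * n)" "v \<in> carrier_vec (m * n)" for N v
      using that by (intro eq_vecI) auto
    ultimately show ?thesis using yc(2)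
      by (subst minus_mult_distrib_mat_vec[of _ "m * n" "m * n"]) auto
  qed
  also have "\<dots> = p *\<^sub>v (l \<cdot>\<^sub>v b) - p *\<^sub>v M \<alpha> w"
    unfolding \<tau> \<sigma> p_def[symmetric] mult_smult_vec[OF pc yc(4)] ..
  also have "\<dots> = p *\<^sub>v (l \<cdot>\<^sub>v b - M \<alpha> w)"
    using pc yc M\<alpha> by (simp add: mult_minus_distrib_mat_vec[of _ "m * n" "m * n"])
  finally have mid: "(l \<cdot>\<^sub>m lift (elem_prod_P m n Ac \<tau>) - lift (elem_prod_P m n Ac \<sigma>)) *\<^sub>v y' =
      p *\<^sub>v (l \<cdot>\<^sub>v b - M \<alpha> w)" .
  have mc: "l \<cdot>\<^sub>m lift (elem_prod_P m n Ac \<tau>) - lift (elem_prod_P m n Ac \<sigma>) \<in> carrier_mat (m * n) (m * n)"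
    using \<tau>c c by (intro minus_carrier_mat) auto
  have lc: "lift (elem_prod m n \<tau>1 Y1) \<in> carrier_mat (m * n) (m * n)"
    "lift (elem_prod m n \<sigma>1 X1) \<in> carrier_mat (m * n) (m * n)"
    "lift (elem_prod m n \<sigma>2 X2) \<in> carrier_mat (m * n) (m * n)"
    "lift (elem_prod m n \<tau>2 Y2) \<in> carrier_mat (m * n) (m * n)" using c by auto
  have assoc: "(N * N') *\<^sub>v v = N *\<^sub>v (N' *\<^sub>v v)"
    if "N \<in> carrier_mat (m * n) (m * n)" "N' \<in> carrier_mat (m * n) (m * n)" "v \<in> carrier_vec (m * n)"
    for N N' :: "'a mat" and v using that by (rule assoc_mult_mat_vec)
  have "L_over *\<^sub>v x = lift (elem_prod m n \<tau>1 Y1) *\<^sub>v (lift (elem_prod m n \<sigma>1 X1) *\<^sub>v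
      ((l \<cdot>\<^sub>m lift (elem_prod_P m n Ac \<tau>) - lift (elem_prod_P m n Ac \<sigma>)) *\<^sub>v y'))"
    unfolding L_over_def y'_def y_def using lc mc x
    by (simp only: assoc mult_carrier_mat[of _ _ "m * n"] mult_mat_vec_carrier[of _ "m * n" "m * n"])
  also have "\<dots> = lift U1 *\<^sub>v (l \<cdot>\<^sub>v b - M \<alpha> w)"
    unfolding mid U1_def p_def using c yc M\<alpha> lc
    by (subst lift_mult_vec[of _ "m * n" "m * n" _ "m * n"], auto,
        subst lift_mult_vec[of _ "m * n" "m * n" _ "m * n"], auto intro!: mult_mat_vec_carrier)
  finally have "L_over *\<^sub>v x + single m n kc g = lift U1 *\<^sub>v (l \<cdot>\<^sub>v b - M \<alpha> w) + lift U1 *\<^sub>v single m n i0 g"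
    using lift_single_U1[OF g] by simp
  also have "\<dots> = lift U1 *\<^sub>v ((l \<cdot>\<^sub>v b - M \<alpha> w) + single m n i0 g)"
    using U1_inverse(1) yc M\<alpha> by (intro mult_add_distrib_mat_vec[symmetric, of _ "m * n" "m * n"]) auto
  also have "(l \<cdot>\<^sub>v b - M \<alpha> w) + single m n i0 g = pencil_side w g - M \<alpha> w"
    unfolding pencil_side_def b_def[symmetric] using yc M\<alpha> single_carrier[of m n i0 g]
    by (intro eq_vecI) (auto simp del: single_carrier)
  finally show ?thesis .
qed

lemma lift_inverse_vec:
  assumes "N \<in> carrier_mat d d" "N' \<in> carrier_mat d d" "N' * N = 1\<^sub>m d" "v \<in> carrier_vec d"
  shows "lift N' *\<^sub>v (lift N *\<^sub>v v) = v"
  using lift_mult_vec[OF assms(2,1,4)] assms by (simp add: lift_one)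

text \<open>
  Cancelling \<open>U\<close> leaves the Fiedler equation for \<open>V x\<close>.
\<close>

theorem egfp_kernel:
  assumes x: "x \<in> carrier_vec (m * n)" and y: "y \<in> carrier_vec r"
  shows "LL_over *\<^sub>v (x @\<^sub>v y) = 0\<^sub>v (m * n + r) \<longleftrightarrow>
    (\<exists>u \<in> carrier_vec n. lift V1 *\<^sub>v x = expand u \<and> level kr x = u \<and>
       tail_sum 0 0 u + lift C *\<^sub>v y = 0\<^sub>v n \<and> lift B *\<^sub>v u + D_over *\<^sub>v y = 0\<^sub>v r)"
proof -
  define g where "g = lift C *\<^sub>v y"
  define w where "w = lift V1 *\<^sub>v x"
  have g: "g \<in> carrier_vec n" unfolding g_def using C y by auto
  have w: "w \<in> carrier_vec (m * n)" unfolding w_def using V1_inverse x by auto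
  have Mw: "M \<alpha> w \<in> carrier_vec (m * n)" using w set by auto
  note rw = pencil_side_carrier[OF w, of g]
  have top: "L_over *\<^sub>v x + lift (kronecker (e_col m (int m - int kc)) C) *\<^sub>v y = lift U1 *\<^sub>v (pencil_side w g - M \<alpha> w)"
    unfolding lift_kronecker_col[OF C kc(2) y] g_def[symmetric] by (rule L_over_mult_vec[OF x g w_def])
  have bot: "lift (kronecker (transpose_mat (e_col m (int m - int kr))) B) *\<^sub>v x + D_over *\<^sub>v y =
      lift B *\<^sub>v level kr x + D_over *\<^sub>v y"
    unfolding lift_kronecker_row[OF B kr(2) x] ..
  have split: "LL_over *\<^sub>v (x @\<^sub>v y) = (lift U1 *\<^sub>v (pencil_side w g - M \<alpha> w)) @\<^sub>v (lift B *\<^sub>v level kr x + D_over *\<^sub>v y)"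
    unfolding LL_over_def
    by (subst four_block_mat_mult_vec[of _ "m * n" "m * n" _ r _ r])
      (use L_over_carrier D_over_carrier dim_kronecker_e[OF C] dim_kronecker_e(2)[OF B] x y in \<open>auto simp: top bot\<close>)
  have zero: "0\<^sub>v (m * n + r) = (0\<^sub>v (m * n) @\<^sub>v 0\<^sub>v r :: 'a vec)" by (intro eq_vecI) auto
  have uc: "lift U1 *\<^sub>v (pencil_side w g - M \<alpha> w) \<in> carrier_vec (m * n)" using U1_inverse(1) rw Mw by auto
  obtain W where W: "W \<in> carrier_mat (m * n) (m * n)" "W * U1 = 1\<^sub>m (m * n)" using U1_inverse(2) by blast
  have "lift U1 *\<^sub>v (pencil_side w g - M \<alpha> w) = 0\<^sub>v (m * n) \<longleftrightarrow> M \<alpha> w = pencil_side w g"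
  proof
    assume "lift U1 *\<^sub>v (pencil_side w g - M \<alpha> w) = 0\<^sub>v (m * n)"
    then have "lift W *\<^sub>v 0\<^sub>v (m * n) = pencil_side w g - M \<alpha> w"
      using lift_inverse_vec[OF U1_inverse(1) W, of "pencil_side w g - M \<alpha> w"] rw Mw by simp
    moreover have "lift W *\<^sub>v 0\<^sub>v (m * n) = 0\<^sub>v (m * n)" using W by (intro eq_vecI) auto
    ultimately have "pencil_side w g - M \<alpha> w = M \<alpha> w - M \<alpha> w" using Mw by simp
    from vec_diff_cancel(4)[OF rw Mw Mw this] show "M \<alpha> w = pencil_side w g" by simp
  next
    assume "M \<alpha> w = pencil_side w g"
    then have "pencil_side w g - M \<alpha> w = 0\<^sub>v (m * n)" using rw by simp
    then show "lift U1 *\<^sub>v (pencil_side w g - M \<alpha> w) = 0\<^sub>v (m * n)" using U1_inverse(1) by (simp, intro eq_vecI) auto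
  qed
  then have "LL_over *\<^sub>v (x @\<^sub>v y) = 0\<^sub>v (m * n + r) \<longleftrightarrow>
      M \<alpha> w = pencil_side w g \<and> lift B *\<^sub>v level kr x + D_over *\<^sub>v y = 0\<^sub>v r"
    unfolding split zero by (subst append_vec_eq[OF uc]) auto
  also have "\<dots> \<longleftrightarrow> (\<exists>u \<in> carrier_vec n. w = expand u \<and> level kr x = u \<and> tail_sum 0 0 u + g = 0\<^sub>v n \<and>
      lift B *\<^sub>v u + D_over *\<^sub>v y = 0\<^sub>v r)"
  proof -
    have "level kr x = u" if "w = expand u" "u \<in> carrier_vec n" for u
      using level_V1[OF x] level_c0_expand[OF that(2)] that(1) by (simp add: w_def)
    then show ?thesis unfolding fiedler_kernel[OF w g] by auto
  qed
  finally show ?thesis by (simp add: w_def g_def)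
qed

lemma S_over_kernel:
  assumes u: "u \<in> carrier_vec n" and y: "y \<in> carrier_vec r"
  shows "S_over *\<^sub>v (u @\<^sub>v y) = 0\<^sub>v (n + r) \<longleftrightarrow>
    tail_sum 0 0 u + lift C *\<^sub>v y = 0\<^sub>v n \<and> lift B *\<^sub>v u + D_over *\<^sub>v y = 0\<^sub>v r"
proof -
  have zero: "0\<^sub>v (n + r) = (0\<^sub>v n @\<^sub>v 0\<^sub>v r :: 'a vec)" by (intro eq_vecI) auto
  have c: "tail_sum 0 0 u + lift C *\<^sub>v y \<in> carrier_vec n" using C y by auto
  have "S_over *\<^sub>v (u @\<^sub>v y) = (tail_sum 0 0 u + lift C *\<^sub>v y) @\<^sub>v (lift B *\<^sub>v u + D_over *\<^sub>v y)"
    unfolding S_over_def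
    by (subst four_block_mat_mult_vec[of _ n n _ r _ r])
      (use C B P_over_carrier D_over_carrier u y in \<open>auto simp: P_over_mult_vec[OF u]\<close>)
  then show ?thesis unfolding zero by (simp only: append_vec_eq[OF c zero_carrier_vec])
qed

lemma recover_kernel:
  assumes "x \<in> carrier_vec (m * n)" "y \<in> carrier_vec r" "LL_over *\<^sub>v (x @\<^sub>v y) = 0\<^sub>v (m * n + r)"
  shows "S_over *\<^sub>v (level kr x @\<^sub>v y) = 0\<^sub>v (n + r)"
proof -
  obtain u where "u \<in> carrier_vec n" "level kr x = u" "tail_sum 0 0 u + lift C *\<^sub>v y = 0\<^sub>v n"
    "lift B *\<^sub>v u + D_over *\<^sub>v y = 0\<^sub>v r"
    using assms egfp_kernel[OF assms(1,2)] by blast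
  then show ?thesis using S_over_kernel[of u y] assms by auto
qed

lemma recover_inj:
  assumes "x \<in> carrier_vec (m * n)" "x' \<in> carrier_vec (m * n)" "y \<in> carrier_vec r"
    and "LL_over *\<^sub>v (x @\<^sub>v y) = 0\<^sub>v (m * n + r)" "LL_over *\<^sub>v (x' @\<^sub>v y) = 0\<^sub>v (m * n + r)"
    and "level kr x = level kr x'"
  shows "x = x'"
proof -
  have "lift V1 *\<^sub>v x = expand (level kr x)" "lift V1 *\<^sub>v x' = expand (level kr x')"
    using assms egfp_kernel[OF assms(1,3)] egfp_kernel[OF assms(2,3)] by auto
  then have "lift V1 *\<^sub>v x = lift V1 *\<^sub>v x'" using assms(6) by simp
  moreover obtain W where "W \<in> carrier_mat (m * n) (m * n)" "W * V1 = 1\<^sub>m (m * n)" using V1_inverse(2) by blast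
  ultimately show ?thesis
    using lift_inverse_vec[OF V1_inverse(1), of W] assms(1,2) by metis
qed

lemma recover_surj:
  assumes u: "u \<in> carrier_vec n" and y: "y \<in> carrier_vec r" and S: "S_over *\<^sub>v (u @\<^sub>v y) = 0\<^sub>v (n + r)"
  obtains x where "x \<in> carrier_vec (m * n)" "LL_over *\<^sub>v (x @\<^sub>v y) = 0\<^sub>v (m * n + r)" "level kr x = u"
proof -
  obtain W where W: "W \<in> carrier_mat (m * n) (m * n)" "V1 * W = 1\<^sub>m (m * n)" using V1_inverse(2) by blast
  define x where "x = lift W *\<^sub>v expand u"
  have x: "x \<in> carrier_vec (m * n)" unfolding x_def using W by (intro mult_mat_vec_carrier) auto
  have V: "lift V1 *\<^sub>v x = expand u" unfolding x_def by (rule lift_inverse_vec[OF W(1) V1_inverse(1) W(2)]) simp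
  have "level kr x = u" using level_V1[OF x] level_c0_expand[OF u] unfolding V by simp
  moreover from this have "LL_over *\<^sub>v (x @\<^sub>v y) = 0\<^sub>v (m * n + r)"
    using egfp_kernel[OF x y] S_over_kernel[OF u y] S V u by blast
  ultimately show thesis using that x by blast
qed

definition recover :: "'a mat" where
  "recover = four_block_mat (lift (kronecker (transpose_mat (e_col m (int m - int kr))) (1\<^sub>m n)))
     (0\<^sub>m n r) (0\<^sub>m r (m * n)) (1\<^sub>m r)"

lemma recover_carrier: "recover \<in> carrier_mat (n + r) (m * n + r)"
  unfolding recover_def using dim_kronecker_e(2)[OF one_carrier_mat[of n], of m "int m - int kr"]
  by (intro four_block_carrier_mat) auto

lemma recover_mult_vec:
  assumes x: "x \<in> carrier_vec (m * n)" and y: "y \<in> carrier_vec r"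
  shows "recover *\<^sub>v (x @\<^sub>v y) = level kr x @\<^sub>v y"
proof -
  have c: "lift (kronecker (transpose_mat (e_col m (int m - int kr))) (1\<^sub>m n)) \<in> carrier_mat n (m * n)"
    using dim_kronecker_e(2)[OF one_carrier_mat[of n], of m "int m - int kr"] by simp
  have "lift (kronecker (transpose_mat (e_col m (int m - int kr))) (1\<^sub>m n)) *\<^sub>v x = level kr x"
    using lift_kronecker_row[OF one_carrier_mat kr(2) x] by (simp add: lift_one)
  then show ?thesis unfolding recover_def using c x y
    by (subst four_block_mat_mult_vec[of _ n "m * n" _ r _ r]) auto
qed

text \<open>
  A null vector \<open>(x, y)\<close> is determined by the level \<open>kr\<close> of \<open>x\<close> and by \<open>y\<close>, and every null vector of the system
  matrix arises in this way.
\<close>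

lemma recover_bij:
  "bij_betw (\<lambda>z. recover *\<^sub>v z) (mat_kernel LL_over) (mat_kernel S_over)"
proof (rule bij_betw_imageI)
  note kL = mat_kernel[OF LL_over_carrier] and kS = mat_kernel[OF S_over_carrier]
  show "inj_on (\<lambda>z. recover *\<^sub>v z) (mat_kernel LL_over)"
  proof (rule inj_onI)
    fix z z' assume z: "z \<in> mat_kernel LL_over" "z' \<in> mat_kernel LL_over" and eq: "recover *\<^sub>v z = recover *\<^sub>v z'"
    obtain x y where xy: "z = x @\<^sub>v y" "x \<in> carrier_vec (m * n)" "y \<in> carrier_vec r"
      using z(1) vec_split_first_last unfolding kL by blast
    obtain x' y' where xy': "z' = x' @\<^sub>v y'" "x' \<in> carrier_vec (m * n)" "y' \<in> carrier_vec r"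
      using z(2) vec_split_first_last unfolding kL by blast
    have "level kr x @\<^sub>v y = level kr x' @\<^sub>v y'"
      using eq unfolding xy(1) xy'(1) recover_mult_vec[OF xy(2,3)] recover_mult_vec[OF xy'(2,3)] .
    then have "level kr x = level kr x'" "y = y'"
      using append_vec_eq[of "level kr x" n "level kr x'" y y'] by auto
    moreover from this have "x = x'" using z recover_inj[OF xy(2) xy'(2) xy(3)] unfolding kL xy(1) xy'(1) by auto
    ultimately show "z = z'" unfolding xy(1) xy'(1) by simp
  qed
  show "(\<lambda>z. recover *\<^sub>v z) ` mat_kernel LL_over = mat_kernel S_over"
  proof (intro equalityI subsetI)
    fix v assume "v \<in> (\<lambda>z. recover *\<^sub>v z) ` mat_kernel LL_over"
    then obtain z where z: "z \<in> mat_kernel LL_over" "v = recover *\<^sub>v z" by blast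
    obtain x y where xy: "z = x @\<^sub>v y" "x \<in> carrier_vec (m * n)" "y \<in> carrier_vec r"
      using z(1) vec_split_first_last unfolding kL by blast
    have "v = level kr x @\<^sub>v y" unfolding z(2) xy(1) by (rule recover_mult_vec[OF xy(2,3)])
    then show "v \<in> mat_kernel S_over" using recover_kernel[OF xy(2,3)] z(1) xy unfolding kL kS by auto
  next
    fix v assume v: "v \<in> mat_kernel S_over"
    obtain u y where uy: "v = u @\<^sub>v y" "u \<in> carrier_vec n" "y \<in> carrier_vec r"
      using v vec_split_first_last unfolding kS by blast
    obtain x where x: "x \<in> carrier_vec (m * n)" "LL_over *\<^sub>v (x @\<^sub>v y) = 0\<^sub>v (m * n + r)" "level kr x = u"
      using recover_surj[OF uy(2,3)] v unfolding kS uy(1) by blast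
    have "v = recover *\<^sub>v (x @\<^sub>v y)" unfolding recover_mult_vec[OF x(1) uy(3)] x(3) uy(1) ..
    moreover have "x @\<^sub>v y \<in> mat_kernel LL_over" using x uy unfolding kL by auto
    ultimately show "v \<in> (\<lambda>z. recover *\<^sub>v z) ` mat_kernel LL_over" by blast
  qed
qed

end

section \<open>Polynomial bases of kernels\<close>

interpretation to_fract: comm_ring_hom "to_fract :: 'a :: idom \<Rightarrow> 'a fract"
  by unfold_locales auto

lemma lincomb_cols:
  fixes ws :: "'a :: field vec list"
  assumes "set ws \<subseteq> carrier_vec d" "distinct ws"
  shows "module.lincomb (module_vec TYPE('a) d) g (set ws) = mat_of_cols d ws *\<^sub>v vec (length ws) (\<lambda>i. g (ws ! i))"
proof -
  interpret vec_space "TYPE('a)" d .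
  show ?thesis
    using lincomb_as_lincomb_list_distinct[OF assms] lincomb_list_as_mat_mult[of ws "\<lambda>i. g (ws ! i)"] assms(1)
    by fastforce
qed

text \<open>
  Coordinates turn the set-based notion of a basis, with distinct columns, into a statement that composes with
  linear maps.
\<close>

lemma basis_kernel_iff:
  fixes G M :: "'a :: field mat"
  assumes G: "G \<in> carrier_mat nr d" and M: "M \<in> carrier_mat d p"
  shows "distinct (cols M) \<and> vectorspace.basis class_ring (module_vec TYPE('a) d \<lparr>carrier := mat_kernel G\<rparr>) (set (cols M))
    \<longleftrightarrow> bij_betw (\<lambda>c. M *\<^sub>v c) (carrier_vec p) (mat_kernel G)"
proof -
  interpret kernel nr d G by unfold_locales (rule G)
  define ws where "ws = cols M"
  have ws: "set ws \<subseteq> carrier_vec d" "length ws = p" "mat_of_cols d ws = M"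
    using M cols_dim[of M] by (auto simp: ws_def)
  have comb: "NC.lincomb g (set ws) = M *\<^sub>v vec p (\<lambda>i. g (ws ! i))" if "distinct ws" for g
    using lincomb_cols[OF ws(1) that] ws by simp
  have col: "M *\<^sub>v unit_vec p i = ws ! i" if "i < p" for i
    using mult_unit_vec[OF M that] M that by (simp add: ws_def)
  have coeff: "\<exists>g. vec p (\<lambda>i. g (ws ! i)) = c" if d: "distinct ws" and c: "c \<in> carrier_vec p" for c :: "'a vec"
  proof -
    define g where "g w = c $ (THE i. i < p \<and> ws ! i = w)" for w
    have "(THE j. j < p \<and> ws ! j = ws ! i) = i" if "i < p" for i
      using d ws(2) that by (intro the_equality) (auto simp: nth_eq_iff_index_eq)
    then have "vec p (\<lambda>i. g (ws ! i)) = c" using c by (intro eq_vecI) (auto simp: g_def)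
    then show ?thesis by blast
  qed
  show ?thesis unfolding ws_def[symmetric]
  proof
    assume a: "distinct ws \<and> basis (set ws)"
    then have b: "lin_indpt (set ws)" "span (set ws) = mat_kernel G" "set ws \<subseteq> mat_kernel G"
      unfolding Ker.basis_def by auto
    have d: "distinct ws" using a by simp
    have "NC.span (set ws) = {NC.lincomb g (set ws) |g. g \<in> set ws \<rightarrow> UNIV}"
      using NC.finite_span[of "set ws"] ws(1) by auto
    then have "mat_kernel G = range (\<lambda>g. M *\<^sub>v vec p (\<lambda>i. g (ws ! i)))"
      using span_same[OF b(3)] b(2) comb[OF d] by auto
    also have "\<dots> = (\<lambda>c. M *\<^sub>v c) ` carrier_vec p"
      using coeff[OF d] by (auto simp: image_iff)
    finally have img: "(\<lambda>c. M *\<^sub>v c) ` carrier_vec p = mat_kernel G" by simp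
    have "c = c'" if c: "c \<in> carrier_vec p" "c' \<in> carrier_vec p" and eq: "M *\<^sub>v c = M *\<^sub>v c'" for c c'
    proof -
      obtain g where g: "vec p (\<lambda>i. g (ws ! i)) = c - c'" using coeff[OF d, of "c - c'"] c by auto
      have "M *\<^sub>v (c - c') = 0\<^sub>v d"
        using mult_minus_distrib_mat_vec[OF M c] eq M c by simp
      then have "NC.lincomb g (set ws) = 0\<^sub>v d" using comb[OF d, of g] g by simp
      moreover have "\<not> NC.lin_dep (set ws)" using b lindep_same by blast
      ultimately have "g w = 0" if "w \<in> set ws" for w
        using that unfolding NC.lin_dep_def by blast
      then have "c - c' = 0\<^sub>v p" using ws(2) by (intro eq_vecI) (auto simp flip: g)
      then have "c $ i - c' $ i = 0" if "i < p" for i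
        using c that by (metis index_minus_vec(1) index_zero_vec(1) carrier_vecD)
      then show ?thesis using c by (intro eq_vecI) auto
    qed
    then show "bij_betw (\<lambda>c. M *\<^sub>v c) (carrier_vec p) (mat_kernel G)"
      using img by (auto simp: bij_betw_def inj_on_def)
  next
    assume bij: "bij_betw (\<lambda>c. M *\<^sub>v c) (carrier_vec p) (mat_kernel G)"
    have inj: "c = c'" if "c \<in> carrier_vec p" "c' \<in> carrier_vec p" "M *\<^sub>v c = M *\<^sub>v c'" for c c'
      using bij that unfolding bij_betw_def inj_on_def by blast
    have d: "distinct ws"
      unfolding distinct_conv_nth ws(2)
    proof (intro allI impI notI)
      fix i j assume ij: "i < p" "j < p" "i \<noteq> j" "ws ! i = ws ! j"
      then have "unit_vec p i = (unit_vec p j :: 'a vec)" using inj[of "unit_vec p i" "unit_vec p j"] col by simp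
      then have "unit_vec p i $ i = (unit_vec p j $ i :: 'a)" by simp
      then show False using ij by simp
    qed
    have sub: "set ws \<subseteq> mat_kernel G"
      using bij col ws(2) unfolding bij_betw_def by (auto simp: in_set_conv_nth) (metis imageI unit_vec_carrier)
    have "NC.span (set ws) = {NC.lincomb g (set ws) |g. g \<in> set ws \<rightarrow> UNIV}"
      using NC.finite_span[of "set ws"] ws(1) by auto
    then have span: "span (set ws) = range (\<lambda>g. M *\<^sub>v vec p (\<lambda>i. g (ws ! i)))"
      using span_same[OF sub] comb[OF d] by auto
    have "span (set ws) = mat_kernel G"
    proof
      show "span (set ws) \<subseteq> mat_kernel G"
        unfolding span using bij unfolding bij_betw_def by auto
      show "mat_kernel G \<subseteq> span (set ws)"
      proof
        fix v assume "v \<in> mat_kernel G"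
        then obtain c where c: "c \<in> carrier_vec p" "v = M *\<^sub>v c" using bij unfolding bij_betw_def by blast
        then show "v \<in> span (set ws)" unfolding span using coeff[OF d c(1)] by (metis rangeI)
      qed
    qed
    moreover have "\<not> NC.lin_dep (set ws)"
    proof (rule NC.finite_lin_indpt2)
      fix g assume "NC.lincomb g (set ws) = 0\<^sub>v d"
      then have "M *\<^sub>v vec p (\<lambda>i. g (ws ! i)) = 0\<^sub>v d" using comb[OF d] by simp
      moreover have "M *\<^sub>v 0\<^sub>v p = 0\<^sub>v d" using M by (intro eq_vecI) auto
      ultimately have "vec p (\<lambda>i. g (ws ! i)) = 0\<^sub>v p" using inj by simp
      then have "g (ws ! i) = 0" if "i < p" for i using that by (metis index_vec index_zero_vec(1))
      then show "\<forall>v\<in>set ws. g v = 0" using ws(2) by (auto simp: in_set_conv_nth)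
    qed (use ws in auto)
    ultimately show "distinct ws \<and> basis (set ws)"
      unfolding Ker.basis_def using d sub lindep_same[OF sub] by auto
  qed
qed

lemma polynomial_basis_iff:
  assumes G: "G \<in> carrier_mat nr d"
  shows "polynomial_basis d (mat_kernel G) Z \<longleftrightarrow>
    dim_row Z = d \<and> bij_betw (\<lambda>c. rat_mat Z *\<^sub>v c) (carrier_vec (dim_col Z)) (mat_kernel G)"
proof -
  have "distinct (cols (rat_mat Z)) \<and> vectorspace.basis class_ring
      (module_vec TYPE(complex poly fract) d \<lparr>carrier := mat_kernel G\<rparr>) (set (cols (rat_mat Z))) \<longleftrightarrow>
      bij_betw (\<lambda>c. rat_mat Z *\<^sub>v c) (carrier_vec (dim_col Z)) (mat_kernel G)" if "dim_row Z = d"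
    by (rule basis_kernel_iff[OF G]) (use that in auto)
  then show ?thesis unfolding polynomial_basis_def by blast
qed

lemma polynomial_basis_dim_col:
  assumes G: "G \<in> carrier_mat nr d"
    and Z: "polynomial_basis d (mat_kernel G) Z" and W: "polynomial_basis d (mat_kernel G) W"
  shows "dim_col Z = dim_col W"
proof -
  interpret kernel nr d G by unfold_locales (rule G)
  have "dim = dim_col Y" if "polynomial_basis d (mat_kernel G) Y" for Y
    using Ker.dim_basis[of "set (cols (rat_mat Y))"] that distinct_card[of "cols (rat_mat Y)"]
    unfolding polynomial_basis_def by auto
  then show ?thesis using Z W by metis
qed

lemma col_rat_mat: "j < dim_col Z \<Longrightarrow> col (rat_mat Z) j = map_vec to_fract (col Z j)"
  by (intro eq_vecI) auto

lemma rat_mat_mult: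
  assumes "R \<in> carrier_mat a b" "Z \<in> carrier_mat b c"
  shows "rat_mat (R * Z) = rat_mat R * rat_mat Z"
  by (rule to_fract.mat_hom_mult[OF assms])

lemma rat_mult_vec:
  assumes "R \<in> carrier_mat a b" "z \<in> carrier_vec b"
  shows "map_vec to_fract (R *\<^sub>v z) = rat_mat R *\<^sub>v map_vec to_fract z"
  by (rule to_fract.mult_mat_vec_hom[OF assms])

text \<open>
  \<open>R\<close> pushes polynomial bases of the first kernel forward, and by \<open>surj\<close> every polynomial basis of the second
  kernel is such an image. All degrees differ by \<open>s\<close>, and any two bases have equally many vectors, so the degree
  sums differ by the same constant and minimality is preserved.
\<close>

lemma minimal_basis_transfer:
  fixes R :: "complex poly mat" and G1 G2 :: "complex poly fract mat"
  assumes G1: "G1 \<in> carrier_mat r1 d1" and G2: "G2 \<in> carrier_mat r2 d2"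
    and R: "R \<in> carrier_mat d2 d1"
    and bij: "bij_betw (\<lambda>z. rat_mat R *\<^sub>v z) (mat_kernel G1) (mat_kernel G2)"
    and surj: "\<And>v. v \<in> carrier_vec d2 \<Longrightarrow> map_vec to_fract v \<in> mat_kernel G2 \<Longrightarrow>
      \<exists>z \<in> carrier_vec d1. map_vec to_fract z \<in> mat_kernel G1 \<and> R *\<^sub>v z = v"
    and degree: "\<And>z. z \<in> carrier_vec d1 \<Longrightarrow> map_vec to_fract z \<in> mat_kernel G1 \<Longrightarrow> z \<noteq> 0\<^sub>v d1 \<Longrightarrow>
      vec_degree z = vec_degree (R *\<^sub>v z) + s"
    and Z: "minimal_basis d1 (mat_kernel G1) Z"
  shows "minimal_basis d2 (mat_kernel G2) (R * Z)"
    and "map vec_degree (cols Z) = map (\<lambda>e. e + s) (map vec_degree (cols (R * Z)))"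
proof -
  have rR: "rat_mat R \<in> carrier_mat d2 d1" using R by simp
  have cols_deg: "map vec_degree (cols W) = map (\<lambda>e. e + s) (map vec_degree (cols (R * W)))"
    if W: "polynomial_basis d1 (mat_kernel G1) W" for W
  proof -
    note W' = W[unfolded polynomial_basis_iff[OF G1]]
    define p where "p = dim_col W"
    have dW: "W \<in> carrier_mat d1 p" using W' unfolding p_def by (intro carrier_matI) simp_all
    have bW: "bij_betw (\<lambda>c. rat_mat W *\<^sub>v c) (carrier_vec p) (mat_kernel G1)"
      unfolding p_def by (rule W'[THEN conjunct2])
    have p: "dim_col W = p" by (simp add: p_def)
    have "vec_degree (col W j) = vec_degree (col (R * W) j) + s" if j: "j < p" for j
    proof -
      let ?u = "unit_vec p j :: complex poly fract vec"
      have u: "rat_mat W *\<^sub>v ?u = map_vec to_fract (col W j)"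
        unfolding mult_unit_vec[OF map_carrier_mat[THEN iffD2, OF dW] j] by (rule col_rat_mat) (simp add: p j)
      have k: "map_vec to_fract (col W j) \<in> mat_kernel G1"
        using bW unfolding bij_betw_def u[symmetric] by auto
      moreover have "col W j \<noteq> 0\<^sub>v d1"
      proof
        assume "col W j = 0\<^sub>v d1"
        then have "rat_mat W *\<^sub>v ?u = 0\<^sub>v d1" unfolding u by (intro eq_vecI) auto
        moreover have "rat_mat W *\<^sub>v 0\<^sub>v p = 0\<^sub>v d1" using dW by (intro mult_zero_vec) simp
        ultimately have "?u = 0\<^sub>v p"
          using bW unfolding bij_betw_def inj_on_def by (metis unit_vec_carrier zero_carrier_vec)
        then have "?u $ j = 0\<^sub>v p $ j" by simp
        then show False using j by simp
      qed
      moreover have "col (R * W) j = R *\<^sub>v col W j" using R dW j by (intro eq_vecI) auto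
      moreover have "col W j \<in> carrier_vec d1" using dW by (intro carrier_vecI) simp
      ultimately show ?thesis using degree[of "col W j"] by simp
    qed
    then show ?thesis by (intro nth_equalityI) (auto simp: p)
  qed
  have push: "polynomial_basis d2 (mat_kernel G2) (R * W)" if W: "polynomial_basis d1 (mat_kernel G1) W" for W
  proof -
    note W' = W[unfolded polynomial_basis_iff[OF G1]]
    define p where "p = dim_col W"
    have dW: "W \<in> carrier_mat d1 p" using W' unfolding p_def by (intro carrier_matI) simp_all
    have bW: "bij_betw (\<lambda>c. rat_mat W *\<^sub>v c) (carrier_vec p) (mat_kernel G1)"
      unfolding p_def by (rule W'[THEN conjunct2])
    have p: "dim_col W = p" by (simp add: p_def)
    have rW: "rat_mat W \<in> carrier_mat d1 p" using dW by simp
    have "rat_mat (R * W) *\<^sub>v c = rat_mat R *\<^sub>v (rat_mat W *\<^sub>v c)" if "c \<in> carrier_vec p" for c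
      unfolding rat_mat_mult[OF R dW] by (rule assoc_mult_mat_vec[OF rR rW that])
    then have "bij_betw (\<lambda>c. rat_mat (R * W) *\<^sub>v c) (carrier_vec p) (mat_kernel G2) \<longleftrightarrow>
      bij_betw ((\<lambda>z. rat_mat R *\<^sub>v z) \<circ> (\<lambda>c. rat_mat W *\<^sub>v c)) (carrier_vec p) (mat_kernel G2)"
      by (intro bij_betw_cong) simp
    then show ?thesis unfolding polynomial_basis_iff[OF G2] using bij_betw_trans[OF bW bij] R by (auto simp: p)
  qed
  \<comment> \<open>Preimages of the columns of \<open>W\<close> are chosen one by one; injectivity of \<open>R\<close> makes them a basis.\<close>
  have pull: "\<exists>W'. polynomial_basis d1 (mat_kernel G1) W' \<and> R * W' = W"
    if W: "polynomial_basis d2 (mat_kernel G2) W" for W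
  proof -
    note W' = W[unfolded polynomial_basis_iff[OF G2]]
    define p where "p = dim_col W"
    have dW: "W \<in> carrier_mat d2 p" using W' unfolding p_def by (intro carrier_matI) simp_all
    have bW: "bij_betw (\<lambda>c. rat_mat W *\<^sub>v c) (carrier_vec p) (mat_kernel G2)"
      unfolding p_def by (rule W'[THEN conjunct2])
    have p: "dim_col W = p" by (simp add: p_def)
    have "\<forall>j \<in> {..<p}. \<exists>z. z \<in> carrier_vec d1 \<and> map_vec to_fract z \<in> mat_kernel G1 \<and> R *\<^sub>v z = col W j"
    proof
      fix j assume "j \<in> {..<p}"
      then have j: "j < p" by simp
      have "rat_mat W *\<^sub>v unit_vec p j = map_vec to_fract (col W j)"
        unfolding mult_unit_vec[OF map_carrier_mat[THEN iffD2, OF dW] j] by (rule col_rat_mat) (simp add: p j)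
      then have "map_vec to_fract (col W j) \<in> mat_kernel G2"
        using bW unfolding bij_betw_def by (metis imageI unit_vec_carrier)
      moreover have "col W j \<in> carrier_vec d2" using dW by (intro carrier_vecI) simp
      ultimately show "\<exists>z. z \<in> carrier_vec d1 \<and> map_vec to_fract z \<in> mat_kernel G1 \<and> R *\<^sub>v z = col W j"
        using surj by blast
    qed
    from bchoice[OF this] obtain z where z: "z j \<in> carrier_vec d1" "map_vec to_fract (z j) \<in> mat_kernel G1" "R *\<^sub>v z j = col W j"
      if "j < p" for j by auto
    define W' where "W' = mat_of_cols d1 (map z [0..<p])"
    have W': "W' \<in> carrier_mat d1 p" by (simp add: W'_def mat_of_cols_def)
    have colW': "col W' j = z j" if "j < p" for j
      unfolding W'_def using that z(1)[OF that] by (subst col_mat_of_cols) auto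
    have RW': "R * W' = W"
    proof (rule mat_col_eqI)
      fix j assume "j < dim_col W"
      then have j: "j < p" by (simp add: p)
      have "col (R * W') j = R *\<^sub>v col W' j" using R W' j by (intro eq_vecI) auto
      then show "col (R * W') j = col W j" using colW'[OF j] z(3)[OF j] by simp
    qed (use R W' dW in auto)
    have G1W': "G1 * rat_mat W' = 0\<^sub>m r1 p"
    proof (rule mat_col_eqI)
      fix j assume "j < dim_col (0\<^sub>m r1 p :: complex poly fract mat)"
      then have j: "j < p" by simp
      have "col (G1 * rat_mat W') j = G1 *\<^sub>v col (rat_mat W') j" using G1 W' j by (intro eq_vecI) auto
      also have "col (rat_mat W') j = map_vec to_fract (z j)"
        using col_rat_mat[of j W'] colW'[OF j] W' j by simp
      also have "G1 *\<^sub>v \<dots> = 0\<^sub>v r1" using mat_kernelD[OF G1 z(2)[OF j]] by simp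
      finally show "col (G1 * rat_mat W') j = col (0\<^sub>m r1 p) j" using j by (intro eq_vecI) auto
    qed (use G1 W' in auto)
    have rW': "rat_mat W' \<in> carrier_mat d1 p" using W' by simp
    have into: "rat_mat W' *\<^sub>v c \<in> mat_kernel G1" if c: "c \<in> carrier_vec p" for c
    proof (rule mat_kernelI[OF G1])
      show "rat_mat W' *\<^sub>v c \<in> carrier_vec d1" using rW' c by simp
      show "G1 *\<^sub>v (rat_mat W' *\<^sub>v c) = 0\<^sub>v r1"
      proof -
        have "0\<^sub>m r1 p *\<^sub>v c = 0\<^sub>v r1" using c by (intro eq_vecI) auto
        then show ?thesis using assoc_mult_mat_vec[OF G1 rW' c] unfolding G1W' by metis
      qed
    qed
    have comp: "rat_mat R *\<^sub>v (rat_mat W' *\<^sub>v c) = rat_mat W *\<^sub>v c" if "c \<in> carrier_vec p" for c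
      using assoc_mult_mat_vec[OF rR rW' that] rat_mat_mult[OF R W'] RW' by simp
    have "bij_betw (\<lambda>c. rat_mat W' *\<^sub>v c) (carrier_vec p) (mat_kernel G1)"
    proof (rule bij_betw_imageI)
      show "inj_on (\<lambda>c. rat_mat W' *\<^sub>v c) (carrier_vec p)"
        using bW comp unfolding bij_betw_def inj_on_def p_def by metis
      show "(\<lambda>c. rat_mat W' *\<^sub>v c) ` carrier_vec p = mat_kernel G1"
      proof (intro equalityI subsetI)
        fix x assume x: "x \<in> mat_kernel G1"
        then have "rat_mat R *\<^sub>v x \<in> mat_kernel G2" using bij unfolding bij_betw_def by auto
        then obtain c where c: "c \<in> carrier_vec p" "rat_mat R *\<^sub>v x = rat_mat W *\<^sub>v c"
          using bW unfolding bij_betw_def p_def by auto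
        then have "rat_mat R *\<^sub>v x = rat_mat R *\<^sub>v (rat_mat W' *\<^sub>v c)" using comp by simp
        then have "x = rat_mat W' *\<^sub>v c"
          using bij x into[OF c(1)] unfolding bij_betw_def inj_on_def by blast
        then show "x \<in> (\<lambda>c. rat_mat W' *\<^sub>v c) ` carrier_vec p" using c by blast
      qed (use into in auto)
    qed
    then have "polynomial_basis d1 (mat_kernel G1) W'"
      unfolding polynomial_basis_iff[OF G1] using W' by auto
    then show ?thesis using RW' by blast
  qed
  have bZ: "polynomial_basis d1 (mat_kernel G1) Z" and sZ: "sorted (map vec_degree (cols Z))"
    and mZ: "\<And>W. polynomial_basis d1 (mat_kernel G1) W \<Longrightarrow>
      sum_list (map vec_degree (cols Z)) \<le> sum_list (map vec_degree (cols W))"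
    using Z unfolding minimal_basis_def by auto
  show eq: "map vec_degree (cols Z) = map (\<lambda>e. e + s) (map vec_degree (cols (R * Z)))"
    by (rule cols_deg[OF bZ])
  have sum_shift: "sum_list (map (\<lambda>e. e + s) xs) = sum_list xs + s * length xs" for xs :: "nat list"
    by (induction xs) auto
  have "sorted (map vec_degree (cols (R * Z)))"
    using sZ unfolding eq by (simp add: sorted_iff_nth_mono_less)
  moreover have "sum_list (map vec_degree (cols (R * Z))) \<le> sum_list (map vec_degree (cols W))"
    if W: "polynomial_basis d2 (mat_kernel G2) W" for W
  proof -
    obtain W' where W': "polynomial_basis d1 (mat_kernel G1) W'" "R * W' = W" using pull[OF W] by blast
    have "dim_col W' = dim_col Z" by (rule polynomial_basis_dim_col[OF G1 W'(1) bZ])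
    then have "length (cols (R * W')) = length (cols (R * Z))" by simp
    then show ?thesis
      using mZ[OF W'(1)] unfolding eq cols_deg[OF W'(1)] W'(2) sum_shift by simp
  qed
  ultimately show "minimal_basis d2 (mat_kernel G2) (R * Z)"
    unfolding minimal_basis_def using push[OF bZ] by blast
qed

section \<open>Degrees of null vectors\<close>

text \<open>
  In contrast to \<open>vec_degree\<close>, such a bound makes sense for vectors without entries, so it can be split over
  blocks of any size.
\<close>

definition deg_le :: "complex poly vec \<Rightarrow> nat \<Rightarrow> bool" where
  "deg_le v k \<longleftrightarrow> (\<forall>i < dim_vec v. degree (v $ i) \<le> k)"

lemma vec_degree_le_iff:
  assumes "0 < dim_vec v"
  shows "vec_degree v \<le> k \<longleftrightarrow> deg_le v k"
proof -
  have "vec_set v = vec_index v ` {..<dim_vec v}" by (auto simp: vec_set_def)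
  moreover have "vec_index v ` {..<dim_vec v} \<noteq> {}" using assms by (auto simp: lessThan_empty_iff)
  ultimately show ?thesis unfolding vec_degree_def deg_le_def by (subst Max_le_iff) auto
qed

lemma deg_le_append: "deg_le (x @\<^sub>v y) k \<longleftrightarrow> deg_le x k \<and> deg_le y k"
proof
  assume a: "deg_le (x @\<^sub>v y) k"
  have "degree (x $ i) \<le> k" if "i < dim_vec x" for i
    using a that unfolding deg_le_def by (metis index_append_vec trans_less_add1)
  moreover have "degree (y $ i) \<le> k" if i: "i < dim_vec y" for i
  proof -
    have "(x @\<^sub>v y) $ (dim_vec x + i) = y $ i" using i by simp
    moreover have "dim_vec x + i < dim_vec (x @\<^sub>v y)" using i by simp
    ultimately show ?thesis using a unfolding deg_le_def by metis
  qed
  ultimately show "deg_le x k \<and> deg_le y k" unfolding deg_le_def by blast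
qed (auto simp: deg_le_def)

lemma deg_le_const_mult:
  assumes M: "M \<in> carrier_mat a b" and v: "v \<in> carrier_vec b" and k: "deg_le v k"
  shows "deg_le (const_mat M *\<^sub>v v) k"
  unfolding deg_le_def
proof (intro allI impI)
  fix i assume "i < dim_vec (const_mat M *\<^sub>v v)"
  then have i: "i < a" using M by simp
  have "(const_mat M *\<^sub>v v) $ i = (\<Sum>j = 0..<b. [:M $$ (i, j):] * v $ j)"
    using M v i by (simp add: scalar_prod_def)
  also have "degree \<dots> \<le> k"
  proof (rule degree_sum_le)
    fix j assume "j \<in> {0..<b}"
    then have "degree (v $ j) \<le> k" using k v unfolding deg_le_def by auto
    then show "degree ([:M $$ (i, j):] * v $ j) \<le> k"
      using degree_mult_le[of "[:M $$ (i, j):]" "v $ j"] by simp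
  qed simp
  finally show "degree ((const_mat M *\<^sub>v v) $ i) \<le> k" .
qed

text \<open>
  An entry of maximal degree that is not \<open>0\<close>; a maximal entry may vanish if all degrees are \<open>0\<close>.
\<close>

lemma vec_max_degree:
  assumes "v \<noteq> 0\<^sub>v (dim_vec v)"
  obtains i where "i < dim_vec v" "v $ i \<noteq> 0" "deg_le v (degree (v $ i))"
proof -
  let ?I = "{i. i < dim_vec v \<and> v $ i \<noteq> 0}"
  have fin: "finite ?I" by simp
  have ne: "?I \<noteq> {}"
  proof
    assume "?I = {}"
    then have "v = 0\<^sub>v (dim_vec v)" by (intro eq_vecI) auto
    with assms show False by blast
  qed
  define e where "e = Max ((\<lambda>i. degree (v $ i)) ` ?I)"
  have "e \<in> (\<lambda>i. degree (v $ i)) ` ?I" unfolding e_def using fin ne by (intro Max_in) auto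
  then obtain i where i: "i \<in> ?I" "e = degree (v $ i)" by auto
  have "degree (v $ j) \<le> e" if "j < dim_vec v" for j
  proof (cases "v $ j = 0")
    case False
    then show ?thesis unfolding e_def using fin that by (intro Max_ge) auto
  qed simp
  then show thesis using i that[of i] by (auto simp: deg_le_def)
qed

lemma degree_X_power_mult: "(p :: complex poly) \<noteq> 0 \<Longrightarrow> degree ([:0, 1:] ^ k * p) = k + degree p"
  by (subst degree_mult_eq) (auto simp: degree_power_eq)

text \<open>
  Multiplied by \<open>X\<^sup>c\<close>, the Horner shift is the upper part of the sum \<open>P\<close>, hence up to sign the lower part
  together with \<open>g\<close>, whose degree is at most \<open>k + e\<close>.
\<close>

lemma horner_shift_degree:
  fixes X t g :: "complex poly"
  assumes X: "X = [:0, 1:]"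
    and t: "t = (\<Sum>l = Suc k..m. X ^ (l - c) * w l)"
    and P: "(\<Sum>l = 0..m. X ^ l * w l) + g = 0"
    and w: "\<And>l. l \<le> m \<Longrightarrow> degree (w l) \<le> e" and g: "degree g \<le> e"
    and c: "c \<le> Suc k" and k: "Suc k \<le> m"
  shows "t = 0 \<or> degree t + c \<le> k + e"
proof (cases "t = 0")
  case False
  have "X ^ c * (X ^ (l - c) * w l) = X ^ l * w l" if "l \<in> {Suc k..m}" for l
  proof -
    have "c + (l - c) = l" using that c by simp
    then show ?thesis by (metis mult.assoc power_add)
  qed
  then have "X ^ c * t = (\<Sum>l = Suc k..m. X ^ l * w l)"
    unfolding t sum_distrib_left by (intro sum.cong refl)
  moreover have "(\<Sum>l = 0..m. X ^ l * w l) = (\<Sum>l = 0..k. X ^ l * w l) + (\<Sum>l = Suc k..m. X ^ l * w l)"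
    using sum.ub_add_nat[of 0 k "\<lambda>l. X ^ l * w l" "m - k"] k by simp
  ultimately have "X ^ c * t + ((\<Sum>l = 0..k. X ^ l * w l) + g) = 0" using P by (simp add: ac_simps)
  then have eq: "X ^ c * t = - ((\<Sum>l = 0..k. X ^ l * w l) + g)" by (rule eq_neg_iff_add_eq_0[THEN iffD2])
  have "degree (\<Sum>l = 0..k. X ^ l * w l) \<le> k + e"
  proof (rule degree_sum_le)
    fix l assume l: "l \<in> {0..k}"
    show "degree (X ^ l * w l) \<le> k + e"
    proof (cases "w l = 0")
      case False
      then have "degree (X ^ l * w l) = l + degree (w l)" unfolding X by (rule degree_X_power_mult)
      then show ?thesis using l k w[of l] by simp
    qed simp
  qed simp
  then have "degree (X ^ c * t) \<le> k + e"
    unfolding eq degree_minus using g by (intro degree_add_le) auto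
  moreover have "degree (X ^ c * t) = c + degree t" unfolding X by (rule degree_X_power_mult[OF False])
  ultimately show ?thesis by simp
qed simp

text \<open>
  Multiplying by \<open>E\<^sup>-\<^sup>1\<close> gives \<open>\<lambda> y = E\<^sup>-\<^sup>1 (A y + B u)\<close>. If an entry of \<open>y\<close> had a degree that is maximal in \<open>y\<close>
  and not below that of \<open>u\<close>, the left side would exceed every degree on the right.
\<close>

lemma state_degree:
  fixes A B E :: "complex mat"
  assumes A: "A \<in> carrier_mat r r" and E: "E \<in> carrier_mat r r" "invertible_mat E"
    and B: "B \<in> carrier_mat r n" and u: "u \<in> carrier_vec n" and y: "y \<in> carrier_vec r"
    and eq: "const_mat B *\<^sub>v u + (const_mat A - [:0, 1:] \<cdot>\<^sub>m const_mat E) *\<^sub>v y = 0\<^sub>v r"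
  shows "deg_le u k \<Longrightarrow> deg_le y k" and "u = 0\<^sub>v n \<Longrightarrow> y = 0\<^sub>v r"
proof -
  interpret const: comm_ring_hom "\<lambda>c. [:c:] :: complex poly" by unfold_locales auto
  obtain E' where E': "E' \<in> carrier_mat r r" "E' * E = 1\<^sub>m r" using invertible_obtain[OF E(2,1)] .
  let ?c = const_mat
  have Ey: "?c E *\<^sub>v y \<in> carrier_vec r" "?c A *\<^sub>v y \<in> carrier_vec r" "?c B *\<^sub>v u \<in> carrier_vec r"
    using E A B y u by auto
  have "(?c A - [:0, 1:] \<cdot>\<^sub>m ?c E) *\<^sub>v y = ?c A *\<^sub>v y - [:0, 1:] \<cdot>\<^sub>v (?c E *\<^sub>v y)"
  proof -
    have "([:0, 1:] \<cdot>\<^sub>m ?c E) *\<^sub>v y = [:0, 1:] \<cdot>\<^sub>v (?c E *\<^sub>v y)" using E y by (intro eq_vecI) auto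
    then show ?thesis using A E y by (subst minus_mult_distrib_mat_vec[of _ r r]) auto
  qed
  then have e1: "?c B *\<^sub>v u + (?c A *\<^sub>v y - [:0, 1:] \<cdot>\<^sub>v (?c E *\<^sub>v y)) = 0\<^sub>v r" using eq by simp
  have e2: "[:0, 1:] \<cdot>\<^sub>v (?c E *\<^sub>v y) = ?c B *\<^sub>v u + ?c A *\<^sub>v y"
  proof (rule eq_vecI)
    fix i assume "i < dim_vec (?c B *\<^sub>v u + ?c A *\<^sub>v y)"
    then have i: "i < r" using A by simp
    have "(?c B *\<^sub>v u + (?c A *\<^sub>v y - [:0, 1:] \<cdot>\<^sub>v (?c E *\<^sub>v y))) $ i = 0" unfolding e1 using i by simp
    moreover have "(?c B *\<^sub>v u + (?c A *\<^sub>v y - [:0, 1:] \<cdot>\<^sub>v (?c E *\<^sub>v y))) $ i =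
        (?c B *\<^sub>v u) $ i + ((?c A *\<^sub>v y) $ i - ([:0, 1:] \<cdot>\<^sub>v (?c E *\<^sub>v y)) $ i)"
      using i Ey by (simp del: index_mult_mat_vec index_smult_vec)
    moreover have "(?c B *\<^sub>v u + ?c A *\<^sub>v y) $ i = (?c B *\<^sub>v u) $ i + (?c A *\<^sub>v y) $ i"
      using i A by (intro index_add_vec(1)) simp
    ultimately show "([:0, 1:] \<cdot>\<^sub>v (?c E *\<^sub>v y)) $ i = (?c B *\<^sub>v u + ?c A *\<^sub>v y) $ i"
      by (simp only: add_diff_eq eq_iff_diff_eq_0[symmetric])
  qed (use E A in auto)
  define b where "b = ?c B *\<^sub>v u + ?c A *\<^sub>v y"
  have b: "b \<in> carrier_vec r" unfolding b_def using Ey by simp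
  have "?c E' *\<^sub>v ([:0, 1:] \<cdot>\<^sub>v (?c E *\<^sub>v y)) = [:0, 1:] \<cdot>\<^sub>v (?c E' *\<^sub>v (?c E *\<^sub>v y))"
    by (rule mult_smult_vec[of _ r r]) (use E' Ey in auto)
  also have "?c E' *\<^sub>v (?c E *\<^sub>v y) = ?c (E' * E) *\<^sub>v y"
    using E' E y unfolding const.mat_hom_mult[OF E'(1) E(1)] by (intro assoc_mult_mat_vec[symmetric]) auto
  also have "\<dots> = y" unfolding E' using y by (simp add: map_mat_1_hom)
  finally have lam: "[:0, 1:] \<cdot>\<^sub>v y = ?c E' *\<^sub>v b" unfolding e2 b_def by simp
  have bound: "deg_le ([:0, 1:] \<cdot>\<^sub>v y) k" if "deg_le u k" "deg_le y k" for k
  proof -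
    have "deg_le (?c B *\<^sub>v u) k" "deg_le (?c A *\<^sub>v y) k"
      using deg_le_const_mult[OF B u] deg_le_const_mult[OF A y] that by auto
    then have "deg_le b k" unfolding b_def deg_le_def using A B
      by (auto simp del: index_mult_mat_vec intro!: degree_add_le)
    then show ?thesis unfolding lam by (rule deg_le_const_mult[OF E'(1) b])
  qed
  have main: "deg_le y k \<and> (u = 0\<^sub>v n \<longrightarrow> y = 0\<^sub>v r)" if k: "deg_le u k" for k
  proof (cases "y = 0\<^sub>v r")
    case True
    then show ?thesis by (auto simp: deg_le_def)
  next
    case False
    then obtain i where i: "i < dim_vec y" "y $ i \<noteq> 0" "deg_le y (degree (y $ i))"
      using vec_max_degree[of y] y by auto
    have less: "\<not> deg_le u (degree (y $ i))"
    proof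
      assume "deg_le u (degree (y $ i))"
      then have "degree (([:0, 1:] \<cdot>\<^sub>v y) $ i) \<le> degree (y $ i)" using bound[OF _ i(3)] i(1) unfolding deg_le_def by simp
      moreover have "degree (([:0, 1:] \<cdot>\<^sub>v y) $ i) = Suc (degree (y $ i))"
        using i degree_X_power_mult[OF i(2), of 1] by simp
      ultimately show False by simp
    qed
    then have "degree (y $ i) \<le> k" using k unfolding deg_le_def by (meson dual_order.trans nat_le_linear)
    then have "deg_le y k" using i(3) unfolding deg_le_def by (meson dual_order.trans)
    moreover have "u \<noteq> 0\<^sub>v n" using less by (auto simp: deg_le_def)
    ultimately show ?thesis by simp
  qed
  show "deg_le u k \<Longrightarrow> deg_le y k" using main by blast
  show "u = 0\<^sub>v n \<Longrightarrow> y = 0\<^sub>v r" using main[of 0] by (auto simp: deg_le_def)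
qed

context egfp
begin

interpretation poly: egfp_over m n r Ac A B C E \<sigma> \<beta> \<gamma> \<sigma>1 \<sigma>2 \<tau>1 \<tau>2 X1 X2 Y1 Y2
  "\<lambda>c. [:c:]" "[:0, 1:]"
  by unfold_locales auto

text \<open>
  Level \<open>m - 1\<close> of the null vector is \<open>\<lambda>\<close> to the power \<open>i(\<alpha>)\<close> times \<open>u\<close> and attains the degree; no other level exceeds it.
\<close>

lemma deg_le_expand:
  assumes u: "u \<in> carrier_vec n" and y: "y \<in> carrier_vec r" and u0: "u \<noteq> 0\<^sub>v n"
    and P: "poly.tail_sum 0 0 u + const_mat C *\<^sub>v y = 0\<^sub>v n"
    and e: "i < n" "u $ i \<noteq> 0" "deg_le u (degree (u $ i))" "deg_le y (degree (u $ i))"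
  shows "deg_le (poly.expand u) k \<longleftrightarrow> degree (u $ i) + total_inversions m \<alpha> \<le> k"
proof -
  let ?e = "degree (u $ i)"
  have mono: "poly.num_inv j \<le> poly.num_inv (m - 1)" if "j \<le> m - 1" for j
    using that by (induction rule: dec_induct) auto
  have ent: "poly.expand u $ ((m - 1 - k) * n + j) = blk m n k (poly.expand u) $ j" if "k < m" "j < n" for k j
    by (rule blk_index(1)[OF that(2,1), symmetric])
  have dlv: "dim_vec (poly.expand u) = m * n" by (rule carrier_vecD[OF poly.expand_carrier])
  have a_deg: "deg_le (const_mat (Ac j) *\<^sub>v u) ?e" if "j \<le> m" for j
    by (rule deg_le_const_mult[OF coeff[OF that] u e(3)])
  have dimA: "dim_row (Ac j) = n" if "j \<le> m" for j using coeff[OF that] by simp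
  have g_deg: "deg_le (const_mat C *\<^sub>v y) ?e"
    by (rule deg_le_const_mult[OF C y e(4)])
  have top: "deg_le (poly.expand u) (?e + total_inversions m \<alpha>)"
    unfolding deg_le_def
  proof (intro allI impI)
    fix q assume "q < dim_vec (poly.expand u)"
    then have q: "q < m * n" unfolding dlv .
    then have n0: "0 < n" by (cases n) auto
    define k where "k = m - 1 - q div n"
    define j where "j = q mod n"
    have qd: "q div n < m" using q by (simp add: less_mult_imp_div_less)
    then have k: "k < m" "m - 1 - k = q div n" unfolding k_def by auto
    have j: "j < n" unfolding j_def using n0 by simp
    have qeq: "q = (m - 1 - k) * n + j" unfolding k(2) j_def by simp
    show "degree (poly.expand u $ q) \<le> ?e + total_inversions m \<alpha>"
    proof (cases "poly.inverted k \<or> k = m - 1")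
      case True
      then have "poly.expand u $ q = [:0, 1:] ^ poly.num_inv k * u $ j"
        unfolding qeq ent[OF k(1) j] using poly.level_expand[OF k(1) u] u j by simp
      also have "degree \<dots> \<le> poly.num_inv k + degree (u $ j)"
      proof (cases "u $ j = 0")
        case False
        from degree_X_power_mult[OF this] show ?thesis by (rule eq_refl)
      qed simp
      also have "\<dots> \<le> poly.num_inv (m - 1) + ?e"
        using mono[of k] k(1) e(3) u j unfolding deg_le_def by (intro add_mono) auto
      finally show ?thesis unfolding poly.num_inv_total by simp
    next
      case False
      then have k': "Suc k \<le> m" "\<not> poly.inverted k" "k < m - 1" using k by auto
      define t where "t = poly.expand u $ q"
      let ?c = "poly.num_con (Suc k)"
      have t: "t = poly.tail_sum (Suc k) ?c u $ j"
        unfolding t_def qeq ent[OF k(1) j] using poly.level_expand[OF k(1) u] False by simp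
      have c: "?c \<le> Suc k" "?c = Suc (poly.num_con k)" using poly.num_con_plus_num_inv[of "Suc k"] k' by auto
      have t': "t = (\<Sum>l = Suc k..m. [:0, 1:] ^ (l - ?c) * (const_mat (Ac l) *\<^sub>v u) $ j)"
        unfolding t poly.tail_sum_def by (rule index_vec[OF j])
      have "(poly.tail_sum 0 0 u + const_mat C *\<^sub>v y) $ j = 0" unfolding P using j by simp
      moreover have "(poly.tail_sum 0 0 u + const_mat C *\<^sub>v y) $ j = poly.tail_sum 0 0 u $ j + (const_mat C *\<^sub>v y) $ j"
        by (rule index_add_vec(1)) (use C j in simp)
      moreover have "poly.tail_sum 0 0 u $ j = (\<Sum>l = 0..m. [:0, 1:] ^ (l - 0) * (const_mat (Ac l) *\<^sub>v u) $ j)"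
        unfolding poly.tail_sum_def by (rule index_vec[OF j])
      ultimately have P': "(\<Sum>l = 0..m. [:0, 1:] ^ l * (const_mat (Ac l) *\<^sub>v u) $ j) + (const_mat C *\<^sub>v y) $ j = 0"
        by (simp only: diff_zero)
      have wd: "degree ((const_mat (Ac l) *\<^sub>v u) $ j) \<le> ?e" if "l \<le> m" for l
        using a_deg[OF that] dimA[OF that] j unfolding deg_le_def dim_mult_mat_vec by simp
      have gd: "degree ((const_mat C *\<^sub>v y) $ j) \<le> ?e"
        using g_deg C j unfolding deg_le_def dim_mult_mat_vec by simp
      \<comment> \<open>The exponent \<open>?c\<close> counts the consecutions up to \<open>k\<close> itself, so \<open>k - ?c\<close> falls short of the number of inversions below \<open>k\<close>.\<close>
      have "t = 0 \<or> degree t + ?c \<le> k + ?e"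
        by (rule horner_shift_degree[OF refl t' P' wd gd c(1) k'(1)])
      then have "degree t \<le> ?e + poly.num_inv k"
        using c(2) poly.num_con_plus_num_inv[of k] by auto
      then show ?thesis using mono[of k] k' unfolding t_def poly.num_inv_total by simp
    qed
  qed
  show ?thesis
  proof
    assume a: "deg_le (poly.expand u) k"
    have m1: "m - 1 < m" using m_ge_2 by simp
    have "poly.expand u $ i = [:0, 1:] ^ poly.num_inv (m - 1) * u $ i"
      using ent[OF m1 e(1)] poly.level_expand[OF m1 u] u e(1) by simp
    then have "degree (poly.expand u $ i) = total_inversions m \<alpha> + ?e"
      using degree_X_power_mult[OF e(2)] unfolding poly.num_inv_total by simp
    moreover have "i < dim_vec (poly.expand u)"
    proof -
      have "n \<le> m * n" using m_ge_2 by (cases m) auto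
      then show ?thesis using e(1) unfolding dlv by (rule less_le_trans[rotated])
    qed
    ultimately show "?e + total_inversions m \<alpha> \<le> k" using a unfolding deg_le_def by force
  next
    assume "?e + total_inversions m \<alpha> \<le> k"
    then show "deg_le (poly.expand u) k" using top unfolding deg_le_def by (meson dual_order.trans)
  qed
qed

text \<open>
  The factor \<open>V\<close> and its inverse are constant, so they preserve degree bounds; and \<open>u \<noteq> 0\<close>, since \<open>u = 0\<close>
  forces \<open>y = 0\<close> and then \<open>x = 0\<close>.
\<close>

lemma kernel_degree:
  assumes x: "x \<in> carrier_vec (m * n)" and y: "y \<in> carrier_vec r"
    and K: "poly.LL_over *\<^sub>v (x @\<^sub>v y) = 0\<^sub>v (m * n + r)" and z0: "x @\<^sub>v y \<noteq> 0\<^sub>v (m * n + r)"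
  shows "vec_degree (x @\<^sub>v y) = vec_degree (blk m n kr x @\<^sub>v y) + total_inversions m \<alpha>"
proof -
  obtain u where u: "u \<in> carrier_vec n" "const_mat V1 *\<^sub>v x = poly.expand u" "blk m n kr x = u"
    "poly.tail_sum 0 0 u + const_mat C *\<^sub>v y = 0\<^sub>v n" "const_mat B *\<^sub>v u + poly.D_over *\<^sub>v y = 0\<^sub>v r"
    using K poly.egfp_kernel[OF x y] by blast
  obtain W where W: "W \<in> carrier_mat (m * n) (m * n)" "W * V1 = 1\<^sub>m (m * n)" using V1_inverse(2) by blast
  have x_eq: "x = const_mat W *\<^sub>v poly.expand u"
    using poly.lift_inverse_vec[OF V1_inverse(1) W x] unfolding u(2) by simp
  note y_deg = state_degree[OF A E B u(1) y u(5)[unfolded poly.D_over_def]]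
  have u0: "u \<noteq> 0\<^sub>v n"
  proof
    assume u0: "u = 0\<^sub>v n"
    then have "y = 0\<^sub>v r" by (rule y_deg(2))
    \<comment> \<open>Both \<open>(x, y)\<close> and \<open>(0, y)\<close> are null vectors that recover \<open>(0, 0)\<close>.\<close>
    moreover have "poly.LL_over *\<^sub>v (0\<^sub>v (m * n) @\<^sub>v y) = 0\<^sub>v (m * n + r)"
    proof -
      have "0\<^sub>v (m * n) @\<^sub>v y = 0\<^sub>v (m * n + r)" using \<open>y = 0\<^sub>v r\<close> by (intro eq_vecI) auto
      then show ?thesis using mult_zero_vec[OF poly.LL_over_carrier] by simp
    qed
    then have "x = 0\<^sub>v (m * n)"
      using poly.recover_inj[OF x zero_carrier_vec y K] u(3) u0 by (simp add: blk_zero[OF kr(2)])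
    ultimately have "x @\<^sub>v y = 0\<^sub>v (m * n + r)" by (intro eq_vecI) auto
    with z0 show False by simp
  qed
  then obtain i where i: "i < n" "u $ i \<noteq> 0" "deg_le u (degree (u $ i))"
    using vec_max_degree[of u] u(1) by auto
  let ?e = "degree (u $ i)"
  have ye: "deg_le y ?e" by (rule y_deg(1)[OF i(3)])
  have lv: "deg_le (poly.expand u) k \<longleftrightarrow> ?e + total_inversions m \<alpha> \<le> k" for k
    by (rule deg_le_expand[OF u(1) y u0 u(4) i ye])
  have "deg_le x k \<longleftrightarrow> ?e + total_inversions m \<alpha> \<le> k" for k
    using deg_le_const_mult[OF V1_inverse(1) x, of k]
      deg_le_const_mult[OF W(1) poly.expand_carrier, of u k] lv[of k]
    unfolding u(2) x_eq[symmetric] by auto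
  moreover have "deg_le y k" if "?e + total_inversions m \<alpha> \<le> k" for k
    using ye that unfolding deg_le_def by (meson add_leE dual_order.trans)
  ultimately have 1: "deg_le (x @\<^sub>v y) k \<longleftrightarrow> ?e + total_inversions m \<alpha> \<le> k" for k
    unfolding deg_le_append by blast
  have 2: "deg_le (u @\<^sub>v y) k \<longleftrightarrow> ?e \<le> k" for k
  proof
    show "?e \<le> k" if "deg_le (u @\<^sub>v y) k"
      using that i(1) u(1) unfolding deg_le_append by (auto simp: deg_le_def)
    show "deg_le (u @\<^sub>v y) k" if "?e \<le> k"
      using ye i(3) that unfolding deg_le_append unfolding deg_le_def by (meson dual_order.trans)
  qed
  have "0 < dim_vec (u @\<^sub>v y)" "0 < dim_vec (x @\<^sub>v y)" using i(1) u(1) x m_ge_2 by auto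
  then have "vec_degree (x @\<^sub>v y) \<le> k \<longleftrightarrow> ?e + total_inversions m \<alpha> \<le> k" "vec_degree (u @\<^sub>v y) \<le> k \<longleftrightarrow> ?e \<le> k" for k
    using 1 2 vec_degree_le_iff by blast+
  then have "vec_degree (x @\<^sub>v y) = ?e + total_inversions m \<alpha>" "vec_degree (u @\<^sub>v y) = ?e"
    by (metis dual_order.antisym order_refl)+
  then show ?thesis unfolding u(3) by simp
qed

end

section \<open>Recovery for right null spaces\<close>

lemma append_rows_mult:
  fixes K :: "'a :: comm_ring_1 mat"
  assumes K: "K \<in> carrier_mat a b" and Z: "Z1 \<in> carrier_mat b p" "Z2 \<in> carrier_mat r p"
  shows "four_block_mat K (0\<^sub>m a r) (0\<^sub>m r b) (1\<^sub>m r) * (Z1 @\<^sub>r Z2) = (K * Z1) @\<^sub>r Z2"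
proof -
  have "four_block_mat K (0\<^sub>m a r) (0\<^sub>m r b) (1\<^sub>m r) * (Z1 @\<^sub>r Z2) =
      four_block_mat (K * Z1 + 0\<^sub>m a r * Z2) (K * 0\<^sub>m b 0 + 0\<^sub>m a r * 0\<^sub>m r 0)
        (0\<^sub>m r b * Z1 + 1\<^sub>m r * Z2) (0\<^sub>m r b * 0\<^sub>m b 0 + 1\<^sub>m r * 0\<^sub>m r 0)"
    unfolding append_rows_def using Z by (subst mult_four_block_mat[OF K _ _ _ Z(1) _ Z(2)]) auto
  also have "\<dots> = (K * Z1) @\<^sub>r Z2"
    unfolding append_rows_def using K Z by (intro cong_four_block_mat) auto
  finally show ?thesis .
qed

lemma map_vec_to_fract_eq_zero_iff:
  "v \<in> carrier_vec d \<Longrightarrow> map_vec to_fract v = 0\<^sub>v d \<longleftrightarrow> v = 0\<^sub>v d"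
proof
  assume v: "v \<in> carrier_vec d" and "map_vec to_fract v = 0\<^sub>v d"
  then have "to_fract (v $ i) = 0" if "i < d" for i using that
    by (metis carrier_vecD index_map_vec(1) index_zero_vec(1))
  then show "v = 0\<^sub>v d" using v by (intro eq_vecI) auto
qed auto

lemma rat_kernel_iff:
  assumes M: "M \<in> carrier_mat a b" and z: "z \<in> carrier_vec b"
  shows "map_vec to_fract z \<in> mat_kernel (rat_mat M) \<longleftrightarrow> z \<in> mat_kernel M"
proof -
  have rM: "rat_mat M \<in> carrier_mat a b" using M by simp
  have "M *\<^sub>v z \<in> carrier_vec a" using M z by simp
  then show ?thesis
    unfolding mat_kernel[OF rM] mat_kernel[OF M]
    using map_vec_to_fract_eq_zero_iff[of "M *\<^sub>v z" a] rat_mult_vec[OF M z] z by auto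
qed

lemma rat_mat_linear:
  assumes "M \<in> carrier_mat p q" "N \<in> carrier_mat p q"
  shows "rat_mat (X \<cdot>\<^sub>m M - N) = to_fract X \<cdot>\<^sub>m rat_mat M - rat_mat N"
    and "rat_mat (N - X \<cdot>\<^sub>m M) = rat_mat N - to_fract X \<cdot>\<^sub>m rat_mat M"
  using assms by (auto intro!: eq_matI simp: to_fract.hom_minus to_fract.hom_mult)

lemma to_fract_poly_sum:
  "to_fract (\<Sum>k\<le>m. a k * X ^ k) = (\<Sum>k\<le>m. to_fract (a k) * to_fract X ^ k)"
  by (simp add: to_fract.hom_sum to_fract.hom_mult to_fract.hom_power)

context egfp
begin

interpretation poly: egfp_over m n r Ac A B C E \<sigma> \<beta> \<gamma> \<sigma>1 \<sigma>2 \<tau>1 \<tau>2 X1 X2 Y1 Y2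
  "\<lambda>c. [:c:]" "[:0, 1:]"
  by unfold_locales auto

interpretation rat: egfp_over m n r Ac A B C E \<sigma> \<beta> \<gamma> \<sigma>1 \<sigma>2 \<tau>1 \<tau>2 X1 X2 Y1 Y2
  "\<lambda>c. to_fract [:c:]" "to_fract [:0, 1:]"
  by unfold_locales (auto simp flip: to_fract.hom_add to_fract.hom_mult)

lemma rat_const: "rat_mat (const_mat M) = map_mat (\<lambda>c. to_fract [:c:]) M"
  by (intro eq_matI) auto

lemma rat_D: "rat_mat poly.D_over = rat.D_over"
  unfolding poly.D_over_def rat.D_over_def rat_const[symmetric]
  by (rule rat_mat_linear(2)) (use A E in auto)

lemma rat_LL: "rat_mat poly.LL_over = rat.LL_over"
proof -
  note c = factor_carriers
  have pc: "elem_prod_P m n Ac \<tau> \<in> carrier_mat (m * n) (m * n)"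
    using c unfolding elem_prod_P_\<tau> by auto
  have midc: "[:0, 1:] \<cdot>\<^sub>m const_mat (elem_prod_P m n Ac \<tau>) - const_mat (elem_prod_P m n Ac \<sigma>) \<in> carrier_mat (m * n) (m * n)"
    using pc c by (intro minus_carrier_mat) auto
  have cc: "const_mat M \<in> carrier_mat p q \<longleftrightarrow> M \<in> carrier_mat p q" for M p q by simp
  have mm: "rat_mat (X * Y) = rat_mat X * rat_mat Y"
    if "X \<in> carrier_mat (m * n) (m * n)" "Y \<in> carrier_mat (m * n) (m * n)" for X Y
    by (rule rat_mat_mult[OF that])
  have mc: "X * Y \<in> carrier_mat (m * n) (m * n)"
    if "X \<in> carrier_mat (m * n) (m * n)" "Y \<in> carrier_mat (m * n) (m * n)" for X Y :: "complex poly mat"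
    using that by simp
  have L: "rat_mat poly.L_over = rat.L_over"
    unfolding poly.L_over_def rat.L_over_def
    using mm mc midc c cc rat_mat_linear(1)[OF cc[THEN iffD2, OF pc] cc[THEN iffD2, OF c(9)], of "[:0, 1:]"]
    by (simp only: rat_const)
  show ?thesis
    unfolding poly.LL_over_def rat.LL_over_def rat_D[symmetric] L[symmetric] rat_const[symmetric]
    using dim_kronecker_e(1)[OF C, of m "int m - int kc"] dim_kronecker_e(2)[OF B, of m "int m - int kr"]
    by (subst map_four_block_mat[OF poly.L_over_carrier _ _ poly.D_over_carrier]) auto
qed

lemma rat_S: "rat_mat poly.S_over = rat.S_over"
proof -
  have P: "rat_mat poly.P_over = rat.P_over"
    unfolding poly.P_over_def rat.P_over_def
    by (intro eq_matI)
      (simp_all only: index_map_mat index_mat dim_row_mat dim_col_mat prod.case to_fract_poly_sum)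
  show ?thesis
    unfolding poly.S_over_def rat.S_over_def rat_D[symmetric] P[symmetric] rat_const[symmetric]
    by (subst map_four_block_mat[OF poly.P_over_carrier _ _ poly.D_over_carrier]) (use C B in auto)
qed

lemma rat_recover: "rat_mat poly.recover = rat.recover"
proof -
  have c: "const_mat (kronecker (transpose_mat (e_col m (int m - int kr))) (1\<^sub>m n)) \<in> carrier_mat n (m * n)"
    using dim_kronecker_e(2)[OF one_carrier_mat[of n], of m "int m - int kr"] by simp
  show ?thesis unfolding poly.recover_def rat.recover_def
    by (subst map_four_block_mat[OF c]) (auto simp: rat_const map_mat_0_hom map_mat_1_hom)
qed

lemma LL_eq: "EGFP_G m (EGFP_P m n Ac \<sigma> \<tau> \<sigma>1 X1 \<sigma>2 X2 \<tau>1 Y1 \<tau>2 Y2) \<sigma> \<sigma>1 \<sigma>2 A B C E = poly.LL_over"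
  unfolding EGFP_G_def EGFP_P_def poly.LL_over_def poly.L_over_def poly.D_over_def pencil_def
    inversions_0_eq_climb consecutions_0_eq_climb kc(1) kr(1) ..

lemma S_eq: "system_matrix (mat_poly n m Ac) A B C E = poly.S_over"
proof -
  have "mat_poly n m Ac = poly.P_over"
    unfolding mat_poly_def poly.P_over_def by (intro eq_matI) (auto simp: monom_altdef)
  then show ?thesis unfolding system_matrix_def poly.S_over_def poly.D_over_def pencil_def by simp
qed

lemma recover_append_rows:
  assumes "Zmn \<in> carrier_mat (m * n) p" "Zr \<in> carrier_mat r p"
  shows "poly.recover * (Zmn @\<^sub>r Zr) =
    const_mat (kronecker (transpose_mat (e_col m (int m - consecutions 0 (\<sigma> @ \<sigma>2)))) (1\<^sub>m n)) * Zmn @\<^sub>r Zr"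
proof -
  have c: "const_mat (kronecker (transpose_mat (e_col m (int m - int kr))) (1\<^sub>m n)) \<in> carrier_mat n (m * n)"
    using dim_kronecker_e(2)[OF one_carrier_mat[of n], of m "int m - int kr"] by simp
  show ?thesis
    unfolding poly.recover_def consecutions_0_eq_climb kr(1)[symmetric]
    by (rule append_rows_mult[OF c assms])
qed

text \<open>
  The bijection of null spaces is used over the rational functions, its polynomial version supplies polynomial
  preimages and degrees.
\<close>

lemma right_transfer:
  assumes LL: "LL = EGFP_G m (EGFP_P m n Ac \<sigma> \<tau> \<sigma>1 X1 \<sigma>2 X2 \<tau>1 Y1 \<tau>2 Y2) \<sigma> \<sigma>1 \<sigma>2 A B C E"
    and S: "S = system_matrix (mat_poly n m Ac) A B C E"
    and Z: "right_minimal_basis (rat_mat LL) Z"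
  shows "right_minimal_basis (rat_mat S) (poly.recover * Z)"
    and "map vec_degree (cols Z) =
      map (\<lambda>e. e + total_inversions m \<alpha>) (map vec_degree (cols (poly.recover * Z)))"
proof -
  have L': "LL = poly.LL_over" "rat_mat LL = rat.LL_over" "S = poly.S_over" "rat_mat S = rat.S_over"
    unfolding LL S LL_eq S_eq rat_LL rat_S by (rule refl)+
  have dims: "dim_col (rat_mat LL) = m * n + r" "dim_col (rat_mat S) = n + r"
    unfolding L'(2,4) using rat.LL_over_carrier rat.S_over_carrier by auto
  have bij: "bij_betw (\<lambda>z. rat_mat poly.recover *\<^sub>v z) (mat_kernel (rat_mat LL)) (mat_kernel (rat_mat S))"
    unfolding rat_recover L'(2,4) by (rule rat.recover_bij)
  have surj: "\<exists>z \<in> carrier_vec (m * n + r). map_vec to_fract z \<in> mat_kernel (rat_mat LL) \<and> poly.recover *\<^sub>v z = v"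
    if "v \<in> carrier_vec (n + r)" "map_vec to_fract v \<in> mat_kernel (rat_mat S)" for v
  proof -
    have "map_vec to_fract v \<in> mat_kernel (rat_mat poly.S_over)" using that(2) unfolding L'(3) .
    then have v: "v \<in> mat_kernel poly.S_over" by (rule rat_kernel_iff[OF poly.S_over_carrier that(1), THEN iffD1])
    have "mat_kernel poly.S_over = (\<lambda>z. poly.recover *\<^sub>v z) ` mat_kernel poly.LL_over"
      by (rule bij_betw_imp_surj_on[OF poly.recover_bij, symmetric])
    from v[unfolded this] obtain z where z: "v = poly.recover *\<^sub>v z" "z \<in> mat_kernel poly.LL_over"
      by (rule imageE)
    have zc: "z \<in> carrier_vec (m * n + r)" by (rule mat_kernelD(1)[OF poly.LL_over_carrier z(2)])
    have "map_vec to_fract z \<in> mat_kernel (rat_mat LL)"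
      unfolding L'(1) by (rule rat_kernel_iff[OF poly.LL_over_carrier zc, THEN iffD2, OF z(2)])
    then show ?thesis using zc z(1)[symmetric] by (intro bexI[of _ z] conjI)
  qed
  have degree: "vec_degree z = vec_degree (poly.recover *\<^sub>v z) + total_inversions m \<alpha>"
    if z: "z \<in> carrier_vec (m * n + r)" "map_vec to_fract z \<in> mat_kernel (rat_mat LL)" "z \<noteq> 0\<^sub>v (m * n + r)" for z
  proof -
    obtain x y where xy: "z = x @\<^sub>v y" "x \<in> carrier_vec (m * n)" "y \<in> carrier_vec r"
      by (rule vec_split_first_last[OF z(1)])
    have "map_vec to_fract z \<in> mat_kernel (rat_mat poly.LL_over)" using that(2) unfolding L'(1) .
    then have "z \<in> mat_kernel poly.LL_over" by (rule rat_kernel_iff[OF poly.LL_over_carrier that(1), THEN iffD1])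
    then have "poly.LL_over *\<^sub>v (x @\<^sub>v y) = 0\<^sub>v (m * n + r)"
      unfolding xy(1) by (rule mat_kernelD(2)[OF poly.LL_over_carrier])
    from kernel_degree[OF xy(2,3) this that(3)[unfolded xy(1)]] show ?thesis
      unfolding xy(1) poly.recover_mult_vec[OF xy(2,3)] .
  qed
  have cL: "rat_mat LL \<in> carrier_mat (m * n + r) (m * n + r)" unfolding L'(2) by (rule rat.LL_over_carrier)
  have cS: "rat_mat S \<in> carrier_mat (n + r) (n + r)" unfolding L'(4) by (rule rat.S_over_carrier)
  note t = minimal_basis_transfer[OF cL cS poly.recover_carrier bij surj degree
      Z[unfolded right_minimal_basis_def dims]]
  show "right_minimal_basis (rat_mat S) (poly.recover * Z)"
    unfolding right_minimal_basis_def dims by (rule t(1))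
  show "map vec_degree (cols Z) =
      map (\<lambda>e. e + total_inversions m \<alpha>) (map vec_degree (cols (poly.recover * Z)))"
    by (rule t(2))
qed

lemma right_minimal_basis_recovery:
  assumes LL: "LL = EGFP_G m (EGFP_P m n Ac \<sigma> \<tau> \<sigma>1 X1 \<sigma>2 X2 \<tau>1 Y1 \<tau>2 Y2) \<sigma> \<sigma>1 \<sigma>2 A B C E"
    and S: "S = system_matrix (mat_poly n m Ac) A B C E"
    and Z: "Zmn \<in> carrier_mat (m * n) p" "Zr \<in> carrier_mat r p"
    and mb: "right_minimal_basis (rat_mat LL) (Zmn @\<^sub>r Zr)"
  shows "right_minimal_basis (rat_mat S)
    (const_mat (kronecker (transpose_mat (e_col m (int m - consecutions 0 (\<sigma> @ \<sigma>2)))) (1\<^sub>m n)) * Zmn @\<^sub>r Zr)"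
  using right_transfer(1)[OF LL S mb] unfolding recover_append_rows[OF Z] .

lemma right_minimal_indices_shift:
  assumes LL: "LL = EGFP_G m (EGFP_P m n Ac \<sigma> \<tau> \<sigma>1 X1 \<sigma>2 X2 \<tau>1 Y1 \<tau>2 Y2) \<sigma> \<sigma>1 \<sigma>2 A B C E"
    and S: "S = system_matrix (mat_poly n m Ac) A B C E"
    and \<epsilon>: "right_minimal_indices (rat_mat LL) \<epsilon>"
  shows "(\<forall>e \<in> set \<epsilon>. total_inversions m \<alpha> \<le> e) \<and>
    right_minimal_indices (rat_mat S) (map (\<lambda>e. e - total_inversions m \<alpha>) \<epsilon>)"
proof -
  obtain Z where Z: "right_minimal_basis (rat_mat LL) Z" "\<epsilon> = map vec_degree (cols Z)"
    using \<epsilon> unfolding right_minimal_indices_def by blast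
  note t = right_transfer[OF LL S Z(1)]
  have \<epsilon>_eq: "\<epsilon> = map (\<lambda>e. e + total_inversions m \<alpha>) (map vec_degree (cols (poly.recover * Z)))"
    unfolding Z(2) by (rule t(2))
  then have "map (\<lambda>e. e - total_inversions m \<alpha>) \<epsilon> = map vec_degree (cols (poly.recover * Z))"
    by (simp add: comp_def)
  then show ?thesis using t(1) \<epsilon>_eq unfolding right_minimal_indices_def by auto
qed

end

section \<open>Left null spaces by transposition\<close>

lemma left_null_eq_right_null_transpose: "left_null G = right_null (transpose_mat G)"
proof -
  have "mat_of_row y * G = 0\<^sub>m 1 (dim_col G) \<longleftrightarrow> transpose_mat G *\<^sub>v y = 0\<^sub>v (dim_col G)"
    if y: "y \<in> carrier_vec (dim_row G)" for y
  proof -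
    have "vec (dim_row G) (($) y) = y" using y by (intro eq_vecI) auto
    then have e: "(mat_of_row y * G) $$ (0, j) = (transpose_mat G *\<^sub>v y) $ j" if "j < dim_col G" for j
      using y that comm_scalar_prod[OF y col_carrier_vec[OF that carrier_matI[OF refl refl]]]
      by (simp add: mat_of_row_def)
    show ?thesis
    proof
      assume a: "mat_of_row y * G = 0\<^sub>m 1 (dim_col G)"
      show "transpose_mat G *\<^sub>v y = 0\<^sub>v (dim_col G)"
      proof (rule eq_vecI)
        fix j assume "j < dim_vec (0\<^sub>v (dim_col G) :: complex poly fract vec)"
        then have j: "j < dim_col G" by simp
        show "(transpose_mat G *\<^sub>v y) $ j = 0\<^sub>v (dim_col G) $ j" unfolding e[OF j, symmetric] a using j by simp
      qed simp
    next
      assume a: "transpose_mat G *\<^sub>v y = 0\<^sub>v (dim_col G)"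
      show "mat_of_row y * G = 0\<^sub>m 1 (dim_col G)"
      proof (rule eq_matI)
        fix i j assume "i < dim_row (0\<^sub>m 1 (dim_col G) :: complex poly fract mat)" "j < dim_col (0\<^sub>m 1 (dim_col G) :: complex poly fract mat)"
        then have j: "i = 0" "j < dim_col G" by auto
        show "(mat_of_row y * G) $$ (i, j) = 0\<^sub>m 1 (dim_col G) $$ (i, j)"
          unfolding j(1) e[OF j(2)] a using j by simp
      qed (auto simp: mat_of_row_def)
    qed
  qed
  then show ?thesis unfolding left_null_def mat_kernel_def by auto
qed

lemma left_minimal_basis_iff: "left_minimal_basis G Z \<longleftrightarrow> right_minimal_basis (transpose_mat G) Z"
  unfolding left_minimal_basis_def right_minimal_basis_def left_null_eq_right_null_transpose by simp

lemma left_minimal_indices_iff: "left_minimal_indices G \<epsilon> \<longleftrightarrow> right_minimal_indices (transpose_mat G) \<epsilon>"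
  unfolding left_minimal_indices_def right_minimal_indices_def left_minimal_basis_iff ..

lemma transpose_map_mat: "transpose_mat (map_mat f M) = map_mat f (transpose_mat M)"
  by (intro eq_matI) auto

lemma invertible_transpose:
  fixes X :: "complex mat"
  assumes "X \<in> carrier_mat n n" "invertible_mat X"
  shows "invertible_mat (transpose_mat X)"
proof -
  obtain Y where Y: "Y \<in> carrier_mat n n" "X * Y = 1\<^sub>m n" "Y * X = 1\<^sub>m n"
    using invertible_obtain[OF assms(2,1)] .
  have "transpose_mat X * transpose_mat Y = 1\<^sub>m n" "transpose_mat Y * transpose_mat X = 1\<^sub>m n"
    unfolding transpose_mult[OF Y(1) assms(1), symmetric] transpose_mult[OF assms(1) Y(1), symmetric] Y(2,3)
    by (rule transpose_one)+
  then show ?thesis using assms(1) Y(1) unfolding invertible_mat_def inverts_mat_def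
    by (intro conjI exI[of _ "transpose_mat Y"]) auto
qed

lemma nonsingular_assignment_transpose:
  assumes "nonsingular_assignment m n ts Xs"
  shows "nonsingular_assignment m n (rev ts) (rev (map transpose_mat Xs))"
  unfolding nonsingular_assignment_def
proof (intro conjI allI impI)
  have a: "length Xs = length ts" "set Xs \<subseteq> carrier_mat n n"
    and i: "\<And>k. k < length ts \<Longrightarrow> ts ! k \<in> {0, int m, - int m} \<Longrightarrow> invertible_mat (Xs ! k)"
    using assms unfolding nonsingular_assignment_def by blast+
  show "length (rev (map transpose_mat Xs)) = length (rev ts)" using a by simp
  show "set (rev (map transpose_mat Xs)) \<subseteq> carrier_mat n n" using a by auto
  fix k assume k: "k < length (rev ts)" "rev ts ! k \<in> {0, int m, - int m}"
  let ?k = "length ts - Suc k"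
  have k': "?k < length ts" "rev ts ! k = ts ! ?k" "rev (map transpose_mat Xs) ! k = transpose_mat (Xs ! ?k)"
    using k(1) a(1) by (auto simp: rev_nth)
  have "Xs ! ?k \<in> carrier_mat n n" using a k'(1) by (metis nth_mem subsetD)
  moreover have "invertible_mat (Xs ! ?k)" using i[OF k'(1)] k(2) k'(2) by simp
  ultimately show "invertible_mat (rev (map transpose_mat Xs) ! k)"
    unfolding k'(3) by (rule invertible_transpose)
qed

lemma total_inversions_rev: "total_inversions m (rev \<alpha>) = total_consecutions m \<alpha>"
  unfolding total_inversions_def total_consecutions_def
  using subseq_rev[of "[_, _ + 1]" \<alpha>] by simp

lemma transpose_elem_prod_P:
  assumes m: "2 \<le> m" and A: "\<And>i. i \<le> m \<Longrightarrow> Ac i \<in> carrier_mat n n" and ts: "set ts \<subseteq> {- int m..<int m}"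
  shows "transpose_mat (elem_prod_P m n Ac ts) = elem_prod_P m n (\<lambda>i. transpose_mat (Ac i)) (rev ts)"
proof -
  have "transpose_mat (P_assign Ac t) = P_assign (\<lambda>i. transpose_mat (Ac i)) t" for t
    unfolding P_assign_def by (auto intro!: eq_matI)
  then have eq: "rev (map transpose_mat (map (P_assign Ac) ts)) = map (P_assign (\<lambda>i. transpose_mat (Ac i))) (rev ts)"
    by (simp add: rev_map)
  have "assignment m n ts (map (P_assign Ac) ts)" using assignment_P[of m Ac n ts] A ts by blast
  then show ?thesis
    unfolding elem_prod_P_def by (simp only: transpose_elem_prod[OF m] eq)
qed

lemma transpose_pencil:
  "U \<in> carrier_mat r r \<Longrightarrow> V \<in> carrier_mat r r \<Longrightarrow>
    transpose_mat (pencil U V) = pencil (transpose_mat U) (transpose_mat V)"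
  unfolding pencil_def by (intro eq_matI) auto

lemma transpose_kronecker:
  "transpose_mat (kronecker U V) = kronecker (transpose_mat U) (transpose_mat V)"
proof (rule eq_matI)
  fix i j assume "i < dim_row (kronecker (transpose_mat U) (transpose_mat V))"
    "j < dim_col (kronecker (transpose_mat U) (transpose_mat V))"
  then have ij: "i < dim_col U * dim_col V" "j < dim_row U * dim_row V" by (auto simp: kronecker_def)
  then have p: "0 < dim_col V" "0 < dim_row V" by (cases "dim_col V"; cases "dim_row V"; auto)+
  then have "i div dim_col V < dim_col U" "j div dim_row V < dim_row U"
    "i mod dim_col V < dim_col V" "j mod dim_row V < dim_row V"
    using ij by (auto simp: less_mult_imp_div_less)
  then show "transpose_mat (kronecker U V) $$ (i, j) = kronecker (transpose_mat U) (transpose_mat V) $$ (i, j)"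
    using ij by (simp add: kronecker_def)
qed (auto simp: kronecker_def)

lemma transpose_system_matrix:
  assumes "\<And>i. i \<le> m \<Longrightarrow> Ac i \<in> carrier_mat n n"
    and "A \<in> carrier_mat r r" "E \<in> carrier_mat r r" "C \<in> carrier_mat n r" "B \<in> carrier_mat r n"
  shows "transpose_mat (system_matrix (mat_poly n m Ac) A B C E) =
    system_matrix (mat_poly n m (\<lambda>i. transpose_mat (Ac i)))
      (transpose_mat A) (transpose_mat C) (transpose_mat B) (transpose_mat E)"
proof -
  have p: "pencil A E \<in> carrier_mat r r" using assms by (auto simp: pencil_def)
  have P: "mat_poly n m Ac \<in> carrier_mat n n" by (simp add: mat_poly_def)
  have "transpose_mat (mat_poly n m Ac) = mat_poly n m (\<lambda>i. transpose_mat (Ac i))"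
    unfolding mat_poly_def
  proof (intro eq_matI; clarsimp)
    fix i j assume ij: "i < n" "j < n"
    have "transpose_mat (Ac k) $$ (i, j) = Ac k $$ (j, i)" if "k \<le> m" for k
      using assms(1)[OF that] ij by simp
    then show "(\<Sum>k\<le>m. monom (Ac k $$ (j, i)) k) = (\<Sum>k\<le>m. monom (transpose_mat (Ac k) $$ (i, j)) k)"
      by (intro sum.cong) auto
  qed
  then show ?thesis
    unfolding system_matrix_def using assms(4,5) transpose_pencil[OF assms(2,3)]
    by (subst transpose_four_block_mat[OF P _ _ p]) (auto simp: transpose_map_mat)
qed

context egfp
begin

text \<open>
  Elementary matrices are block symmetric, so transposing a product reverses its tuple.
\<close>

lemma egfp_transpose:
  "egfp m n r (\<lambda>i. transpose_mat (Ac i)) (transpose_mat A) (transpose_mat C) (transpose_mat B) (transpose_mat E)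
    (rev \<sigma>) (rev \<gamma>) (rev \<beta>) (rev \<sigma>2) (rev \<sigma>1) (rev \<tau>2) (rev \<tau>1)
    (rev (map transpose_mat X2)) (rev (map transpose_mat X1))
    (rev (map transpose_mat Y2)) (rev (map transpose_mat Y1))"
proof
  have 1: "rev \<sigma>2 @ rev \<sigma> @ rev \<sigma>1 = rev (\<sigma>1 @ \<sigma> @ \<sigma>2)" by simp
  show "SIP (rev \<sigma>2 @ rev \<sigma> @ rev \<sigma>1)" unfolding 1 SIP_rev by (rule \<sigma>12(3))
  have 2: "rev \<tau>2 @ (map uminus (rev \<gamma>) @ [- int m] @ map uminus (rev \<beta>)) @ rev \<tau>1 = rev (\<tau>1 @ \<tau> @ \<tau>2)"
    by (simp add: rev_map)
  show "SIP (rev \<tau>2 @ (map uminus (rev \<gamma>) @ [- int m] @ map uminus (rev \<beta>)) @ rev \<tau>1)"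
    unfolding 2 SIP_rev by (rule \<tau>12(3))
  show "transpose_mat (Ac i) \<in> carrier_mat n n" if "i \<le> m" for i using coeff[OF that] by simp
  show "2 \<le> m" by (rule m_ge_2)
qed (use A E B C distinct set zero \<sigma>12 \<tau>12 nonsingular in
  \<open>auto intro!: invertible_transpose nonsingular_assignment_transpose\<close>)

lemma transpose_EGFP_P:
  "transpose_mat (EGFP_P m n Ac \<sigma> \<tau> \<sigma>1 X1 \<sigma>2 X2 \<tau>1 Y1 \<tau>2 Y2) =
    EGFP_P m n (\<lambda>i. transpose_mat (Ac i)) (rev \<sigma>) (rev \<tau>)
      (rev \<sigma>2) (rev (map transpose_mat X2)) (rev \<sigma>1) (rev (map transpose_mat X1))
      (rev \<tau>2) (rev (map transpose_mat Y2)) (rev \<tau>1) (rev (map transpose_mat Y1))"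
proof -
  have \<tau>s: "set \<tau> \<subseteq> {- int m..<int m}" using \<tau>_sub m_ge_2 by force
  have tp: "transpose_mat (elem_prod_P m n Ac ts) = elem_prod_P m n (\<lambda>i. transpose_mat (Ac i)) (rev ts)"
    if "set ts \<subseteq> {- int m..<int m}" for ts
    by (rule transpose_elem_prod_P[OF m_ge_2 _ that]) (rule coeff)
  define a b N c d where "a = const_mat (elem_prod m n \<tau>1 Y1)" "b = const_mat (elem_prod m n \<sigma>1 X1)"
    "N = [:0, 1:] \<cdot>\<^sub>m const_mat (elem_prod_P m n Ac \<tau>) - const_mat (elem_prod_P m n Ac \<sigma>)"
    "c = const_mat (elem_prod m n \<sigma>2 X2)" "d = const_mat (elem_prod m n \<tau>2 Y2)"
  note defs = this
  have pc: "elem_prod_P m n Ac \<tau> \<in> carrier_mat (m * n) (m * n)"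
    using factor_carriers unfolding elem_prod_P_\<tau> by auto
  have car: "a \<in> carrier_mat (m * n) (m * n)" "b \<in> carrier_mat (m * n) (m * n)" "N \<in> carrier_mat (m * n) (m * n)"
    "c \<in> carrier_mat (m * n) (m * n)" "d \<in> carrier_mat (m * n) (m * n)"
    unfolding defs using factor_carriers pc by (auto intro!: minus_carrier_mat)
  have "transpose_mat N = [:0, 1:] \<cdot>\<^sub>m transpose_mat (const_mat (elem_prod_P m n Ac \<tau>)) -
      transpose_mat (const_mat (elem_prod_P m n Ac \<sigma>))"
    unfolding defs using pc factor_carriers(9) by (intro eq_matI) auto
  then have N: "transpose_mat N = [:0, 1:] \<cdot>\<^sub>m const_mat (elem_prod_P m n (\<lambda>i. transpose_mat (Ac i)) (rev \<tau>)) -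
      const_mat (elem_prod_P m n (\<lambda>i. transpose_mat (Ac i)) (rev \<sigma>))"
    unfolding transpose_map_mat tp[OF \<tau>s] tp[OF sub_valid(5)] .
  have "transpose_mat (a * b * N * c * d) =
      transpose_mat d * (transpose_mat c * (transpose_mat N * (transpose_mat b * transpose_mat a)))"
    using car by (simp only: transpose_mult[of _ "m * n" "m * n" _ "m * n"] mult_carrier_mat[of _ "m * n" "m * n" _ "m * n"])
  also have "\<dots> = transpose_mat d * transpose_mat c * transpose_mat N * transpose_mat b * transpose_mat a"
    using car by (simp add: assoc_mult_mat[of _ "m * n" "m * n" _ "m * n" _ "m * n"])
  finally show ?thesis
    unfolding EGFP_P_def N unfolding defs transpose_map_mat
      transpose_elem_prod[OF m_ge_2 assignments(1)] transpose_elem_prod[OF m_ge_2 assignments(2)]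
      transpose_elem_prod[OF m_ge_2 assignments(3)] transpose_elem_prod[OF m_ge_2 assignments(4)] .
qed

lemma transpose_EGFP_G:
  "transpose_mat (EGFP_G m (EGFP_P m n Ac \<sigma> \<tau> \<sigma>1 X1 \<sigma>2 X2 \<tau>1 Y1 \<tau>2 Y2) \<sigma> \<sigma>1 \<sigma>2 A B C E) =
    EGFP_G m (EGFP_P m n (\<lambda>i. transpose_mat (Ac i)) (rev \<sigma>) (map uminus (rev \<gamma>) @ [- int m] @ map uminus (rev \<beta>))
      (rev \<sigma>2) (rev (map transpose_mat X2)) (rev \<sigma>1) (rev (map transpose_mat X1))
      (rev \<tau>2) (rev (map transpose_mat Y2)) (rev \<tau>1) (rev (map transpose_mat Y1)))
      (rev \<sigma>) (rev \<sigma>2) (rev \<sigma>1)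
      (transpose_mat A) (transpose_mat C) (transpose_mat B) (transpose_mat E)"
proof -
  have i: "inversions 0 (rev \<sigma>2 @ rev \<sigma>) = consecutions 0 (\<sigma> @ \<sigma>2)"
    "consecutions 0 (rev \<sigma> @ rev \<sigma>1) = inversions 0 (\<sigma>1 @ \<sigma>)"
    unfolding inversions_0_eq_climb consecutions_0_eq_climb by simp_all
  interpret poly: egfp_over m n r Ac A B C E \<sigma> \<beta> \<gamma> \<sigma>1 \<sigma>2 \<tau>1 \<tau>2 X1 X2 Y1 Y2
    "\<lambda>c. [:c:]" "[:0, 1:]"
    by unfold_locales auto
  have L: "EGFP_P m n Ac \<sigma> \<tau> \<sigma>1 X1 \<sigma>2 X2 \<tau>1 Y1 \<tau>2 Y2 \<in> carrier_mat (m * n) (m * n)"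
    using poly.L_over_carrier unfolding poly.L_over_def EGFP_P_def .
  have p: "pencil A E \<in> carrier_mat r r" using A E by (auto simp: pencil_def)
  show ?thesis
    unfolding EGFP_G_def i
    using dim_kronecker_e(1)[OF C] dim_kronecker_e(2)[OF B] transpose_EGFP_P
    by (subst transpose_four_block_mat[OF L _ _ p])
      (auto simp: transpose_map_mat transpose_kronecker transpose_pencil[OF A E(1)] rev_map)
qed

end

theorem theorem5p18:
  fixes m n r p :: nat
    and Ac :: "nat \<Rightarrow> complex mat"
    and A B C E :: "complex mat"
    and G :: "complex poly fract mat"
    and P S L LL :: "complex poly mat"
    and \<sigma> \<omega> \<tau> \<sigma>1 \<sigma>2 \<tau>1 \<tau>2 :: "int list"
    and X1 X2 Y1 Y2 :: "complex mat list"
    and Zmn Zr :: "complex poly mat"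
  assumes "m \<ge> 2"
    and "\<And>i. i \<le> m \<Longrightarrow> Ac i \<in> carrier_mat n n" and "Ac m \<noteq> 0\<^sub>m n n"
    and "P = mat_poly n m Ac"
    and "A \<in> carrier_mat r r" and "E \<in> carrier_mat r r" and "invertible_mat E"
    and "C \<in> carrier_mat n r" and "B \<in> carrier_mat r n"
    and "G = transfer_function P A B C E"
    and "S = system_matrix P A B C E"
    and "distinct (\<sigma> @ \<omega>)" and "set (\<sigma> @ \<omega>) = {0..int m}"
    and "\<tau> = map uminus \<omega>"
    and "set \<sigma>1 \<subseteq> set \<sigma> - {int m - 1, int m}" and "set \<sigma>2 \<subseteq> set \<sigma> - {int m - 1, int m}"
    and "SIP (\<sigma>1 @ \<sigma> @ \<sigma>2)"
    and "set \<tau>1 \<subseteq> set \<tau> - {- 1, - 0}" and "set \<tau>2 \<subseteq> set \<tau> - {- 1, - 0}"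
    and "SIP (\<tau>1 @ \<tau> @ \<tau>2)"
    and "nonsingular_assignment m n \<sigma>1 X1" and "nonsingular_assignment m n \<sigma>2 X2"
    and "nonsingular_assignment m n \<tau>1 Y1" and "nonsingular_assignment m n \<tau>2 Y2"
    and "0 \<in> set \<sigma>" and "- int m \<in> set \<tau>"
    and "L = EGFP_P m n Ac \<sigma> \<tau> \<sigma>1 X1 \<sigma>2 X2 \<tau>1 Y1 \<tau>2 Y2"
    and "LL = EGFP_G m L \<sigma> \<sigma>1 \<sigma>2 A B C E"
    and "Zmn \<in> carrier_mat (m * n) p" and "Zr \<in> carrier_mat r p"
  shows
    "(right_minimal_basis (rat_mat LL) (Zmn @\<^sub>r Zr) \<longrightarrow>
        right_minimal_basis (rat_mat S)
          (const_mat (kronecker (transpose_mat (e_col m (int m - consecutions 0 (\<sigma> @ \<sigma>2)))) (1\<^sub>m n))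
             * Zmn @\<^sub>r Zr)) \<and>
     (left_minimal_basis (rat_mat LL) (Zmn @\<^sub>r Zr) \<longrightarrow>
        left_minimal_basis (rat_mat S)
          (const_mat (kronecker (transpose_mat (e_col m (int m - inversions 0 (\<sigma>1 @ \<sigma>)))) (1\<^sub>m n))
             * Zmn @\<^sub>r Zr)) \<and>
     (\<forall>\<beta> \<gamma> \<alpha>. \<tau> = map uminus \<beta> @ [- int m] @ map uminus \<gamma> \<and> \<alpha> = rev \<beta> @ \<sigma> @ rev \<gamma> \<longrightarrow>
        distinct \<alpha> \<and> set \<alpha> = {0..int m - 1} \<and>
        (\<forall>\<epsilon>. right_minimal_indices (rat_mat LL) \<epsilon> \<longrightarrow>
           (\<forall>e \<in> set \<epsilon>. total_inversions m \<alpha> \<le> e) \<and>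
           right_minimal_indices (rat_mat S) (map (\<lambda>e. e - total_inversions m \<alpha>) \<epsilon>)) \<and>
        (\<forall>\<epsilon>. left_minimal_indices (rat_mat LL) \<epsilon> \<longrightarrow>
           (\<forall>e \<in> set \<epsilon>. total_consecutions m \<alpha> \<le> e) \<and>
           left_minimal_indices (rat_mat S) (map (\<lambda>e. e - total_consecutions m \<alpha>) \<epsilon>)))"
proof -
  have S_eq: "S = system_matrix (mat_poly n m Ac) A B C E" using assms(4,11) by simp
  \<comment> \<open>Negating \<open>\<tau>\<close> gives back \<open>\<omega> = (\<beta>, m, \<gamma>)\<close>, so \<open>\<alpha>\<close> is \<open>(\<sigma>, \<omega>)\<close> rearranged and without \<open>m\<close>.\<close>
  have perm: "distinct (rev \<beta> @ \<sigma> @ rev \<gamma>) \<and> set (rev \<beta> @ \<sigma> @ rev \<gamma>) = {0..<int m}"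
    if \<tau>: "\<tau> = map uminus \<beta> @ [- int m] @ map uminus \<gamma>" for \<beta> \<gamma>
  proof -
    have \<omega>: "\<omega> = \<beta> @ [int m] @ \<gamma>"
    proof -
      have "map uminus \<tau> = \<omega>" unfolding assms(14) by (simp add: comp_def)
      then show ?thesis unfolding \<tau> by (auto simp: comp_def)
    qed
    have "distinct (\<sigma> @ \<beta> @ [int m] @ \<gamma>)" "set (\<sigma> @ \<beta> @ [int m] @ \<gamma>) = {0..int m}"
      using assms(12,13) unfolding \<omega> by auto
    then have d: "distinct (rev \<beta> @ \<sigma> @ rev \<gamma>)" "int m \<notin> set (rev \<beta> @ \<sigma> @ rev \<gamma>)"
      "insert (int m) (set (rev \<beta> @ \<sigma> @ rev \<gamma>)) = {0..int m}" by auto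
    then have "set (rev \<beta> @ \<sigma> @ rev \<gamma>) = {0..int m} - {int m}" by blast
    also have "\<dots> = {0..<int m}" by auto
    finally show ?thesis using d(1) by blast
  qed
  have egfp: "egfp m n r Ac A B C E \<sigma> \<beta> \<gamma> \<sigma>1 \<sigma>2 \<tau>1 \<tau>2 X1 X2 Y1 Y2"
    if \<tau>: "\<tau> = map uminus \<beta> @ [- int m] @ map uminus \<gamma>" for \<beta> \<gamma>
  proof
    show "distinct (rev \<beta> @ \<sigma> @ rev \<gamma>)" "set (rev \<beta> @ \<sigma> @ rev \<gamma>) = {0..<int m}"
      using perm[OF \<tau>] by blast+
    show "set \<tau>1 \<subseteq> set (map uminus \<beta> @ [- int m] @ map uminus \<gamma>)"
      "set \<tau>2 \<subseteq> set (map uminus \<beta> @ [- int m] @ map uminus \<gamma>)"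
      "SIP (\<tau>1 @ (map uminus \<beta> @ [- int m] @ map uminus \<gamma>) @ \<tau>2)"
      using assms(18-20) unfolding \<tau> by blast+
    show "set \<sigma>1 \<subseteq> set \<sigma>" "set \<sigma>2 \<subseteq> set \<sigma>" using assms(15,16) by blast+
  qed (fact assms)+
  have swap: "inversions 0 (\<sigma>1 @ \<sigma>) = consecutions 0 (rev \<sigma> @ rev \<sigma>1)"
    unfolding inversions_0_eq_climb consecutions_0_eq_climb by simp
  obtain b g where \<tau>_split: "\<tau> = b @ [- int m] @ g" using assms(26) by (metis split_list append_Cons append_Nil)
  define \<beta> \<gamma> where "\<beta> = map uminus b" "\<gamma> = map uminus g"
  have \<tau>: "\<tau> = map uminus \<beta> @ [- int m] @ map uminus \<gamma>"
    unfolding \<tau>_split \<beta>_\<gamma>_def by (simp add: comp_def)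
  have LL: "LL = EGFP_G m (EGFP_P m n Ac \<sigma> (map uminus \<beta> @ [- int m] @ map uminus \<gamma>) \<sigma>1 X1 \<sigma>2 X2 \<tau>1 Y1 \<tau>2 Y2) \<sigma> \<sigma>1 \<sigma>2 A B C E"
    if "\<tau> = map uminus \<beta> @ [- int m] @ map uminus \<gamma>" for \<beta> \<gamma>
    unfolding assms(27,28) that ..
  have St: "transpose_mat (rat_mat S) = rat_mat (system_matrix (mat_poly n m (\<lambda>i. transpose_mat (Ac i)))
      (transpose_mat A) (transpose_mat C) (transpose_mat B) (transpose_mat E))"
    unfolding transpose_map_mat S_eq
    by (subst transpose_system_matrix[OF assms(2,5,6,8,9)]) simp_all
  show ?thesis
  proof (intro conjI impI allI; (elim conjE)?)
    assume "right_minimal_basis (rat_mat LL) (Zmn @\<^sub>r Zr)"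
    then show "right_minimal_basis (rat_mat S)
          (const_mat (kronecker (transpose_mat (e_col m (int m - consecutions 0 (\<sigma> @ \<sigma>2)))) (1\<^sub>m n))
             * Zmn @\<^sub>r Zr)"
      by (rule egfp.right_minimal_basis_recovery[OF egfp[OF \<tau>] LL[OF \<tau>] S_eq assms(29,30)])
  next
    assume "left_minimal_basis (rat_mat LL) (Zmn @\<^sub>r Zr)"
    then show "left_minimal_basis (rat_mat S)
          (const_mat (kronecker (transpose_mat (e_col m (int m - inversions 0 (\<sigma>1 @ \<sigma>)))) (1\<^sub>m n))
             * Zmn @\<^sub>r Zr)"
      \<comment> \<open>The recovery of right minimal bases, applied to the transposed data.\<close>
      unfolding left_minimal_basis_iff St swap unfolding transpose_map_mat LL[OF \<tau>]
        egfp.transpose_EGFP_G[OF egfp[OF \<tau>]]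
      by (rule egfp.right_minimal_basis_recovery[OF egfp.egfp_transpose[OF egfp[OF \<tau>]] refl refl assms(29,30)])
  next
    fix \<beta> \<gamma> \<alpha> assume \<tau>: "\<tau> = map uminus \<beta> @ [- int m] @ map uminus \<gamma>" and \<alpha>: "\<alpha> = rev \<beta> @ \<sigma> @ rev \<gamma>"
    show "distinct \<alpha>" "set \<alpha> = {0..int m - 1}" using perm[OF \<tau>] unfolding \<alpha> by auto
    fix \<epsilon>
    {
      assume "right_minimal_indices (rat_mat LL) \<epsilon>"
      note t = egfp.right_minimal_indices_shift[OF egfp[OF \<tau>] LL[OF \<tau>] S_eq this]
      show "right_minimal_indices (rat_mat S) (map (\<lambda>e. e - total_inversions m \<alpha>) \<epsilon>)"
        "\<forall>e \<in> set \<epsilon>. total_inversions m \<alpha> \<le> e"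
        using t unfolding \<alpha> by blast+
    }
    {
      assume "left_minimal_indices (rat_mat LL) \<epsilon>"
      then have "right_minimal_indices (transpose_mat (rat_mat LL)) \<epsilon>" unfolding left_minimal_indices_iff .
      note t = egfp.right_minimal_indices_shift[OF egfp.egfp_transpose[OF egfp[OF \<tau>]] refl refl
          this[unfolded transpose_map_mat LL[OF \<tau>] egfp.transpose_EGFP_G[OF egfp[OF \<tau>]]]]
      have r: "rev (rev \<gamma>) @ rev \<sigma> @ rev (rev \<beta>) = rev \<alpha>" unfolding \<alpha> by simp
      show "left_minimal_indices (rat_mat S) (map (\<lambda>e. e - total_consecutions m \<alpha>) \<epsilon>)"
        "\<forall>e \<in> set \<epsilon>. total_consecutions m \<alpha> \<le> e"
        using t unfolding r total_inversions_rev left_minimal_indices_iff St by blast+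
    }
  qed
qed

end
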